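(* Let $M$ be a smooth $n$-manifold and let $A\subset TM\setminus \mathbf{0}$ be an open conic subset with $\pi(A)=M$. Here $(x,y)$ denote the natural coordinates on $TU$ induced by a chart $(U,x)$ of $M$, and repeated indices are summed. (1) Any $A$-anisotropic connection $\nabla$, with Christoffel symbols $\Gamma_{ij}^a(x,y)$, canonically defines a nonlinear connection $\nu^\nabla$ on $A\to M$ whose components in any chart are $$N_i^a(x,y)=\Gamma_{ij}^a(x,y)\,y^j .$$ Moreover, if $\nabla$ is homogeneous, then $\nu^\nabla$ is homogeneous. (2) Any nonlinear connection $\nu$ on $A\to M$, with components $N_i^a(x,y)$, canonically defines an $A$-anisotropic connection $\nabla^\nu$ whose Christoffel symbols in any chart are $$\Gamma_{ij}^a(x,y)=\frac{\partial N_i^a}{\partial y^j}(x,y).$$ Moreover, if $\nu$ is homogeneous, then $\nabla^\nu$ is homogeneous and $\nu^{(\nabla^\nu)}=\nu$. In particular, the map $\nabla\mapsto\nu^\nabla$ is onto when restricted to a map from the set of homogeneous $A$-anisotropic connections to the set of homogeneous nonlinear connections on $A\to M$. (3) For any homogeneous nonlinear connection $\nu$ on $A\to M$, $$\{\nabla\ A\text{-anisotropic connection}: \nu^\nabla=\nu\}=\{\nabla^\nu+Q:\ Q\in\mathcal{T}^1_2(M_A)\text{ and } Q_{ij}^k\,y^j=0\}.$$ (4) The map $\nabla\mapsto\nu^\nabla$, restricted to the (classical) affine connections on $M$ (regarded as $A$-anisotropic connections) and with values in the linear connections on $A\to M$, is well defined and bijective.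
   Context: $\pi:TM\to M$ is the projection, $\pi_A=\pi|_A$; $A\subset TM\setminus\mathbf 0$ conic means $\lambda v\in A$ for all $v\in A,\lambda>0$. All objects are smooth. **Anisotropic tensors.** $\mathcal{T}^r_s(M_A)$ is the space of smooth sections over $A$ of the pullback bundle $\pi_A^*(\bigotimes^{r}TM\otimes\bigotimes^{s}T^*M)$; in coordinates the components are smooth functions of $(x,y)\in A\cap TU$ which transform tensorially. In particular $\mathcal{T}_0^0(M_A)=\mathcal F(A)$ (smooth functions on $A$). **Anisotropic connection.** An $A$-anisotropic connection is a map $\nabla:\mathfrak X(M)\times\mathfrak X(M)\to\mathcal T^1_0(M_A)$ that is additive in both entries, with $\nabla_X(fY)=(X(f)Y)\circ\pi_A+(f\circ\pi_A)\nabla_XY$ and $\nabla_{fX+hY}Z=(f\circ\pi_A)\nabla_XZ+(h\circ\pi_A)\nabla_YZ$ for $f,h\in\mathcal F(M)$. Its Christoffel symbols in a chart $(U,x)$ are the functions $\Gamma^a_{ij}:A\cap TU\to\mathbb R$ with $(\nabla_{\partial_i}\partial_j)_v=\Gamma^a_{ij}(v)\,\partial_a|_{\pi(v)}$. They satisfy under changes of chart $$\bar\Gamma_{ij}^a=\frac{\partial\bar x^a}{\partial x^m}\Big(\frac{\partial^2x^m}{\partial\bar x^i\partial\bar x^j}+\frac{\partial x^k}{\partial\bar x^i}\frac{\partial x^l}{\partial\bar x^j}\Gamma^m_{kl}\Big)$$ (evaluated at the same $v\in A$), and conversely any family of local functions satisfying this rule on a coordinate atlas determines a unique $A$-anisotropic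 connection. $\nabla$ is homogeneous if $(\nabla_XY)_{\lambda v}=(\nabla_XY)_v$ for all $X,Y$, $v\in A$, $\lambda>0$, i.e. $\Gamma^a_{ij}(x,\lambda y)=\Gamma^a_{ij}(x,y)$. For $Q\in\mathcal T^1_2(M_A)$, $\nabla+Q$ is the anisotropic connection with Christoffel symbols $\Gamma_{ij}^k+Q_{ij}^k$. A classical (Koszul) affine connection on $M$ is regarded as an $A$-anisotropic connection, whose Christoffel symbols do not depend on $y$. **Nonlinear connection.** A nonlinear connection on $A\to M$ is a smooth distribution $\mathcal HA\subset TA$ with $TA=\mathcal HA\oplus\mathcal VA$, where $\mathcal VA=\ker T\pi_A$ is the vertical bundle. Its components $N_i^a:A\cap TU\to\mathbb R$ are given by $\mathcal H_{(x,y)}A=\mathrm{Span}_i\{\partial_{x^i}-N_i^a(x,y)\partial_{y^a}\}$. Under changes of chart they satisfy $$\bar N_j^a(\bar x,\bar y)=\frac{\partial x^i}{\partial\bar x^j}\Big(-\frac{\partial^2\bar x^a}{\partial x^i\partial x^l}y^l+\frac{\partial\bar x^a}{\partial x^b}N_i^b(x,y)\Big),$$ and conversely any family of local functions satisfying this rule defines a nonlinear connection. It is homogeneous if $\mathcal HA$ is invariant under the homotheties $h_\lambda(v)=\lambda v$, $\lambda>0$, equivalently $N_i^a(x,\lambda y)=\lambda N_i^a(x,y)$. It is linear if in every chart $N_i^a(x,y)=\Gamma_{ij}^a(x)\,y^j$ for some smooth functions $\Gamma_{ij}^a$ on $U$. *)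

theory Defs
  imports "HOL-Analysis.Analysis" "HOL-Library.Function_Algebras"
begin

section \<open>Pointwise vector space structure on function types\<close>

instantiation "fun" :: (type, scaleR) scaleR
begin

definition scaleR_fun_def: "r *\<^sub>R f = (\<lambda>x. r *\<^sub>R f x)"

instance ..

end

lemma scaleR_fun_apply [simp]: "(r *\<^sub>R f) x = r *\<^sub>R f x"
  by (simp add: scaleR_fun_def)

instance "fun" :: (type, real_vector) real_vector
  by standard (simp_all add: fun_eq_iff scaleR_add_right scaleR_add_left)


section \<open>Smooth maps between Euclidean spaces\<close>

text \<open>Only used for open \<open>S\<close>: all iterated directional derivatives exist as Frechet
  derivatives and are continuous.\<close>

primrec Ck_on :: "nat \<Rightarrow> 'e::euclidean_space set \<Rightarrow> ('e \<Rightarrow> 'f::euclidean_space) \<Rightarrow> bool" where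
  "Ck_on 0 S f \<longleftrightarrow> continuous_on S f"
| "Ck_on (Suc k) S f \<longleftrightarrow> (\<forall>x\<in>S. f differentiable (at x)) \<and>
     (\<forall>u. Ck_on k S (\<lambda>x. frechet_derivative f (at x) u))"

definition smooth_on :: "'e::euclidean_space set \<Rightarrow> ('e \<Rightarrow> 'f::euclidean_space) \<Rightarrow> bool" where
  "smooth_on S f \<longleftrightarrow> (\<forall>k. Ck_on k S f)"


section \<open>Smooth manifolds\<close>

text \<open>A chart is a domain together with a coordinate map; the values of the map outside of the
  domain are irrelevant.\<close>

type_synonym ('a, 'e) chart = "'a set \<times> ('a \<Rightarrow> 'e)"

abbreviation chart_inv :: "('a, 'e) chart \<Rightarrow> 'e \<Rightarrow> 'a" where
  "chart_inv c \<equiv> inv_into (fst c) (snd c)"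

definition points :: "('a, 'e) chart set \<Rightarrow> 'a set" where
  "points \<A> = (\<Union>c\<in>\<A>. fst c)"

text \<open>The topology for which all charts are homeomorphisms onto open sets: \<open>W\<close> is open iff its
  image under every chart is open.\<close>

definition atlas_topology :: "('a, 'e::euclidean_space) chart set \<Rightarrow> 'a topology" where
  "atlas_topology \<A> =
     topology (\<lambda>W. W \<subseteq> points \<A> \<and> (\<forall>c\<in>\<A>. open (chart_inv c -` W \<inter> snd c ` fst c)))"

lemma openin_atlas_topology:
  "openin (atlas_topology \<A>) W \<longleftrightarrow>
     W \<subseteq> points \<A> \<and> (\<forall>c\<in>\<A>. open (chart_inv c -` W \<inter> snd c ` fst c))"
proof -
  let ?P = "\<lambda>W. W \<subseteq> points \<A> \<and> (\<forall>c\<in>\<A>. open (chart_inv c -` W \<inter> snd c ` fst c))"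
  have "istopology ?P"
    unfolding istopology_def
  proof (rule conjI; intro allI impI)
    fix S T assume P: "?P S" "?P T"
    have "chart_inv c -` (S \<inter> T) \<inter> snd c ` fst c =
        (chart_inv c -` S \<inter> snd c ` fst c) \<inter> (chart_inv c -` T \<inter> snd c ` fst c)" for c
      by blast
    then have "open (chart_inv c -` (S \<inter> T) \<inter> snd c ` fst c)" if "c \<in> \<A>" for c
      using P that by (metis open_Int)
    then show "?P (S \<inter> T)"
      using P by blast
  next
    fix K assume K: "\<forall>S\<in>K. ?P S"
    have "chart_inv c -` (\<Union> K) \<inter> snd c ` fst c = (\<Union>S\<in>K. chart_inv c -` S \<inter> snd c ` fst c)" for c
      by blast
    then have "open (chart_inv c -` (\<Union> K) \<inter> snd c ` fst c)" if "c \<in> \<A>" for c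
      using K that by (metis (no_types, lifting) open_UN)
    then show "?P (\<Union> K)"
      using K by blast
  qed
  then show ?thesis
    by (simp add: atlas_topology_def)
qed

text \<open>The atlas is not required to be maximal; a maximal one is a special case.\<close>

definition smooth_manifold :: "('a, 'e::euclidean_space) chart set \<Rightarrow> bool" where
  "smooth_manifold \<A> \<longleftrightarrow>
     (\<forall>c\<in>\<A>. inj_on (snd c) (fst c) \<and> open (snd c ` fst c)) \<and>
     (\<forall>c\<in>\<A>. \<forall>d\<in>\<A>. open (snd c ` (fst c \<inter> fst d)) \<and>
        smooth_on (snd c ` (fst c \<inter> fst d)) (snd d \<circ> chart_inv c)) \<and>
     Hausdorff_space (atlas_topology \<A>) \<and> second_countable (atlas_topology \<A>)"

definition smooth_fun :: "('a, 'e::euclidean_space) chart set \<Rightarrow> ('a \<Rightarrow> real) \<Rightarrow> bool" where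
  "smooth_fun \<A> f \<longleftrightarrow> (\<forall>c\<in>\<A>. smooth_on (snd c ` fst c) (f \<circ> chart_inv c))"


section \<open>Tangent vectors\<close>

text \<open>A tangent vector at \<open>p\<close> assigns to every chart around \<open>p\<close> its components in that chart,
  subject to the tensorial transformation law.\<close>

type_synonym ('a, 'e) tvec = "('a, 'e) chart \<Rightarrow> 'e"

definition tangent_space ::
  "('a, 'e::euclidean_space) chart set \<Rightarrow> 'a \<Rightarrow> ('a, 'e) tvec set" where
  "tangent_space \<A> p = {w.
     (\<forall>c\<in>\<A>. \<forall>d\<in>\<A>. p \<in> fst c \<inter> fst d \<longrightarrow>
        w d = frechet_derivative (snd d \<circ> chart_inv c) (at (snd c p)) (w c)) \<and>
     (\<forall>c. \<not> (c \<in> \<A> \<and> p \<in> fst c) \<longrightarrow> w c = 0)}"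

text \<open>The tangent vector at \<open>p\<close> with components \<open>u\<close> in the chart \<open>c\<close>.\<close>

definition tvec_of :: "('a, 'e::euclidean_space) chart set \<Rightarrow> ('a, 'e) chart \<Rightarrow> 'a \<Rightarrow> 'e \<Rightarrow> ('a, 'e) tvec"
  where "tvec_of \<A> c p u = (\<lambda>d. if d \<in> \<A> \<and> p \<in> fst d
     then frechet_derivative (snd d \<circ> chart_inv c) (at (snd c p)) u else 0)"

definition some_chart :: "('a, 'e) chart set \<Rightarrow> 'a \<Rightarrow> ('a, 'e) chart" where
  "some_chart \<A> p = (SOME c. c \<in> \<A> \<and> p \<in> fst c)"

definition tangent_map ::
  "('a, 'e::euclidean_space) chart set \<Rightarrow> ('b, 'f::euclidean_space) chart set \<Rightarrow>
   ('a \<Rightarrow> 'b) \<Rightarrow> 'a \<Rightarrow> ('a, 'e) tvec \<Rightarrow> ('b, 'f) tvec" where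
  "tangent_map \<A> \<B> f p w = (\<lambda>d. if d \<in> \<B> \<and> f p \<in> fst d
     then let c = some_chart \<A> p in
       frechet_derivative (snd d \<circ> f \<circ> chart_inv c) (at (snd c p)) (w c)
     else 0)"

text \<open>The derivative of a function in the direction of a tangent vector.\<close>

definition dir_deriv ::
  "('a, 'e::euclidean_space) chart set \<Rightarrow> 'a \<Rightarrow> ('a, 'e) tvec \<Rightarrow> ('a \<Rightarrow> real) \<Rightarrow> real" where
  "dir_deriv \<A> p w f = (let c = some_chart \<A> p in
     frechet_derivative (f \<circ> chart_inv c) (at (snd c p)) (w c))"

definition smooth_field_on ::
  "('a, 'e::euclidean_space) chart set \<Rightarrow> 'a set \<Rightarrow> ('a \<Rightarrow> ('a, 'e) tvec) \<Rightarrow> bool" where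
  "smooth_field_on \<A> W X \<longleftrightarrow> (\<forall>p\<in>W. X p \<in> tangent_space \<A> p) \<and>
     (\<forall>c\<in>\<A>. smooth_on (snd c ` (W \<inter> fst c)) (\<lambda>z. X (chart_inv c z) c))"

text \<open>Vector fields are extended by zero outside of the manifold, so that equality of functions
  is equality of vector fields and the operations are the pointwise ones.\<close>

definition vector_fields ::
  "('a, 'e::euclidean_space) chart set \<Rightarrow> ('a \<Rightarrow> ('a, 'e) tvec) set" where
  "vector_fields \<A> = {X. smooth_field_on \<A> (points \<A>) X \<and> (\<forall>p. p \<notin> points \<A> \<longrightarrow> X p = 0)}"

text \<open>A smooth distribution on an open set \<open>D\<close>, as a subset of the tangent bundle restricted
  to \<open>D\<close> with fibre \<open>H `` {p}\<close> over \<open>p\<close>.\<close>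

definition smooth_distribution_on ::
  "('a, 'e::euclidean_space) chart set \<Rightarrow> 'a set \<Rightarrow> ('a \<times> ('a, 'e) tvec) set \<Rightarrow> bool" where
  "smooth_distribution_on \<A> D H \<longleftrightarrow> H \<subseteq> Sigma D (tangent_space \<A>) \<and>
     (\<exists>k::nat. \<forall>p\<in>D. \<exists>W E. openin (atlas_topology \<A>) W \<and> p \<in> W \<and> W \<subseteq> D \<and>
        (\<forall>i<k. smooth_field_on \<A> W (E i)) \<and>
        (\<forall>q\<in>W. inj_on (\<lambda>i. E i q) {..<k} \<and> independent ((\<lambda>i. E i q) ` {..<k}) \<and>
           H `` {q} = span ((\<lambda>i. E i q) ` {..<k})))"


section \<open>The tangent bundle\<close>

type_synonym ('a, 'e) tpoint = "'a \<times> ('a, 'e) tvec"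

definition tangent_bundle ::
  "('a, 'e::euclidean_space) chart set \<Rightarrow> ('a, 'e) tpoint set" where
  "tangent_bundle \<A> = Sigma (points \<A>) (tangent_space \<A>)"

text \<open>The natural coordinates \<open>(x, y)\<close> on \<open>TU\<close> induced by a chart \<open>(U, x)\<close>.\<close>

definition T_chart :: "('a, 'e::euclidean_space) chart set \<Rightarrow> ('a, 'e) chart \<Rightarrow>
    (('a, 'e) tpoint, 'e \<times> 'e) chart" where
  "T_chart \<A> c = (Sigma (fst c) (tangent_space \<A>), \<lambda>v. (snd c (fst v), snd v c))"

definition T_atlas :: "('a, 'e::euclidean_space) chart set \<Rightarrow>
    (('a, 'e) tpoint, 'e \<times> 'e) chart set" where
  "T_atlas \<A> = T_chart \<A> ` \<A>"

definition dilate :: "real \<Rightarrow> ('a, 'e::euclidean_space) tpoint \<Rightarrow> ('a, 'e) tpoint" where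
  "dilate r v = (fst v, r *\<^sub>R snd v)"

definition conic_set :: "('a, 'e::euclidean_space) tpoint set \<Rightarrow> bool" where
  "conic_set A \<longleftrightarrow> (\<forall>v\<in>A. \<forall>r>0. dilate r v \<in> A)"

text \<open>Below, \<open>A\<close> always is an open subset of the tangent bundle. Since it is open, the tangent
  space of \<open>A\<close> at \<open>v\<close> is that of the tangent bundle.\<close>

definition dom_in :: "('a, 'e::euclidean_space) chart set \<Rightarrow> ('a, 'e) tpoint set \<Rightarrow>
    ('a, 'e) chart \<Rightarrow> ('a, 'e) tpoint set" where
  "dom_in \<A> A c = A \<inter> fst (T_chart \<A> c)"

definition smooth_in_chart :: "('a, 'e::euclidean_space) chart set \<Rightarrow> ('a, 'e) tpoint set \<Rightarrow>
    ('a, 'e) chart \<Rightarrow> (('a, 'e) tpoint \<Rightarrow> 'f::euclidean_space) \<Rightarrow> bool" where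
  "smooth_in_chart \<A> A c F \<longleftrightarrow>
     smooth_on (snd (T_chart \<A> c) ` dom_in \<A> A c) (F \<circ> chart_inv (T_chart \<A> c))"

text \<open>The coordinate fields \<open>\<partial>\<^sub>i\<close> of a chart of \<open>M\<close>.\<close>

definition coord_field :: "('a, real^'n) chart set \<Rightarrow> ('a, real^'n) chart \<Rightarrow> 'n::finite \<Rightarrow>
    'a \<Rightarrow> ('a, real^'n) tvec" where
  "coord_field \<A> c i p = tvec_of \<A> c p (axis i 1)"


section \<open>Anisotropic tensors\<close>

text \<open>\<open>\<T>\<^sup>1\<^sub>0(M\<^sub>A)\<close>: sections over \<open>A\<close> of the pullback of the tangent bundle, again extended by zero.\<close>

definition aniso_fields :: "('a, real^'n::finite) chart set \<Rightarrow> ('a, real^'n) tpoint set \<Rightarrow>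
    (('a, real^'n) tpoint \<Rightarrow> ('a, real^'n) tvec) set" where
  "aniso_fields \<A> A = {Z. (\<forall>v\<in>A. Z v \<in> tangent_space \<A> (fst v)) \<and> (\<forall>v. v \<notin> A \<longrightarrow> Z v = 0) \<and>
     (\<forall>c\<in>\<A>. smooth_in_chart \<A> A c (\<lambda>v. Z v c))}"

text \<open>The component \<open>Q\<^sub>i\<^sub>j\<^sup>k\<close> in the chart \<open>c\<close>.\<close>

definition tensor_comp :: "('a, real^'n) chart set \<Rightarrow>
    (('a, real^'n) tpoint \<Rightarrow> ('a, real^'n) tvec \<Rightarrow> ('a, real^'n) tvec \<Rightarrow> ('a, real^'n) tvec) \<Rightarrow>
    ('a, real^'n) chart \<Rightarrow> 'n::finite \<Rightarrow> 'n \<Rightarrow> 'n \<Rightarrow> ('a, real^'n) tpoint \<Rightarrow> real" where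
  "tensor_comp \<A> Q c i j k v = Q v (coord_field \<A> c i (fst v)) (coord_field \<A> c j (fst v)) c $ k"

text \<open>\<open>\<T>\<^sup>1\<^sub>2(M\<^sub>A)\<close>: an element of \<open>T\<^sub>pM \<otimes> T\<^sub>p\<^sup>*M \<otimes> T\<^sub>p\<^sup>*M\<close> is regarded as a bilinear map
  \<open>T\<^sub>pM \<times> T\<^sub>pM \<rightarrow> T\<^sub>pM\<close>, where \<open>p\<close> is the base point of \<open>v\<close>.\<close>

definition aniso_tensors_1_2 :: "('a, real^'n::finite) chart set \<Rightarrow> ('a, real^'n) tpoint set \<Rightarrow>
    (('a, real^'n) tpoint \<Rightarrow> ('a, real^'n) tvec \<Rightarrow> ('a, real^'n) tvec \<Rightarrow> ('a, real^'n) tvec) set" where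
  "aniso_tensors_1_2 \<A> A = {Q.
     (\<forall>v\<in>A. let T = tangent_space \<A> (fst v) in
        (\<forall>w\<in>T. \<forall>u\<in>T. Q v w u \<in> T) \<and>
        (\<forall>w\<in>T. \<forall>w'\<in>T. \<forall>u\<in>T. \<forall>r s. Q v (r *\<^sub>R w + s *\<^sub>R w') u = r *\<^sub>R Q v w u + s *\<^sub>R Q v w' u) \<and>
        (\<forall>w\<in>T. \<forall>u\<in>T. \<forall>u'\<in>T. \<forall>r s. Q v w (r *\<^sub>R u + s *\<^sub>R u') = r *\<^sub>R Q v w u + s *\<^sub>R Q v w u')) \<and>
     (\<forall>v w u. \<not> (v \<in> A \<and> w \<in> tangent_space \<A> (fst v) \<and> u \<in> tangent_space \<A> (fst v)) \<longrightarrow>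
        Q v w u = 0) \<and>
     (\<forall>c\<in>\<A>. \<forall>i j k. smooth_in_chart \<A> A c (tensor_comp \<A> Q c i j k))}"


section \<open>Anisotropic and affine connections\<close>

type_synonym ('a, 'n) aniso_conn =
  "('a \<Rightarrow> ('a, real^'n) tvec) \<Rightarrow> ('a \<Rightarrow> ('a, real^'n) tvec) \<Rightarrow>
   ('a, real^'n) tpoint \<Rightarrow> ('a, real^'n) tvec"

definition aniso_connections :: "('a, real^'n::finite) chart set \<Rightarrow> ('a, real^'n) tpoint set \<Rightarrow>
    ('a, 'n) aniso_conn set" where
  "aniso_connections \<A> A =
     {D \<in> vector_fields \<A> \<rightarrow>\<^sub>E vector_fields \<A> \<rightarrow>\<^sub>E aniso_fields \<A> A.
       (\<forall>X\<in>vector_fields \<A>. \<forall>Y\<in>vector_fields \<A>. \<forall>Z\<in>vector_fields \<A>.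
          D (X + Y) Z = D X Z + D Y Z \<and> D X (Y + Z) = D X Y + D X Z) \<and>
       (\<forall>X\<in>vector_fields \<A>. \<forall>Y\<in>vector_fields \<A>. \<forall>f. smooth_fun \<A> f \<longrightarrow>
          (\<forall>v\<in>A. D X (\<lambda>p. f p *\<^sub>R Y p) v =
             dir_deriv \<A> (fst v) (X (fst v)) f *\<^sub>R Y (fst v) + f (fst v) *\<^sub>R D X Y v)) \<and>
       (\<forall>X\<in>vector_fields \<A>. \<forall>Y\<in>vector_fields \<A>. \<forall>Z\<in>vector_fields \<A>. \<forall>f h.
          smooth_fun \<A> f \<and> smooth_fun \<A> h \<longrightarrow>
          (\<forall>v\<in>A. D (\<lambda>p. f p *\<^sub>R X p + h p *\<^sub>R Y p) Z v =
             f (fst v) *\<^sub>R D X Z v + h (fst v) *\<^sub>R D Y Z v))}"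

text \<open>The Christoffel symbol \<open>\<Gamma>\<^sup>a\<^sub>i\<^sub>j(v)\<close> in the chart \<open>c\<close>. The coordinate fields are only defined on
  the chart domain; as a connection is local, they are replaced by arbitrary global vector fields
  that coincide with them near the base point of \<open>v\<close>.\<close>

definition agree_near :: "('a, 'e::euclidean_space) chart set \<Rightarrow> 'a \<Rightarrow> ('a \<Rightarrow> 'b) \<Rightarrow> ('a \<Rightarrow> 'b) \<Rightarrow> bool"
  where "agree_near \<A> p X Y \<longleftrightarrow>
     (\<exists>W. openin (atlas_topology \<A>) W \<and> p \<in> W \<and> (\<forall>q\<in>W. X q = Y q))"

definition christoffel :: "('a, real^'n) chart set \<Rightarrow> ('a, 'n) aniso_conn \<Rightarrow>
    ('a, real^'n) chart \<Rightarrow> 'n::finite \<Rightarrow> 'n \<Rightarrow> 'n \<Rightarrow> ('a, real^'n) tpoint \<Rightarrow> real" where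
  "christoffel \<A> D c a i j v = (THE r. \<forall>X\<in>vector_fields \<A>. \<forall>Y\<in>vector_fields \<A>.
     agree_near \<A> (fst v) X (coord_field \<A> c i) \<and> agree_near \<A> (fst v) Y (coord_field \<A> c j) \<longrightarrow>
     D X Y v c $ a = r)"

definition homogeneous_aniso :: "('a, real^'n::finite) chart set \<Rightarrow> ('a, real^'n) tpoint set \<Rightarrow>
    ('a, 'n) aniso_conn \<Rightarrow> bool" where
  "homogeneous_aniso \<A> A D \<longleftrightarrow>
     (\<forall>X\<in>vector_fields \<A>. \<forall>Y\<in>vector_fields \<A>. \<forall>v\<in>A. \<forall>r>0. D X Y (dilate r v) = D X Y v)"

definition add_tensor :: "('a, real^'n::finite) chart set \<Rightarrow> ('a, real^'n) tpoint set \<Rightarrow>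
    ('a, 'n) aniso_conn \<Rightarrow>
    (('a, real^'n) tpoint \<Rightarrow> ('a, real^'n) tvec \<Rightarrow> ('a, real^'n) tvec \<Rightarrow> ('a, real^'n) tvec) \<Rightarrow>
    ('a, 'n) aniso_conn" where
  "add_tensor \<A> A D Q = (THE D'. D' \<in> aniso_connections \<A> A \<and>
     (\<forall>c\<in>\<A>. \<forall>v\<in>dom_in \<A> A c. \<forall>i j k.
        christoffel \<A> D' c k i j v = christoffel \<A> D c k i j v + tensor_comp \<A> Q c i j k v))"

text \<open>Koszul connections.\<close>

definition affine_connections :: "('a, real^'n::finite) chart set \<Rightarrow>
    (('a \<Rightarrow> ('a, real^'n) tvec) \<Rightarrow> ('a \<Rightarrow> ('a, real^'n) tvec) \<Rightarrow> 'a \<Rightarrow> ('a, real^'n) tvec) set" where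
  "affine_connections \<A> =
     {D \<in> vector_fields \<A> \<rightarrow>\<^sub>E vector_fields \<A> \<rightarrow>\<^sub>E vector_fields \<A>.
       (\<forall>X\<in>vector_fields \<A>. \<forall>Y\<in>vector_fields \<A>. \<forall>Z\<in>vector_fields \<A>.
          D (X + Y) Z = D X Z + D Y Z \<and> D X (Y + Z) = D X Y + D X Z) \<and>
       (\<forall>X\<in>vector_fields \<A>. \<forall>Y\<in>vector_fields \<A>. \<forall>f. smooth_fun \<A> f \<longrightarrow>
          (\<forall>p\<in>points \<A>. D X (\<lambda>p. f p *\<^sub>R Y p) p =
             dir_deriv \<A> p (X p) f *\<^sub>R Y p + f p *\<^sub>R D X Y p)) \<and>
       (\<forall>X\<in>vector_fields \<A>. \<forall>Y\<in>vector_fields \<A>. \<forall>Z\<in>vector_fields \<A>. \<forall>f h.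
          smooth_fun \<A> f \<and> smooth_fun \<A> h \<longrightarrow>
          (\<forall>p\<in>points \<A>. D (\<lambda>p. f p *\<^sub>R X p + h p *\<^sub>R Y p) Z p =
             f p *\<^sub>R D X Z p + h p *\<^sub>R D Y Z p))}"

definition as_aniso :: "('a, real^'n::finite) chart set \<Rightarrow> ('a, real^'n) tpoint set \<Rightarrow>
    (('a \<Rightarrow> ('a, real^'n) tvec) \<Rightarrow> ('a \<Rightarrow> ('a, real^'n) tvec) \<Rightarrow> 'a \<Rightarrow> ('a, real^'n) tvec) \<Rightarrow>
    ('a, 'n) aniso_conn" where
  "as_aniso \<A> A D =
     (\<lambda>X\<in>vector_fields \<A>. \<lambda>Y\<in>vector_fields \<A>. \<lambda>v. if v \<in> A then D X Y (fst v) else 0)"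


section \<open>Nonlinear connections\<close>

type_synonym ('a, 'n) distr =
  "(('a, real^'n) tpoint \<times> (('a, real^'n) tpoint, (real^'n) \<times> (real^'n)) tvec) set"

text \<open>The fibre at \<open>v\<close> of the kernel of the differential of the projection \<open>TM \<rightarrow> M\<close>.\<close>

definition vertical_space :: "('a, real^'n::finite) chart set \<Rightarrow> ('a, real^'n) tpoint \<Rightarrow>
    (('a, real^'n) tpoint, (real^'n) \<times> (real^'n)) tvec set" where
  "vertical_space \<A> v =
     {w \<in> tangent_space (T_atlas \<A>) v. tangent_map (T_atlas \<A>) \<A> fst v w = 0}"

definition nonlinear_connections :: "('a, real^'n::finite) chart set \<Rightarrow>
    ('a, real^'n) tpoint set \<Rightarrow> ('a, 'n) distr set" where
  "nonlinear_connections \<A> A = {H. smooth_distribution_on (T_atlas \<A>) A H \<and>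
     (\<forall>v\<in>A. H `` {v} \<inter> vertical_space \<A> v = {0} \<and>
        {h + u |h u. h \<in> H `` {v} \<and> u \<in> vertical_space \<A> v} = tangent_space (T_atlas \<A>) v)}"

text \<open>The component \<open>N\<^sub>i\<^sup>a(v)\<close> in the chart \<open>c\<close>. In the induced coordinates, \<open>\<partial>\<close> with respect to
  \<open>x\<^sup>i\<close> is \<open>(axis i 1, 0)\<close> and \<open>\<partial>\<close> with respect to \<open>y\<^sup>a\<close> is \<open>(0, axis a 1)\<close>.\<close>

definition nl_comp :: "('a, real^'n) chart set \<Rightarrow> ('a, 'n) distr \<Rightarrow> ('a, real^'n) chart \<Rightarrow>
    'n::finite \<Rightarrow> 'n \<Rightarrow> ('a, real^'n) tpoint \<Rightarrow> real" where
  "nl_comp \<A> H c i a v = (THE N :: 'n \<Rightarrow> 'n \<Rightarrow> real.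
     (\<lambda>w. w (T_chart \<A> c)) ` (H `` {v}) =
       span (range (\<lambda>i. (axis i 1, 0) - (\<Sum>a\<in>UNIV. N i a *\<^sub>R (0, axis a 1))))) i a"

definition homogeneous_nl :: "('a, real^'n::finite) chart set \<Rightarrow> ('a, real^'n) tpoint set \<Rightarrow>
    ('a, 'n) distr \<Rightarrow> bool" where
  "homogeneous_nl \<A> A H \<longleftrightarrow> (\<forall>v\<in>A. \<forall>r>0.
     tangent_map (T_atlas \<A>) (T_atlas \<A>) (dilate r) v ` (H `` {v}) = H `` {dilate r v})"

definition linear_connections :: "('a, real^'n::finite) chart set \<Rightarrow>
    ('a, real^'n) tpoint set \<Rightarrow> ('a, 'n) distr set" where
  "linear_connections \<A> A = {H \<in> nonlinear_connections \<A> A.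
     \<forall>c\<in>\<A>. \<exists>G :: 'n \<Rightarrow> 'n \<Rightarrow> 'n \<Rightarrow> 'a \<Rightarrow> real.
       (\<forall>a i j. smooth_on (snd c ` fst c) (G a i j \<circ> chart_inv c)) \<and>
       (\<forall>v\<in>dom_in \<A> A c. \<forall>i a.
          nl_comp \<A> H c i a v = (\<Sum>j\<in>UNIV. G a i j (fst v) * snd v c $ j))}"


section \<open>Passing between the two kinds of connections\<close>

definition nl_from_aniso :: "('a, real^'n::finite) chart set \<Rightarrow> ('a, real^'n) tpoint set \<Rightarrow>
    ('a, 'n) aniso_conn \<Rightarrow> ('a, 'n) distr \<Rightarrow> bool" where
  "nl_from_aniso \<A> A D H \<longleftrightarrow> H \<in> nonlinear_connections \<A> A \<and>
     (\<forall>c\<in>\<A>. \<forall>v\<in>dom_in \<A> A c. \<forall>i a.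
        nl_comp \<A> H c i a v = (\<Sum>j\<in>UNIV. christoffel \<A> D c a i j v * snd v c $ j))"

text \<open>Partial derivative with respect to \<open>y\<^sup>j\<close> in the coordinates induced by the chart \<open>c\<close>.\<close>

definition partial_y :: "('a, real^'n) chart set \<Rightarrow> ('a, real^'n) chart \<Rightarrow> 'n::finite \<Rightarrow>
    (('a, real^'n) tpoint \<Rightarrow> real) \<Rightarrow> ('a, real^'n) tpoint \<Rightarrow> real" where
  "partial_y \<A> c j F v = frechet_derivative (F \<circ> chart_inv (T_chart \<A> c))
     (at (snd (T_chart \<A> c) v)) (0, axis j 1)"

definition aniso_from_nl :: "('a, real^'n::finite) chart set \<Rightarrow> ('a, real^'n) tpoint set \<Rightarrow>
    ('a, 'n) distr \<Rightarrow> ('a, 'n) aniso_conn \<Rightarrow> bool" where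
  "aniso_from_nl \<A> A H D \<longleftrightarrow> D \<in> aniso_connections \<A> A \<and>
     (\<forall>c\<in>\<A>. \<forall>v\<in>dom_in \<A> A c. \<forall>a i j.
        christoffel \<A> D c a i j v = partial_y \<A> c j (nl_comp \<A> H c i a) v)"

definition nl_of :: "('a, real^'n::finite) chart set \<Rightarrow> ('a, real^'n) tpoint set \<Rightarrow>
    ('a, 'n) aniso_conn \<Rightarrow> ('a, 'n) distr" where
  "nl_of \<A> A D = (THE H. nl_from_aniso \<A> A D H)"

definition aniso_of :: "('a, real^'n::finite) chart set \<Rightarrow> ('a, real^'n) tpoint set \<Rightarrow>
    ('a, 'n) distr \<Rightarrow> ('a, 'n) aniso_conn" where
  "aniso_of \<A> A H = (THE D. aniso_from_nl \<A> A H D)"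

end

theory Submission
  imports Defs
begin

text \<open>In a chart, an anisotropic connection is a smooth family of bilinear maps \<open>G\<close> with
  \<open>\<nabla>\<^sub>X Y = DY(X) + G(X, Y)\<close>, and a nonlinear connection is a smooth family of linear maps \<open>N\<close> whose
  graphs of \<open>- N\<close> are the horizontal spaces. For a transition map \<open>\<tau>\<close> the transformation laws are
  \<open>G'(D\<tau> u, D\<tau> w) + D\<^sup>2\<tau>(u, w) = D\<tau> G(u, w)\<close> and \<open>N'(D\<tau> u) + D\<^sup>2\<tau>(u, y) = D\<tau> N(u)\<close>. Setting \<open>w = y\<close>
  turns the first law into the second for \<open>N = G(\<sqdot>, y)\<close>, and differentiating the second law with
  respect to \<open>y\<close> gives the first one for \<open>G = \<partial>N/\<partial>y\<close>. By Euler's theorem \<open>\<partial>N/\<partial>y\<close> is a preimage of \<open>N\<close> if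
  \<open>N\<close> is homogeneous, and two preimages differ by a tensor that vanishes on \<open>y\<close>. If \<open>G\<close> does not depend
  on \<open>y\<close>, then \<open>G = \<partial>N/\<partial>y\<close>, whence the bijection between affine and linear connections.
  The smoothness of \<open>N\<close> follows from that of a local frame of the distribution by Cramer's rule.\<close>

section \<open>Smooth functions between Euclidean spaces\<close>

text \<open>The definitions speak of global objects: a connection acts on vector fields of the whole
  manifold, and Christoffel symbols, components and the passage between the two kinds of connections
  are definite descriptions. Cutoff functions reduce this to coordinates: they extend coordinate
  fields to global ones, smoothly because compact sets are closed in a Hausdorff space. Subtracting
  the flat connection of a chart leaves an expression that is linear over functions in both entries,
  hence depends only on values at a point; this gives the description of the Christoffel symbols a
  meaning. Conversely, coordinate expressions with the right law define a global object when
  evaluated in an arbitrarily chosen chart. Each description is settled by building an object from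
  such data and by showing that its coordinates determine it. The tangent bundle is treated as a
  second atlas, so the calculus in charts is developed once and used twice; the second derivative in
  the law of \<open>N\<close> is the off-diagonal part of the Jacobian of its transition maps
  \<open>(x, y) \<mapsto> (\<tau> x, D\<tau>(x) y)\<close>.\<close>

lemma Ck_on_cong:
  assumes "open S" "\<And>x. x \<in> S \<Longrightarrow> f x = g x" "Ck_on k S f"
  shows "Ck_on k S g"
  using assms(2,3)
proof (induction k arbitrary: f g)
  case 0
  then show ?case
    by (metis Ck_on.simps(1) continuous_on_cong)
next
  case (Suc k)
  have d: "f differentiable (at x)" if "x \<in> S" for x
    using Suc.prems that by simp
  have fg: "frechet_derivative f (at x) = frechet_derivative g (at x)" if "x \<in> S" for x
    using frechet_derivative_transform_within_open[OF d[OF that] assms(1) that] Suc.prems(1) by blast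
  have "g differentiable (at x)" if "x \<in> S" for x
    using d[OF that] Suc.prems(1) assms(1) that
    by (meson differentiable_def has_derivative_transform_within_open)
  moreover have "Ck_on k S (\<lambda>x. frechet_derivative g (at x) u)" for u
    using Suc.IH[of "\<lambda>x. frechet_derivative f (at x) u"] Suc.prems(2) fg by simp
  ultimately show ?case by simp
qed

lemma Ck_on_subset: "Ck_on k S f \<Longrightarrow> T \<subseteq> S \<Longrightarrow> Ck_on k T f"
  by (induction k arbitrary: f) (auto intro: continuous_on_subset)

lemma Ck_on_Suc_imp: "Ck_on (Suc k) S f \<Longrightarrow> Ck_on k S f"
proof (induction k arbitrary: f)
  case 0
  then show ?case
    by (simp add: continuous_at_imp_continuous_on differentiable_imp_continuous_within)
next
  case (Suc k)
  then show ?case by (metis Ck_on.simps(2))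
qed

lemma Ck_on_local:
  assumes "open S" "\<And>x. x \<in> S \<Longrightarrow> \<exists>V. open V \<and> x \<in> V \<and> Ck_on k V f"
  shows "Ck_on k S f"
  using assms(2)
proof (induction k arbitrary: f)
  case 0
  have "isCont f x" if x: "x \<in> S" for x
  proof -
    obtain V where "open V" "x \<in> V" "continuous_on V f"
      using 0[OF x] by auto
    then show ?thesis
      using continuous_on_eq_continuous_at by blast
  qed
  then show ?case
    by (simp add: continuous_at_imp_continuous_on)
next
  case (Suc k)
  have 1: "\<forall>x\<in>S. f differentiable (at x)"
    using Suc.prems by force
  have 2: "Ck_on k S (\<lambda>x. frechet_derivative f (at x) u)" for u
    by (rule Suc.IH) (use Suc.prems in force)
  show ?case using 1 2 by simp
qed

text \<open>Lets a derivative be exhibited by a formula instead of through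
  \<open>frechet_derivative\<close>. The closure properties below use it for their induction
  step.\<close>

lemma has_derivative_Ck_on_SucI:
  assumes "open S" "\<And>x. x \<in> S \<Longrightarrow> (f has_derivative f' x) (at x)" "\<And>u. Ck_on k S (\<lambda>x. f' x u)"
  shows "Ck_on (Suc k) S f"
proof -
  have "frechet_derivative f (at x) = f' x" if "x \<in> S" for x
    using assms(2)[OF that] frechet_derivative_at by metis
  then have "Ck_on k S (\<lambda>x. frechet_derivative f (at x) u)" for u
    using Ck_on_cong[OF assms(1) _ assms(3)[of u]] by simp
  then show ?thesis
    using assms(2) by (auto intro: differentiableI)
qed

lemma Ck_on_Suc_has_derivative:
  "Ck_on (Suc k) S f \<Longrightarrow> x \<in> S \<Longrightarrow> (f has_derivative frechet_derivative f (at x)) (at x)"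
  by (simp add: frechet_derivative_works)

lemma Ck_on_const: "Ck_on k S (\<lambda>x. c)"
  by (induction k arbitrary: c) auto

lemma Ck_on_linear:
  assumes "bounded_linear f" "open S"
  shows "Ck_on k S f"
proof (cases k)
  case 0
  then show ?thesis
    using assms by (simp add: linear_continuous_on)
next
  case (Suc m)
  show ?thesis
    unfolding Suc
    by (rule has_derivative_Ck_on_SucI[where f' = "\<lambda>x. f"])
      (use assms bounded_linear_imp_has_derivative Ck_on_const in auto)
qed

lemma Ck_on_add:
  "open S \<Longrightarrow> Ck_on k S f \<Longrightarrow> Ck_on k S g \<Longrightarrow> Ck_on k S (\<lambda>x. f x + g x)"
proof (induction k arbitrary: f g)
  case 0
  then show ?case by (simp add: continuous_on_add)
next
  case (Suc k)
  show ?case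
  proof (rule has_derivative_Ck_on_SucI[OF Suc.prems(1)])
    show "((\<lambda>x. f x + g x) has_derivative
        (\<lambda>u. frechet_derivative f (at x) u + frechet_derivative g (at x) u)) (at x)" if "x \<in> S" for x
      using Suc.prems that by (intro has_derivative_add Ck_on_Suc_has_derivative)
    show "Ck_on k S (\<lambda>x. frechet_derivative f (at x) u + frechet_derivative g (at x) u)" for u
      using Suc.prems by (intro Suc.IH) auto
  qed
qed

lemma Ck_on_sum:
  assumes "open S" "\<And>i. i \<in> I \<Longrightarrow> Ck_on k S (f i)"
  shows "Ck_on k S (\<lambda>x. \<Sum>i\<in>I. f i x)"
  using assms(2)
proof (induction I rule: infinite_finite_induct)
  case (insert i I)
  then show ?case
    using Ck_on_add[OF assms(1), of k "f i" "\<lambda>x. \<Sum>i\<in>I. f i x"] by simp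
qed (auto simp: Ck_on_const)

lemma Ck_on_bilinear:
  assumes h: "bounded_bilinear h" and S: "open S"
  shows "Ck_on k S f \<Longrightarrow> Ck_on k S g \<Longrightarrow> Ck_on k S (\<lambda>x. h (f x) (g x))"
proof (induction k arbitrary: f g)
  case 0
  then show ?case by (simp add: bounded_bilinear.continuous_on[OF h])
next
  case (Suc k)
  show ?case
  proof (rule has_derivative_Ck_on_SucI[OF S])
    show "((\<lambda>x. h (f x) (g x)) has_derivative
        (\<lambda>u. h (f x) (frechet_derivative g (at x) u) + h (frechet_derivative f (at x) u) (g x))) (at x)"
      if "x \<in> S" for x
      using Suc.prems that by (intro bounded_bilinear.FDERIV[OF h] Ck_on_Suc_has_derivative)
    show "Ck_on k S (\<lambda>x. h (f x) (frechet_derivative g (at x) u) + h (frechet_derivative f (at x) u) (g x))"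
      for u
      using Suc.prems by (intro Ck_on_add[OF S] Suc.IH Ck_on_Suc_imp[of k S f] Ck_on_Suc_imp[of k S g]) auto
  qed
qed

lemma linear_expansion_Basis:
  fixes f :: "'e::euclidean_space \<Rightarrow> 'f::real_vector"
  assumes "linear f"
  shows "f u = (\<Sum>b\<in>Basis. (u \<bullet> b) *\<^sub>R f b)"
proof -
  have "f u = f (\<Sum>b\<in>Basis. (u \<bullet> b) *\<^sub>R b)"
    by (simp add: euclidean_representation)
  then show ?thesis
    using assms by (simp add: linear_sum linear_scale)
qed

text \<open>By the chain rule the derivative of \<open>g\<close> is taken at \<open>f x\<close> in a
  direction that varies with \<open>x\<close>, whereas \<open>Ck_on\<close> controls fixed
  directions only. Expanding the direction in \<open>Basis\<close> leaves products of smooth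
  coefficients with derivatives of \<open>g\<close> in fixed directions, to which the induction
  hypothesis applies.\<close>

lemma Ck_on_compose:
  assumes S: "open S" and T: "open T" and st: "\<And>x. x \<in> S \<Longrightarrow> f x \<in> T"
  shows "Ck_on k S f \<Longrightarrow> Ck_on k T g \<Longrightarrow> Ck_on k S (\<lambda>x. g (f x))"
  using st
proof (induction k arbitrary: g)
  case 0
  then show ?case
    using continuous_on_compose2[of T g S f] by auto
next
  case (Suc k)
  have d: "(g has_derivative frechet_derivative g (at (f x))) (at (f x))" if "x \<in> S" for x
    using Suc.prems that by (intro Ck_on_Suc_has_derivative) auto
  show ?case
  proof (rule has_derivative_Ck_on_SucI[OF S])
    show "((\<lambda>x. g (f x)) has_derivative
      (\<lambda>u. \<Sum>b\<in>Basis. (frechet_derivative f (at x) u \<bullet> b) *\<^sub>R frechet_derivative g (at (f x)) b)) (at x)"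
      if x: "x \<in> S" for x
    proof -
      have "((\<lambda>x. g (f x)) has_derivative
        (\<lambda>u. frechet_derivative g (at (f x)) (frechet_derivative f (at x) u))) (at x)"
        using has_derivative_compose[OF Ck_on_Suc_has_derivative[OF Suc.prems(1) x] d[OF x]] .
      then show ?thesis
        by (subst (asm) linear_expansion_Basis[OF has_derivative_linear[OF d[OF x]]])
    qed
    show "Ck_on k S (\<lambda>x. \<Sum>b\<in>Basis. (frechet_derivative f (at x) u \<bullet> b) *\<^sub>R
        frechet_derivative g (at (f x)) b)" for u
    proof (intro Ck_on_sum[OF S] Ck_on_bilinear[OF bounded_bilinear_scaleR S]
        Ck_on_bilinear[OF bounded_bilinear_inner S] Ck_on_const)
      show "Ck_on k S (\<lambda>x. frechet_derivative f (at x) u)"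
        using Suc.prems by simp
      show "Ck_on k S (\<lambda>x. frechet_derivative g (at (f x)) b)" for b
        using Suc.prems Ck_on_Suc_imp
        by (intro Suc.IH[of "\<lambda>y. frechet_derivative g (at y) b"]) auto
    qed
  qed
qed

lemma Ck_on_inverse:
  fixes f :: "'e::euclidean_space \<Rightarrow> real"
  assumes S: "open S" and nz: "\<And>x. x \<in> S \<Longrightarrow> f x \<noteq> 0"
  shows "Ck_on k S f \<Longrightarrow> Ck_on k S (\<lambda>x. inverse (f x))"
proof (induction k)
  case 0
  then show ?case using nz by (simp add: continuous_on_inverse)
next
  case (Suc k)
  note bl = Ck_on_bilinear[OF bounded_bilinear_mult S]
  have fk: "Ck_on k S (\<lambda>x. inverse (f x))"
    using Suc by (simp add: Ck_on_Suc_imp del: Ck_on.simps)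
  show ?case
  proof (rule has_derivative_Ck_on_SucI[OF S])
    show "((\<lambda>x. inverse (f x)) has_derivative
      (\<lambda>u. (-1) * (inverse (f x) * frechet_derivative f (at x) u * inverse (f x)))) (at x)"
      if x: "x \<in> S" for x
      using Deriv.has_derivative_inverse[OF nz[OF x] Ck_on_Suc_has_derivative[OF Suc.prems x]] by simp
    show "Ck_on k S (\<lambda>x. (-1) * (inverse (f x) * frechet_derivative f (at x) u * inverse (f x)))" for u
      using Suc.prems by (intro bl Ck_on_const fk) auto
  qed
qed

text \<open>Smoothness of the germ. The closure properties can then be combined without keeping
  track of open sets; on an open set it gives back \<open>smooth_on\<close> by
  \<open>smooth_on_iff_smooth_at\<close>.\<close>

definition smooth_at :: "('e::euclidean_space \<Rightarrow> 'f::euclidean_space) \<Rightarrow> 'e \<Rightarrow> bool" where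
  "smooth_at f x \<longleftrightarrow> (\<exists>V. open V \<and> x \<in> V \<and> smooth_on V f)"

lemma smooth_on_iff_smooth_at:
  assumes "open S"
  shows "smooth_on S f \<longleftrightarrow> (\<forall>x\<in>S. smooth_at f x)"
proof
  assume "\<forall>x\<in>S. smooth_at f x"
  then show "smooth_on S f"
    unfolding smooth_on_def smooth_at_def using Ck_on_local[OF assms] by metis
qed (use assms in \<open>auto simp: smooth_at_def\<close>)

lemma eventually_isCont_compose:
  assumes "isCont h x" "eventually P (nhds (h x))"
  shows "eventually (\<lambda>z. P (h z)) (nhds x)"
  using eventually_compose_filterlim[OF assms(2)] assms(1)
  by (simp add: isCont_def tendsto_at_iff_tendsto_nhds)

lemma eventually_smooth_at: "smooth_at f x \<Longrightarrow> eventually (smooth_at f) (nhds x)"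
  unfolding smooth_at_def eventually_nhds by auto

lemma smooth_at_cong:
  assumes "eventually (\<lambda>z. f z = g z) (nhds x)" "smooth_at f x"
  shows "smooth_at g x"
proof -
  obtain V W where "open V" "x \<in> V" "smooth_on V f" "open W" "x \<in> W" "\<forall>z\<in>W. f z = g z"
    using assms unfolding smooth_at_def eventually_nhds by blast
  then have "smooth_on (V \<inter> W) g"
    unfolding smooth_on_def
    using Ck_on_cong[of "V \<inter> W" f g] Ck_on_subset[of _ V f "V \<inter> W"] by (auto simp: open_Int)
  then show ?thesis
    unfolding smooth_at_def using \<open>open V\<close> \<open>x \<in> V\<close> \<open>open W\<close> \<open>x \<in> W\<close> by blast
qed

lemma smooth_at_has_derivative:
  "smooth_at f x \<Longrightarrow> (f has_derivative frechet_derivative f (at x)) (at x)"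
  unfolding smooth_at_def smooth_on_def using Ck_on_Suc_has_derivative by blast

lemma smooth_at_linear_frechet: "smooth_at f x \<Longrightarrow> linear (frechet_derivative f (at x))"
  using has_derivative_linear smooth_at_has_derivative by blast

lemma smooth_at_isCont: "smooth_at f x \<Longrightarrow> isCont f x"
  using has_derivative_continuous smooth_at_has_derivative by blast

lemma smooth_at_frechet: "smooth_at f x \<Longrightarrow> smooth_at (\<lambda>z. frechet_derivative f (at z) u) x"
  unfolding smooth_at_def smooth_on_def by (metis Ck_on.simps(2))

lemma smooth_at_const [simp]: "smooth_at (\<lambda>z. c) x"
  unfolding smooth_at_def smooth_on_def using Ck_on_const by blast

lemma smooth_at_linear: "bounded_linear f \<Longrightarrow> smooth_at f x"
  unfolding smooth_at_def smooth_on_def using Ck_on_linear[OF _ open_UNIV] by blast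

lemma smooth_at_ident: "smooth_at (\<lambda>z. z) x"
  by (simp add: smooth_at_linear bounded_linear_ident)

lemma smooth_at_bilinear:
  assumes "bounded_bilinear h" "smooth_at f x" "smooth_at g x"
  shows "smooth_at (\<lambda>z. h (f z) (g z)) x"
proof -
  obtain V W where "open V" "x \<in> V" "smooth_on V f" "open W" "x \<in> W" "smooth_on W g"
    using assms unfolding smooth_at_def by blast
  then have "smooth_on (V \<inter> W) (\<lambda>z. h (f z) (g z))"
    unfolding smooth_on_def
    by (intro allI Ck_on_bilinear[OF assms(1)])
      (auto intro: Ck_on_subset[of _ V f] Ck_on_subset[of _ W g])
  then show ?thesis
    unfolding smooth_at_def using \<open>open V\<close> \<open>x \<in> V\<close> \<open>open W\<close> \<open>x \<in> W\<close> by blast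
qed

lemma smooth_at_add:
  assumes "smooth_at f x" "smooth_at g x"
  shows "smooth_at (\<lambda>z. f z + g z) x"
proof -
  obtain V W where "open V" "x \<in> V" "smooth_on V f" "open W" "x \<in> W" "smooth_on W g"
    using assms unfolding smooth_at_def by blast
  then have "smooth_on (V \<inter> W) (\<lambda>z. f z + g z)"
    unfolding smooth_on_def
    by (intro allI Ck_on_add) (auto intro: Ck_on_subset[of _ V f] Ck_on_subset[of _ W g])
  then show ?thesis
    unfolding smooth_at_def using \<open>open V\<close> \<open>x \<in> V\<close> \<open>open W\<close> \<open>x \<in> W\<close> by blast
qed

lemmas smooth_at_scaleR = smooth_at_bilinear[OF bounded_bilinear_scaleR]

lemma smooth_at_mult:
  fixes f g :: "'e::euclidean_space \<Rightarrow> real"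
  shows "smooth_at f x \<Longrightarrow> smooth_at g x \<Longrightarrow> smooth_at (\<lambda>z. f z * g z) x"
  by (rule smooth_at_bilinear[OF bounded_bilinear_mult])

lemma smooth_at_minus: "smooth_at f x \<Longrightarrow> smooth_at (\<lambda>z. - f z) x"
  using smooth_at_scaleR[of "\<lambda>z. -1" x f] by simp

lemma smooth_at_diff: "smooth_at f x \<Longrightarrow> smooth_at g x \<Longrightarrow> smooth_at (\<lambda>z. f z - g z) x"
  using smooth_at_add[of f x "\<lambda>z. - g z"] smooth_at_minus[of g x] by simp

lemma smooth_at_sum:
  assumes "\<And>i. i \<in> I \<Longrightarrow> smooth_at (f i) x"
  shows "smooth_at (\<lambda>z. \<Sum>i\<in>I. f i z) x"
  using assms
proof (induction I rule: infinite_finite_induct)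
  case (insert i I)
  then show ?case
    using smooth_at_add[of "f i" x "\<lambda>z. \<Sum>i\<in>I. f i z"] by simp
qed auto

lemma smooth_at_prod:
  fixes f :: "'i \<Rightarrow> 'e::euclidean_space \<Rightarrow> real"
  assumes "\<And>i. i \<in> I \<Longrightarrow> smooth_at (f i) x"
  shows "smooth_at (\<lambda>z. \<Prod>i\<in>I. f i z) x"
  using assms
proof (induction I rule: infinite_finite_induct)
  case (insert i I)
  then show ?case
    using smooth_at_mult[of "f i" x "\<lambda>z. \<Prod>i\<in>I. f i z"] by simp
qed auto

lemma smooth_at_inverse:
  fixes f :: "'e::euclidean_space \<Rightarrow> real"
  assumes "smooth_at f x" "f x \<noteq> 0"
  shows "smooth_at (\<lambda>z. inverse (f z)) x"
proof -
  obtain V where V: "open V" "x \<in> V" "smooth_on V f"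
    using assms unfolding smooth_at_def by blast
  have "eventually (\<lambda>z. f z \<noteq> 0) (nhds x)"
    by (rule eventually_isCont_compose[OF smooth_at_isCont[OF assms(1)] t1_space_nhds[OF assms(2)]])
  then obtain W where W: "open W" "x \<in> W" "\<forall>z\<in>W. f z \<noteq> 0"
    unfolding eventually_nhds by blast
  have "smooth_on (V \<inter> W) (\<lambda>z. inverse (f z))"
    unfolding smooth_on_def
    using Ck_on_inverse[of "V \<inter> W" f] V W Ck_on_subset[of _ V f "V \<inter> W"]
    by (auto simp: smooth_on_def open_Int)
  then show ?thesis
    unfolding smooth_at_def using V W by blast
qed

lemma smooth_at_divide:
  fixes f :: "'e::euclidean_space \<Rightarrow> real"
  shows "smooth_at f x \<Longrightarrow> smooth_at g x \<Longrightarrow> g x \<noteq> 0 \<Longrightarrow> smooth_at (\<lambda>z. f z / g z) x"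
  using smooth_at_mult[of f x "\<lambda>z. inverse (g z)"] smooth_at_inverse[of g x]
  by (simp add: divide_inverse)

lemma smooth_at_compose:
  assumes "smooth_at f x" "smooth_at g (f x)"
  shows "smooth_at (\<lambda>z. g (f z)) x"
proof -
  obtain V W where VW: "open V" "x \<in> V" "smooth_on V f" "open W" "f x \<in> W" "smooth_on W g"
    using assms unfolding smooth_at_def by blast
  have "continuous_on V f"
    using VW(3) unfolding smooth_on_def by (metis Ck_on.simps(1))
  then have o: "open (f -` W \<inter> V)"
    using VW continuous_on_open_vimage by blast
  have "smooth_on (f -` W \<inter> V) (\<lambda>z. g (f z))"
    unfolding smooth_on_def
    using Ck_on_compose[OF o \<open>open W\<close>, of f _ g] VW Ck_on_subset[of _ V f "f -` W \<inter> V"]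
    by (auto simp: smooth_on_def)
  then show ?thesis
    unfolding smooth_at_def using VW o by blast
qed

lemma frechet_derivative_compose_smooth_at:
  assumes "smooth_at f x" "smooth_at g (f x)"
  shows "frechet_derivative (\<lambda>z. g (f z)) (at x) u =
    frechet_derivative g (at (f x)) (frechet_derivative f (at x) u)"
  using frechet_derivative_at[OF has_derivative_compose[OF smooth_at_has_derivative[OF assms(1)]
        smooth_at_has_derivative[OF assms(2)]]] by metis

text \<open>Functions that agree near \<open>x\<close> have the same derivatives at
  \<open>x\<close>, so the choice operator in \<open>frechet_derivative\<close> makes the same
  choice for both, even where there is no derivative.\<close>

lemma frechet_derivative_cong:
  assumes "eventually (\<lambda>z. f z = g z) (nhds x)"
  shows "frechet_derivative f (at x) = frechet_derivative g (at x)"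
proof -
  have "(g has_derivative D) (at x)"
    if "eventually (\<lambda>z. f z = g z) (nhds x)" "(f has_derivative D) (at x)" for f g :: "'a \<Rightarrow> 'b" and D
  proof (rule has_derivative_transform_eventually[OF that(2)])
    show "eventually (\<lambda>z. f z = g z) (at x)"
      using that(1) by (simp add: eventually_at_filter eventually_mono)
    show "f x = g x"
      using that(1) by (rule eventually_nhds_x_imp_x)
  qed simp
  from this[of f g] this[of g f] have "(f has_derivative D) (at x) \<longleftrightarrow> (g has_derivative D) (at x)" for D
    using assms by (auto simp: eq_commute)
  then show ?thesis
    by (simp add: frechet_derivative_def)
qed

text \<open>Base point and direction may both vary. The direction is expanded in
  \<open>Basis\<close>, because smoothness of a derivative is known for fixed directions only. This
  is what makes Jacobians of transition maps smooth.\<close>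

lemma smooth_at_frechet_at:
  assumes "smooth_at f (h x)" "smooth_at h x" "smooth_at g x"
  shows "smooth_at (\<lambda>z. frechet_derivative f (at (h z)) (g z)) x"
proof -
  have "eventually (\<lambda>z. smooth_at f (h z)) (nhds x)"
    by (rule eventually_isCont_compose[OF smooth_at_isCont[OF assms(2)] eventually_smooth_at[OF assms(1)]])
  then have "eventually (\<lambda>z. (\<Sum>b\<in>Basis. (g z \<bullet> b) *\<^sub>R frechet_derivative f (at (h z)) b) =
      frechet_derivative f (at (h z)) (g z)) (nhds x)"
    by eventually_elim
      (rule linear_expansion_Basis[symmetric], rule smooth_at_linear_frechet)
  moreover have "smooth_at (\<lambda>z. \<Sum>b\<in>Basis. (g z \<bullet> b) *\<^sub>R frechet_derivative f (at (h z)) b) x"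
    by (intro smooth_at_sum smooth_at_scaleR smooth_at_bilinear[OF bounded_bilinear_inner] assms
        smooth_at_const smooth_at_compose[of h x "\<lambda>y. frechet_derivative f (at y) _"] smooth_at_frechet)
  ultimately show ?thesis
    by (rule smooth_at_cong)
qed

lemma smooth_at_linear_compose:
  "bounded_linear h \<Longrightarrow> smooth_at f x \<Longrightarrow> smooth_at (\<lambda>z. h (f z)) x"
  using smooth_at_compose smooth_at_linear by blast

lemma smooth_at_Pair:
  assumes "smooth_at f x" "smooth_at g x"
  shows "smooth_at (\<lambda>z. (f z, g z)) x"
proof -
  have l: "bounded_linear (\<lambda>z. (z, 0))" "bounded_linear (\<lambda>z. (0, z))"
    by (auto intro!: bounded_linear_Pair bounded_linear_ident bounded_linear_zero)
  show ?thesis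
    using smooth_at_add[OF smooth_at_linear_compose[OF l(1) assms(1)]
        smooth_at_linear_compose[OF l(2) assms(2)]] by simp
qed

lemmas smooth_at_fst = smooth_at_linear_compose[OF bounded_linear_fst]
lemmas smooth_at_snd = smooth_at_linear_compose[OF bounded_linear_snd]
lemmas smooth_at_nth = smooth_at_linear_compose[OF bounded_linear_vec_nth]

lemma vec_expansion: "(x::real^'n) = (\<Sum>i\<in>UNIV. x $ i *\<^sub>R axis i 1)"
  by (simp add: vec_eq_iff axis_def if_distrib cong: if_cong)

lemma smooth_at_vec_iff:
  fixes f :: "'e::euclidean_space \<Rightarrow> real^'n"
  shows "smooth_at f x \<longleftrightarrow> (\<forall>i. smooth_at (\<lambda>z. f z $ i) x)"
proof
  assume "\<forall>i. smooth_at (\<lambda>z. f z $ i) x"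
  then have "smooth_at (\<lambda>z. \<Sum>i\<in>UNIV. f z $ i *\<^sub>R axis i (1::real)) x"
    by (intro smooth_at_sum smooth_at_scaleR) auto
  moreover have "(\<lambda>z. \<Sum>i\<in>UNIV. f z $ i *\<^sub>R axis i 1) = f"
    by (rule ext) (rule vec_expansion[symmetric])
  ultimately show "smooth_at f x"
    by simp
qed (auto intro: smooth_at_nth)

lemma smooth_at_det:
  fixes M :: "'e::euclidean_space \<Rightarrow> real^'n^'n"
  assumes "\<And>i j. smooth_at (\<lambda>z. M z $ i $ j) x"
  shows "smooth_at (\<lambda>z. det (M z)) x"
  unfolding det_def by (intro smooth_at_sum smooth_at_mult smooth_at_const smooth_at_prod assms)

subsection \<open>A smooth cutoff function\<close>

text \<open>The functions \<open>t \<mapsto> p (1 / t) exp (- 1 / t)\<close> for polynomials \<open>p\<close>, extended by zero to \<open>t \<le> 0\<close>,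
  are closed under differentiation.\<close>

definition exp_poly :: "real poly \<Rightarrow> real \<Rightarrow> real" where
  "exp_poly p t = (if t > 0 then poly p (inverse t) * exp (- inverse t) else 0)"

text \<open>With \<open>s = 1 / t\<close> the limit from the right is that of
  \<open>poly p s * exp (- s)\<close> at infinity, where the exponential beats every power; from the
  left the function vanishes.\<close>

lemma exp_poly_tendsto_0: "(exp_poly p \<longlongrightarrow> 0) (at 0)"
proof -
  have "((\<lambda>s. poly p s * exp (- s)) \<longlongrightarrow> 0) at_top"
  proof -
    have "((\<lambda>s. coeff p i * (s ^ i / exp s)) \<longlongrightarrow> coeff p i * 0) at_top" for i
      by (intro tendsto_intros tendsto_power_div_exp_0)
    then have "((\<lambda>s. \<Sum>i\<le>degree p. coeff p i * (s ^ i / exp s)) \<longlongrightarrow> (\<Sum>i\<le>degree p. 0)) at_top"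
      by (intro tendsto_sum) auto
    then show ?thesis
      by (simp add: poly_altdef exp_minus divide_inverse sum_distrib_right mult.assoc)
  qed
  then have "((\<lambda>t. poly p (inverse t) * exp (- inverse t)) \<longlongrightarrow> 0) (at_right 0)"
    using filterlim_compose[OF _ filterlim_inverse_at_top_right] by fastforce
  then have "(exp_poly p \<longlongrightarrow> 0) (at_right 0)"
    by (rule Lim_transform_eventually)
      (auto simp: exp_poly_def eventually_at_filter)
  moreover have "(exp_poly p \<longlongrightarrow> 0) (at_left 0)"
    by (rule Lim_transform_eventually[OF tendsto_const])
      (auto simp: exp_poly_def eventually_at_filter)
  ultimately show ?thesis
    by (simp add: filterlim_at_split)
qed

text \<open>With \<open>s = 1 / t\<close> one has \<open>ds/dt = - s^2\<close>, so the derivative of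
  \<open>p(s) exp(- s)\<close> is \<open>s^2 (p(s) - p'(s)) exp(- s)\<close>. The polynomial
  \<open>[:0, 0, 1:]\<close> is the factor \<open>s^2\<close>.\<close>

lemma exp_poly_has_derivative:
  "(exp_poly p has_real_derivative exp_poly ([:0, 0, 1:] * (p - pderiv p)) t) (at t)"
proof -
  consider "t > 0" | "t = 0" | "t < 0" by linarith
  then show ?thesis
  proof cases
    case 1
    have "((\<lambda>t. poly p (inverse t) * exp (- inverse t)) has_real_derivative
        exp_poly ([:0, 0, 1:] * (p - pderiv p)) t) (at t)"
      using 1 by (auto intro!: derivative_eq_intros DERIV_chain2[OF poly_DERIV]
          simp: exp_poly_def field_simps power2_eq_square)
    then show ?thesis
      by (rule DERIV_cong_ev[OF refl _ refl, THEN iffD1, rotated])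
        (use 1 eventually_nhds_in_open[of "{0<..}" t] in
          \<open>auto elim!: eventually_mono simp: exp_poly_def\<close>)
  next
    case 2
    \<comment> \<open>Division by \<open>h\<close> multiplies the polynomial by
      \<open>1 / h\<close>, so the difference quotient at 0 is again a function of this kind and
      tends to 0.\<close>
    have "exp_poly p h / h = exp_poly ([:0, 1:] * p) h" for h
      by (simp add: exp_poly_def divide_inverse)
    then have "((\<lambda>h. (exp_poly p (0 + h) - exp_poly p 0) / h) \<longlongrightarrow> 0) (at 0)"
      using exp_poly_tendsto_0[of "[:0, 1:] * p"] by (simp add: exp_poly_def[of p 0])
    then show ?thesis
      using 2 by (simp add: DERIV_def exp_poly_def[of _ 0])
  next
    case 3
    have "((\<lambda>t. 0) has_real_derivative 0) (at t)"
      by simp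
    then have "(exp_poly p has_real_derivative 0) (at t)"
      by (rule DERIV_cong_ev[OF refl _ refl, THEN iffD1, rotated])
        (use 3 eventually_nhds_in_open[of "{..<0}" t] in
          \<open>auto elim!: eventually_mono simp: exp_poly_def\<close>)
    then show ?thesis
      using 3 by (simp add: exp_poly_def)
  qed
qed

lemma smooth_at_exp_poly: "smooth_at (exp_poly p) t"
proof -
  have "Ck_on k UNIV (exp_poly p)" for k
  proof (induction k arbitrary: p)
    case 0
    then show ?case
      by (auto simp: continuous_on_eq_continuous_at intro: DERIV_isCont[OF exp_poly_has_derivative])
  next
    case (Suc k)
    show ?case
      by (rule has_derivative_Ck_on_SucI[OF open_UNIV
            exp_poly_has_derivative[unfolded has_field_derivative_def]])
        (intro Ck_on_bilinear[OF bounded_bilinear_mult open_UNIV] Suc.IH Ck_on_const)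
  qed
  then show ?thesis
    unfolding smooth_at_def smooth_on_def by blast
qed

lemma ex_smooth_cutoff:
  fixes x :: "'e::euclidean_space"
  assumes "r > 0"
  obtains f :: "'e \<Rightarrow> real" where "\<And>z. smooth_at f z" "\<And>z. dist x z < r \<Longrightarrow> f z = 1"
    "\<And>z. dist x z \<ge> 2 * r \<Longrightarrow> f z = 0"
proof
  define h where "h = exp_poly 1"
  have h: "h t > 0 \<longleftrightarrow> t > 0" "h t \<ge> 0" for t
    by (auto simp: h_def exp_poly_def)
  have h0: "h t = 0" if "t \<le> 0" for t
    using that by (simp add: h_def exp_poly_def)
  \<comment> \<open>The squared distance is smooth also at the centre \<open>x\<close>, unlike the
    distance.\<close>
  define s where "s z = (x - z) \<bullet> (x - z)" for z
  have s: "s z = (dist x z)\<^sup>2" for z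
    by (simp add: s_def dist_norm power2_norm_eq_inner)
  \<comment> \<open>The numerator vanishes from distance \<open>2 * r\<close> on, and the second
    term of the denominator vanishes up to distance \<open>r\<close>, where the quotient is
    therefore 1. The two terms never vanish together.\<close>
  define f where "f z = h (4 * r\<^sup>2 - s z) / (h (4 * r\<^sup>2 - s z) + h (s z - r\<^sup>2))" for z
  have pos: "h (4 * r\<^sup>2 - s z) + h (s z - r\<^sup>2) > 0" for z
  proof -
    have "4 * r\<^sup>2 - s z > 0 \<or> s z - r\<^sup>2 > 0"
      using assms by (smt (verit) zero_less_power)
    then show ?thesis
      using h by (smt (verit))
  qed
  have ss: "smooth_at s z" for z
    unfolding s_def by (intro smooth_at_bilinear[OF bounded_bilinear_inner] smooth_at_diff
        smooth_at_ident smooth_at_const)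
  have sh: "smooth_at (\<lambda>z. h (g z)) z" if "smooth_at g z" for g :: "'e \<Rightarrow> real" and z
    using smooth_at_compose[OF that smooth_at_exp_poly] by (simp add: h_def)
  show "smooth_at f z" for z
    unfolding f_def
    by (intro smooth_at_divide smooth_at_add sh smooth_at_diff ss smooth_at_const)
      (use pos[of z] in simp)
  show "f z = 1" if "dist x z < r" for z
  proof -
    have "s z < r\<^sup>2"
      using that assms by (simp add: s power_strict_mono)
    then show ?thesis
      using pos[of z] h0[of "s z - r\<^sup>2"] by (simp add: f_def)
  qed
  show "f z = 0" if "dist x z \<ge> 2 * r" for z
  proof -
    have "s z \<ge> 4 * r\<^sup>2"
      using that assms power_mono[of "2 * r" "dist x z" 2] by (simp add: s power_mult_distrib)
    then show ?thesis
      using h0 by (simp add: f_def)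
  qed
qed

section \<open>Smooth atlases and tangent spaces\<close>

text \<open>The part of the manifold axioms that is also used for the tangent bundle.\<close>

locale smooth_atlas =
  fixes B :: "('a, 'e::euclidean_space) chart set"
  assumes inj: "c \<in> B \<Longrightarrow> inj_on (snd c) (fst c)"
    and open_image: "c \<in> B \<Longrightarrow> open (snd c ` fst c)"
    and open_overlap: "c \<in> B \<Longrightarrow> d \<in> B \<Longrightarrow> open (snd c ` (fst c \<inter> fst d))"
    and smooth_transition:
      "c \<in> B \<Longrightarrow> d \<in> B \<Longrightarrow> smooth_on (snd c ` (fst c \<inter> fst d)) (snd d \<circ> chart_inv c)"

lemma smooth_manifold_smooth_atlas: "smooth_manifold \<A> \<Longrightarrow> smooth_atlas \<A>"
  by unfold_locales (auto simp: smooth_manifold_def)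

text \<open>One chart is enough, which makes the property easy to establish;
  \<open>msmooth_iff\<close> shows that every chart around \<open>p\<close> then works. The
  definition also forces \<open>p\<close> to be a point of the manifold.\<close>

definition msmooth :: "('a, 'e::euclidean_space) chart set \<Rightarrow> ('a \<Rightarrow> 'f::euclidean_space) \<Rightarrow> 'a \<Rightarrow> bool"
  where "msmooth B F p \<longleftrightarrow> (\<exists>c\<in>B. p \<in> fst c \<and> smooth_at (\<lambda>z. F (chart_inv c z)) (snd c p))"

definition mderiv :: "('a, 'e::euclidean_space) chart \<Rightarrow> ('a \<Rightarrow> 'f::euclidean_space) \<Rightarrow> 'a \<Rightarrow> 'e \<Rightarrow> 'f"
  where "mderiv c F p u = frechet_derivative (\<lambda>z. F (chart_inv c z)) (at (snd c p)) u"

text \<open>The Jacobian of the transition from \<open>c\<close> to \<open>d\<close>, regarded as a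
  function of the point of the manifold, so that it can be differentiated again and pulled back to
  the tangent bundle.\<close>

definition dtr :: "('a, 'e::euclidean_space) chart \<Rightarrow> ('a, 'e) chart \<Rightarrow> 'a \<Rightarrow> 'e \<Rightarrow> 'e"
  where "dtr c d p u = mderiv c (snd d) p u"

text \<open>In the two transformation laws \<open>u\<close> is always the direction of the connection, so the symmetry of
  second derivatives is never needed.\<close>

definition d2tr :: "('a, 'e::euclidean_space) chart \<Rightarrow> ('a, 'e) chart \<Rightarrow> 'a \<Rightarrow> 'e \<Rightarrow> 'e \<Rightarrow> 'e"
  where "d2tr c d p u w = mderiv c (\<lambda>q. dtr c d q w) p u"

lemma dtr_frechet: "frechet_derivative (snd d \<circ> chart_inv c) (at (snd c p)) u = dtr c d p u"
  by (simp add: dtr_def mderiv_def comp_def)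

lemma tvec_of_apply:
  "d \<in> B \<Longrightarrow> p \<in> fst d \<Longrightarrow> tvec_of B c p u d = dtr c d p u"
  by (simp add: tvec_of_def dtr_frechet)

lemma tangent_space_iff:
  "w \<in> tangent_space B p \<longleftrightarrow>
    (\<forall>c\<in>B. \<forall>d\<in>B. p \<in> fst c \<inter> fst d \<longrightarrow> w d = dtr c d p (w c)) \<and>
     (\<forall>c. \<not> (c \<in> B \<and> p \<in> fst c) \<longrightarrow> w c = 0)"
  by (simp add: tangent_space_def dtr_frechet)

context smooth_atlas
begin

abbreviation "mtop \<equiv> atlas_topology B"

lemma chart_inv_chart [simp]: "c \<in> B \<Longrightarrow> p \<in> fst c \<Longrightarrow> chart_inv c (snd c p) = p"
  by (simp add: inj inv_into_f_f)

lemma chart_inv_in: "z \<in> snd c ` fst c \<Longrightarrow> chart_inv c z \<in> fst c"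
  by (rule inv_into_into)

lemma chart_chart_inv: "z \<in> snd c ` fst c \<Longrightarrow> snd c (chart_inv c z) = z"
  by (rule f_inv_into_f)

lemma chart_in_points: "c \<in> B \<Longrightarrow> p \<in> fst c \<Longrightarrow> p \<in> points B"
  by (auto simp: points_def)

lemma in_pointsE:
  assumes "p \<in> points B"
  obtains c where "c \<in> B" "p \<in> fst c"
  using assms by (auto simp: points_def)

lemma chart_vimage:
  assumes "c \<in> B"
  shows "chart_inv c -` W \<inter> snd c ` fst c = snd c ` (W \<inter> fst c)"
  using assms by (auto simp: chart_inv_in chart_chart_inv image_iff)

lemma openin_iff: "openin mtop W \<longleftrightarrow> W \<subseteq> points B \<and> (\<forall>c\<in>B. open (snd c ` (W \<inter> fst c)))"
  by (simp add: openin_atlas_topology chart_vimage)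

lemma openin_domain: "c \<in> B \<Longrightarrow> openin mtop (fst c)"
  unfolding openin_iff using open_overlap by (auto simp: Int_commute points_def)

lemma topspace_eq [simp]: "topspace mtop = points B"
proof -
  have "openin mtop (points B)"
    unfolding openin_iff using open_image by (auto simp: points_def Int_absorb1 UN_upper)
  then show ?thesis
    by (metis openin_iff openin_subset openin_topspace subset_antisym)
qed

lemma smooth_at_transition:
  assumes "c \<in> B" "d \<in> B" "p \<in> fst c" "p \<in> fst d"
  shows "smooth_at (\<lambda>z. snd d (chart_inv c z)) (snd c p)"
  using smooth_transition[OF assms(1,2)] assms
  by (auto simp: smooth_on_iff_smooth_at[OF open_overlap] comp_def)

text \<open>The topology is defined through all charts at once, but its neighbourhoods of
  \<open>p\<close> can be read off in a single chart. For the converse direction, the part of the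
  domain that lies over an open set of coordinates is open in every other chart because transition
  maps are continuous.\<close>

lemma eventually_nhdsin_iff:
  assumes c: "c \<in> B" and p: "p \<in> fst c"
  shows "eventually P (nhdsin mtop p) \<longleftrightarrow>
    eventually (\<lambda>z. z \<in> snd c ` fst c \<and> P (chart_inv c z)) (nhds (snd c p))"
proof
  assume "eventually P (nhdsin mtop p)"
  then obtain W where W: "openin mtop W" "p \<in> W" "\<forall>q\<in>W. P q"
    using chart_in_points[OF c p] by (auto simp: eventually_nhdsin)
  have "open (snd c ` (W \<inter> fst c))"
    using W(1) c by (simp add: openin_iff)
  moreover have "z \<in> snd c ` fst c \<and> P (chart_inv c z)" if "z \<in> snd c ` (W \<inter> fst c)" for z
    using that W c by auto
  moreover have "snd c p \<in> snd c ` (W \<inter> fst c)"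
    using W p by blast
  ultimately show "eventually (\<lambda>z. z \<in> snd c ` fst c \<and> P (chart_inv c z)) (nhds (snd c p))"
    unfolding eventually_nhds by blast
next
  assume "eventually (\<lambda>z. z \<in> snd c ` fst c \<and> P (chart_inv c z)) (nhds (snd c p))"
  then obtain V where V: "open V" "snd c p \<in> V" "\<forall>z\<in>V. z \<in> snd c ` fst c \<and> P (chart_inv c z)"
    unfolding eventually_nhds by blast
  define W where "W = {q \<in> fst c. snd c q \<in> V}"
  have "open (snd d ` (W \<inter> fst d))" if d: "d \<in> B" for d
  proof -
    have *: "snd d ` (W \<inter> fst d) =
        (\<lambda>z. snd c (chart_inv d z)) -` V \<inter> snd d ` (fst d \<inter> fst c)"
      using d by (auto simp: W_def)
    have "continuous_on (snd d ` (fst d \<inter> fst c)) (\<lambda>z. snd c (chart_inv d z))"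
      using smooth_at_transition[OF d c] smooth_at_isCont
      by (intro continuous_at_imp_continuous_on) blast
    then show ?thesis
      unfolding * using continuous_on_open_vimage[OF open_overlap[OF d c]] V(1) by blast
  qed
  then have "openin mtop W"
    using c by (auto simp: openin_iff W_def points_def)
  moreover have "p \<in> W" "\<forall>q\<in>W. P q"
    using V p chart_inv_chart[OF c] by (force simp: W_def)+
  ultimately show "eventually P (nhdsin mtop p)"
    by (auto simp: eventually_nhdsin)
qed

lemma eventually_nhdsin_openin: "openin mtop W \<Longrightarrow> p \<in> W \<Longrightarrow> eventually (\<lambda>q. q \<in> W) (nhdsin mtop p)"
  by (auto simp: eventually_nhdsin)

lemma eventually_eventually_nhdsin:
  "eventually P (nhdsin mtop p) \<Longrightarrow> eventually (\<lambda>q. eventually P (nhdsin mtop q)) (nhdsin mtop p)"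
  by (auto simp: eventually_nhdsin)

lemma eventually_in_domain: "c \<in> B \<Longrightarrow> p \<in> fst c \<Longrightarrow> eventually (\<lambda>q. q \<in> fst c) (nhdsin mtop p)"
  using eventually_nhdsin_openin openin_domain by blast

lemma eventually_chart_inv:
  "c \<in> B \<Longrightarrow> p \<in> fst c \<Longrightarrow> eventually P (nhdsin mtop p) \<Longrightarrow>
    eventually (\<lambda>z. P (chart_inv c z)) (nhds (snd c p))"
  by (simp add: eventually_nhdsin_iff eventually_conj_iff)

lemma agree_near_iff:
  "p \<in> points B \<Longrightarrow> agree_near B p X Y \<longleftrightarrow> eventually (\<lambda>q. X q = Y q) (nhdsin mtop p)"
  by (auto simp: agree_near_def eventually_nhdsin)

lemma eventually_nhdsin_self: "p \<in> points B \<Longrightarrow> eventually P (nhdsin mtop p) \<Longrightarrow> P p"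
  by (auto simp: eventually_nhdsin)

subsection \<open>Smoothness at a point\<close>

text \<open>Near \<open>p\<close> the expression of \<open>F\<close> in the chart \<open>c\<close>
  is its expression in \<open>d\<close> composed with the smooth transition map.\<close>

lemma msmooth_iff:
  assumes "c \<in> B" "p \<in> fst c"
  shows "msmooth B F p \<longleftrightarrow> smooth_at (\<lambda>z. F (chart_inv c z)) (snd c p)"
proof
  assume "msmooth B F p"
  then obtain d where d: "d \<in> B" "p \<in> fst d" "smooth_at (\<lambda>z. F (chart_inv d z)) (snd d p)"
    by (auto simp: msmooth_def)
  have "smooth_at (\<lambda>z. F (chart_inv d (snd d (chart_inv c z)))) (snd c p)"
    using smooth_at_compose[OF smooth_at_transition[OF assms(1) d(1) assms(2) d(2)],
        of "\<lambda>z. F (chart_inv d z)"] d assms by simp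
  moreover have "eventually (\<lambda>z. F (chart_inv d (snd d (chart_inv c z))) = F (chart_inv c z))
      (nhds (snd c p))"
    by (rule eventually_mono[OF eventually_chart_inv[OF assms eventually_in_domain[OF d(1,2)]]])
      (use d in simp)
  ultimately show "smooth_at (\<lambda>z. F (chart_inv c z)) (snd c p)"
    using smooth_at_cong by fast
qed (use assms in \<open>auto simp: msmooth_def\<close>)

lemma msmooth_point: "msmooth B F p \<Longrightarrow> p \<in> points B"
  by (auto simp: msmooth_def points_def)

lemma msmooth_chart: "c \<in> B \<Longrightarrow> p \<in> fst c \<Longrightarrow> msmooth B (snd c) p"
  using msmooth_iff[of c p "snd c"] smooth_at_transition[of c c p] by simp

lemma msmooth_cong:
  assumes "eventually (\<lambda>q. F q = G q) (nhdsin mtop p)" "msmooth B F p"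
  shows "msmooth B G p"
proof -
  obtain c where c: "c \<in> B" "p \<in> fst c"
    using assms by (auto simp: msmooth_def)
  show ?thesis
    using smooth_at_cong[OF eventually_chart_inv[OF c assms(1)]] assms(2) msmooth_iff[OF c] by blast
qed

lemma msmooth_const: "p \<in> points B \<Longrightarrow> msmooth B (\<lambda>q. k) p"
  by (auto simp: msmooth_def points_def)

lemma msmooth_compose:
  assumes "msmooth B F p" "smooth_at f (F p)"
  shows "msmooth B (\<lambda>q. f (F q)) p"
proof -
  obtain c where c: "c \<in> B" "p \<in> fst c"
    using assms by (auto simp: msmooth_def)
  show ?thesis
    using assms c smooth_at_compose[of "\<lambda>z. F (chart_inv c z)" "snd c p" f] by (simp add: msmooth_iff[OF c])
qed

lemma msmooth_bilinear:
  assumes "bounded_bilinear h" "msmooth B F p" "msmooth B G p"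
  shows "msmooth B (\<lambda>q. h (F q) (G q)) p"
proof -
  obtain c where c: "c \<in> B" "p \<in> fst c"
    using assms by (auto simp: msmooth_def)
  show ?thesis
    using assms smooth_at_bilinear by (simp add: msmooth_iff[OF c])
qed

lemmas msmooth_scaleR = msmooth_bilinear[OF bounded_bilinear_scaleR]

lemma msmooth_linear:
  "bounded_linear h \<Longrightarrow> msmooth B F p \<Longrightarrow> msmooth B (\<lambda>q. h (F q)) p"
  by (rule msmooth_compose) (auto intro: smooth_at_linear)

lemma msmooth_add: "msmooth B F p \<Longrightarrow> msmooth B G p \<Longrightarrow> msmooth B (\<lambda>q. F q + G q) p"
  using msmooth_iff smooth_at_add unfolding msmooth_def by blast

lemma msmooth_mult:
  fixes F G :: "'a \<Rightarrow> real"
  shows "msmooth B F p \<Longrightarrow> msmooth B G p \<Longrightarrow> msmooth B (\<lambda>q. F q * G q) p"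
  by (rule msmooth_bilinear[OF bounded_bilinear_mult])

lemma msmooth_minus: "msmooth B F p \<Longrightarrow> msmooth B (\<lambda>q. - F q) p"
  using msmooth_linear[OF bounded_linear_minus[OF bounded_linear_ident]] by blast

lemma msmooth_diff: "msmooth B F p \<Longrightarrow> msmooth B G p \<Longrightarrow> msmooth B (\<lambda>q. F q - G q) p"
  using msmooth_add[of F p "\<lambda>q. - G q"] msmooth_minus[of G p] by simp

lemma msmooth_sum:
  assumes "p \<in> points B" "\<And>i. i \<in> I \<Longrightarrow> msmooth B (F i) p"
  shows "msmooth B (\<lambda>q. \<Sum>i\<in>I. F i q) p"
  using assms(2)
proof (induction I rule: infinite_finite_induct)
  case (insert i I)
  then show ?case
    using msmooth_add[of "F i" p "\<lambda>q. \<Sum>i\<in>I. F i q"] by simp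
qed (auto intro: msmooth_const assms(1))

lemma msmooth_vec_iff:
  fixes F :: "'a \<Rightarrow> real^'n"
  shows "msmooth B F p \<longleftrightarrow> (\<forall>i. msmooth B (\<lambda>q. F q $ i) p)"
proof (cases "p \<in> points B")
  case True
  then obtain c where c: "c \<in> B" "p \<in> fst c"
    by (rule in_pointsE)
  show ?thesis
    by (simp add: msmooth_iff[OF c] smooth_at_vec_iff)
qed (blast dest: msmooth_point)

lemma msmooth_det:
  fixes M :: "'a \<Rightarrow> real^'n^'n"
  assumes "p \<in> points B" "\<And>i j. msmooth B (\<lambda>q. M q $ i $ j) p"
  shows "msmooth B (\<lambda>q. det (M q)) p"
proof -
  obtain c where c: "c \<in> B" "p \<in> fst c"
    using assms(1) by (rule in_pointsE)
  show ?thesis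
    using assms(2) unfolding msmooth_iff[OF c] by (rule smooth_at_det)
qed

lemma msmooth_divide:
  fixes F G :: "'a \<Rightarrow> real"
  assumes "msmooth B F p" "msmooth B G p" "G p \<noteq> 0"
  shows "msmooth B (\<lambda>q. F q / G q) p"
proof -
  obtain c where c: "c \<in> B" "p \<in> fst c"
    using msmooth_point[OF assms(1)] by (rule in_pointsE)
  show ?thesis
    using assms unfolding msmooth_iff[OF c] by (intro smooth_at_divide) (simp_all add: c)
qed

lemma eventually_msmooth_nonzero:
  assumes "msmooth B F p" "F p \<noteq> 0"
  shows "eventually (\<lambda>q. F q \<noteq> 0) (nhdsin mtop p)"
proof -
  obtain c where c: "c \<in> B" "p \<in> fst c"
    using msmooth_point[OF assms(1)] by (rule in_pointsE)
  have "eventually (\<lambda>z. F (chart_inv c z) \<noteq> 0) (nhds (snd c p))"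
    using assms c by (intro eventually_isCont_compose[OF smooth_at_isCont t1_space_nhds])
      (simp_all flip: msmooth_iff)
  moreover have "eventually (\<lambda>z. z \<in> snd c ` fst c) (nhds (snd c p))"
    using open_image[OF c(1)] c by (intro eventually_nhds_in_open) auto
  ultimately show ?thesis
    unfolding eventually_nhdsin_iff[OF c] by eventually_elim simp
qed

lemma msmooth_frechet_at:
  assumes "smooth_at f (h p)" "msmooth B h p" "msmooth B g p"
  shows "msmooth B (\<lambda>q. frechet_derivative f (at (h q)) (g q)) p"
proof -
  obtain c where c: "c \<in> B" "p \<in> fst c"
    using assms by (auto simp: msmooth_def)
  show ?thesis
    using assms c smooth_at_frechet_at[of f "\<lambda>z. h (chart_inv c z)" "snd c p" "\<lambda>z. g (chart_inv c z)"]
    by (simp add: msmooth_iff[OF c])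
qed

lemma msmooth_dtr:
  assumes "c \<in> B" "d \<in> B" "p \<in> fst c" "p \<in> fst d" "msmooth B G p"
  shows "msmooth B (\<lambda>q. dtr c d q (G q)) p"
  unfolding dtr_def mderiv_def
  using assms by (intro msmooth_frechet_at smooth_at_transition msmooth_chart)

text \<open>The bridge between the notions of smoothness in the definitions, which are stated on
  images of charts, and pointwise smoothness on the manifold.\<close>

lemma smooth_on_chart_iff:
  assumes "c \<in> B" "openin mtop W"
  shows "smooth_on (snd c ` (W \<inter> fst c)) (\<lambda>z. F (chart_inv c z)) \<longleftrightarrow> (\<forall>p\<in>W \<inter> fst c. msmooth B F p)"
proof -
  have "open (snd c ` (W \<inter> fst c))"
    using assms by (simp add: openin_iff)
  then show ?thesis
    using assms(1) by (auto simp: smooth_on_iff_smooth_at msmooth_iff)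
qed

lemma smooth_fun_iff: "smooth_fun B f \<longleftrightarrow> (\<forall>p\<in>points B. msmooth B f p)"
proof -
  have "smooth_on (snd c ` fst c) (f \<circ> chart_inv c) \<longleftrightarrow> (\<forall>p\<in>fst c. msmooth B f p)" if "c \<in> B" for c
    using smooth_on_chart_iff[OF that openin_domain[OF that], of f] by (simp add: comp_def)
  then show ?thesis
    by (auto simp: smooth_fun_def points_def)
qed

subsection \<open>Derivatives in charts\<close>

lemma mderiv_has_derivative:
  assumes "c \<in> B" "p \<in> fst c" "msmooth B F p"
  shows "((\<lambda>z. F (chart_inv c z)) has_derivative mderiv c F p) (at (snd c p))"
  using smooth_at_has_derivative[of "\<lambda>z. F (chart_inv c z)" "snd c p"] assms
  by (simp add: msmooth_iff mderiv_def[abs_def])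

lemma mderivI:
  assumes "((\<lambda>z. F (chart_inv c z)) has_derivative D) (at (snd c p))"
  shows "mderiv c F p = D"
  using frechet_derivative_at[OF assms] by (simp add: mderiv_def[abs_def])

lemma linear_mderiv: "c \<in> B \<Longrightarrow> p \<in> fst c \<Longrightarrow> msmooth B F p \<Longrightarrow> linear (mderiv c F p)"
  using mderiv_has_derivative has_derivative_linear by blast

lemma msmooth_mderiv:
  assumes "c \<in> B" "p \<in> fst c" "msmooth B F p" "msmooth B G p"
  shows "msmooth B (\<lambda>q. mderiv c F q (G q)) p"
  unfolding mderiv_def
  using assms by (intro msmooth_frechet_at msmooth_chart) (simp_all flip: msmooth_iff)

lemma mderiv_cong:
  assumes "c \<in> B" "p \<in> fst c" "eventually (\<lambda>q. F q = G q) (nhdsin mtop p)"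
  shows "mderiv c F p = mderiv c G p"
  using frechet_derivative_cong[OF eventually_chart_inv[OF assms]] by (simp add: mderiv_def[abs_def])

lemma mderiv_const [simp]: "mderiv c (\<lambda>q. k) p u = 0"
  by (simp add: mderiv_def)

lemma mderiv_add:
  assumes "c \<in> B" "p \<in> fst c" "msmooth B F p" "msmooth B G p"
  shows "mderiv c (\<lambda>q. F q + G q) p u = mderiv c F p u + mderiv c G p u"
  using mderivI[OF has_derivative_add[OF mderiv_has_derivative[OF assms(1-3)]
        mderiv_has_derivative[OF assms(1,2,4)]]] by simp

lemma mderiv_scaleR:
  assumes "c \<in> B" "p \<in> fst c" "msmooth B f p" "msmooth B G p"
  shows "mderiv c (\<lambda>q. f q *\<^sub>R G q) p u = mderiv c f p u *\<^sub>R G p + f p *\<^sub>R mderiv c G p u"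
  using mderivI[OF bounded_bilinear.FDERIV[OF bounded_bilinear_scaleR
        mderiv_has_derivative[OF assms(1-3)] mderiv_has_derivative[OF assms(1,2,4)]]] assms(1,2)
  by simp

text \<open>The chain rule for \<open>F\<close> read in the chart \<open>d\<close> after the
  transition map: a differential applied to a vector does not depend on the chart.\<close>

lemma mderiv_trans:
  assumes "c \<in> B" "d \<in> B" "p \<in> fst c" "p \<in> fst d" "msmooth B F p"
  shows "mderiv d F p (dtr c d p u) = mderiv c F p u"
proof -
  have "mderiv c F p u = mderiv c (\<lambda>q. F (chart_inv d (snd d q))) p u"
    using assms by (intro fun_cong[OF mderiv_cong] eventually_mono[OF eventually_in_domain[of d p]]) auto
  also have "\<dots> = mderiv d F p (dtr c d p u)"
    unfolding dtr_def mderiv_def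
    using frechet_derivative_compose_smooth_at[OF smooth_at_transition[OF assms(1-4)],
        of "\<lambda>z. F (chart_inv d z)"] assms(5) msmooth_iff[OF assms(2,4), of F] assms(1,3)
    by simp
  finally show ?thesis by simp
qed

lemma dtr_trans:
  assumes "c \<in> B" "d \<in> B" "e \<in> B" "p \<in> fst c" "p \<in> fst d" "p \<in> fst e"
  shows "dtr d e p (dtr c d p u) = dtr c e p u"
  using mderiv_trans[of c d p "snd e"] assms msmooth_chart by (simp add: dtr_def[of _ e])

lemma dtr_self [simp]:
  assumes "c \<in> B" "p \<in> fst c"
  shows "dtr c c p u = u"
proof -
  have "eventually (\<lambda>z. z = snd c (chart_inv c z)) (nhds (snd c p))"
    using open_image[OF assms(1)] assms chart_chart_inv
    by (intro eventually_mono[OF eventually_nhds_in_open[of "snd c ` fst c"]]) auto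
  then have "frechet_derivative (\<lambda>z. z) (at (snd c p)) =
      frechet_derivative (\<lambda>z. snd c (chart_inv c z)) (at (snd c p))"
    by (rule frechet_derivative_cong)
  then show ?thesis
    by (metis dtr_def frechet_derivative_ident mderiv_def)
qed

lemma linear_dtr: "c \<in> B \<Longrightarrow> d \<in> B \<Longrightarrow> p \<in> fst c \<Longrightarrow> p \<in> fst d \<Longrightarrow> linear (dtr c d p)"
  using linear_mderiv[of c p "snd d"] msmooth_chart by (simp add: dtr_def[abs_def])

lemma linear_d2tr:
  assumes "c \<in> B" "d \<in> B" "p \<in> fst c" "p \<in> fst d"
  shows "linear (d2tr c d p u)" and "linear (\<lambda>u. d2tr c d p u w)"
proof -
  note ms = msmooth_dtr[OF assms msmooth_const[OF chart_in_points[OF assms(1,3)]]]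
  show "linear (\<lambda>u. d2tr c d p u w)"
    unfolding d2tr_def using linear_mderiv[OF assms(1,3) ms] by simp
  have ev: "eventually (\<lambda>q. q \<in> fst c \<and> q \<in> fst d) (nhdsin mtop p)"
    by (intro eventually_conj eventually_in_domain assms)
  show "linear (d2tr c d p u)"
  proof (rule linearI)
    fix w w'
    have "d2tr c d p u (w + w') = mderiv c (\<lambda>q. dtr c d q w + dtr c d q w') p u"
      unfolding d2tr_def
      by (intro fun_cong[OF mderiv_cong] assms eventually_mono[OF ev])
        (use assms linear_add[OF linear_dtr] in auto)
    also have "\<dots> = d2tr c d p u w + d2tr c d p u w'"
      unfolding d2tr_def by (intro mderiv_add assms ms)
    finally show "d2tr c d p u (w + w') = d2tr c d p u w + d2tr c d p u w'" .
  next
    fix r w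
    have "d2tr c d p u (r *\<^sub>R w) = mderiv c (\<lambda>q. r *\<^sub>R dtr c d q w) p u"
      unfolding d2tr_def
      by (intro fun_cong[OF mderiv_cong] assms eventually_mono[OF ev])
        (use assms linear_scale[OF linear_dtr] in auto)
    also have "\<dots> = r *\<^sub>R d2tr c d p u w"
      unfolding d2tr_def
      using mderiv_scaleR[OF assms(1,3) msmooth_const[OF chart_in_points[OF assms(1,3)]] ms] by simp
    finally show "d2tr c d p u (r *\<^sub>R w) = r *\<^sub>R d2tr c d p u w" .
  qed
qed

text \<open>The product rule for the Jacobian applied to a varying vector, obtained by expanding the
  vector in \<open>Basis\<close>. Its first term is the reason why the components of a derivative of
  a vector field do not transform tensorially.\<close>

lemma mderiv_dtr:
  assumes "c \<in> B" "d \<in> B" "p \<in> fst c" "p \<in> fst d" "msmooth B G p"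
  shows "mderiv c (\<lambda>q. dtr c d q (G q)) p u = d2tr c d p u (G p) + dtr c d p (mderiv c G p u)"
proof -
  note p = chart_in_points[OF assms(1,3)]
  note ms = msmooth_dtr[OF assms(1-4) msmooth_const[OF p]]
  have gb: "msmooth B (\<lambda>q. G q \<bullet> b) p" for b
    by (rule msmooth_linear[OF bounded_linear_inner_left assms(5)])
  have "eventually (\<lambda>q. q \<in> fst c \<and> q \<in> fst d) (nhdsin mtop p)"
    by (intro eventually_conj eventually_in_domain assms)
  then have "mderiv c (\<lambda>q. dtr c d q (G q)) p u =
      mderiv c (\<lambda>q. \<Sum>b\<in>Basis. (G q \<bullet> b) *\<^sub>R dtr c d q b) p u"
    by (intro fun_cong[OF mderiv_cong] assms; elim eventually_mono)
      (use assms linear_expansion_Basis[OF linear_dtr] in blast)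
  also have "\<dots> = (\<Sum>b\<in>Basis. mderiv c (\<lambda>q. (G q \<bullet> b) *\<^sub>R dtr c d q b) p u)"
    by (intro fun_cong[OF mderivI] has_derivative_sum mderiv_has_derivative assms msmooth_scaleR gb ms)
  also have "\<dots> = (\<Sum>b\<in>Basis. (G p \<bullet> b) *\<^sub>R d2tr c d p u b) +
      (\<Sum>b\<in>Basis. mderiv c (\<lambda>q. G q \<bullet> b) p u *\<^sub>R dtr c d p b)"
    by (simp add: mderiv_scaleR[OF assms(1,3) gb ms] d2tr_def sum.distrib add.commute)
  also have "(\<lambda>b. mderiv c (\<lambda>q. G q \<bullet> b) p u) = (\<lambda>b. mderiv c G p u \<bullet> b)"
    by (intro ext fun_cong[OF mderivI] has_derivative_inner_left mderiv_has_derivative assms)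
  also have "(\<Sum>b\<in>Basis. (G p \<bullet> b) *\<^sub>R d2tr c d p u b) = d2tr c d p u (G p)"
    by (rule linear_expansion_Basis[symmetric]) (rule linear_d2tr[OF assms(1-4)])
  also have "(\<Sum>b\<in>Basis. (mderiv c G p u \<bullet> b) *\<^sub>R dtr c d p b) = dtr c d p (mderiv c G p u)"
    by (rule linear_expansion_Basis[symmetric]) (rule linear_dtr[OF assms(1-4)])
  finally show ?thesis .
qed

subsection \<open>Tangent spaces\<close>

lemma tangent_coord:
  "w \<in> tangent_space B p \<Longrightarrow> c \<in> B \<Longrightarrow> d \<in> B \<Longrightarrow> p \<in> fst c \<Longrightarrow> p \<in> fst d \<Longrightarrow> w d = dtr c d p (w c)"
  unfolding tangent_space_iff by blast

lemma tangent_outside: "w \<in> tangent_space B p \<Longrightarrow> \<not> (c \<in> B \<and> p \<in> fst c) \<Longrightarrow> w c = 0"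
  unfolding tangent_space_iff by blast

lemma tangent_spaceI:
  "(\<And>c d. c \<in> B \<Longrightarrow> d \<in> B \<Longrightarrow> p \<in> fst c \<Longrightarrow> p \<in> fst d \<Longrightarrow> w d = dtr c d p (w c)) \<Longrightarrow>
    (\<And>c. \<not> (c \<in> B \<and> p \<in> fst c) \<Longrightarrow> w c = 0) \<Longrightarrow> w \<in> tangent_space B p"
  unfolding tangent_space_iff by blast

lemma tvec_of_in: "c \<in> B \<Longrightarrow> p \<in> fst c \<Longrightarrow> tvec_of B c p u \<in> tangent_space B p"
  by (rule tangent_spaceI) (simp_all add: tvec_of_apply dtr_trans, auto simp: tvec_of_def)

lemma tvec_of_self [simp]: "c \<in> B \<Longrightarrow> p \<in> fst c \<Longrightarrow> tvec_of B c p u c = u"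
  by (simp add: tvec_of_apply)

text \<open>A tangent vector is determined by its components in one chart: the transformation law
  gives the others, and it is zero on charts that do not contain \<open>p\<close>. Most identities
  of tangent vectors below are reduced to coordinates in this way.\<close>

lemma tangent_eqI:
  assumes "w \<in> tangent_space B p" "w' \<in> tangent_space B p" "c \<in> B" "p \<in> fst c" "w c = w' c"
  shows "w = w'"
proof
  fix d
  show "w d = w' d"
    using tangent_coord[OF assms(1,3) _ assms(4), of d] tangent_coord[OF assms(2,3) _ assms(4), of d]
      tangent_outside[OF assms(1), of d] tangent_outside[OF assms(2), of d] assms(5) by metis
qed

lemma subspace_tangent_space: "subspace (tangent_space B p)"
  by (intro subspaceI tangent_spaceI)
    (simp_all add: linear_add[OF linear_dtr] linear_scale[OF linear_dtr] linear_0[OF linear_dtr]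
      tangent_coord[symmetric] tangent_outside)

lemmas tangent_add = subspace_add[OF subspace_tangent_space]
lemmas tangent_scale = subspace_scale[OF subspace_tangent_space]
lemmas tangent_0 = subspace_0[OF subspace_tangent_space]

lemma some_chart: "p \<in> points B \<Longrightarrow> some_chart B p \<in> B \<and> p \<in> fst (some_chart B p)"
  unfolding some_chart_def points_def by (rule someI_ex) auto

text \<open>The definition uses an arbitrarily chosen chart. The change of the differential and that
  of the components of \<open>w\<close> compensate each other, so any chart may be used.\<close>

lemma dir_deriv_eq:
  assumes "c \<in> B" "p \<in> fst c" "w \<in> tangent_space B p" "msmooth B f p"
  shows "dir_deriv B p w f = mderiv c f p (w c)"
proof -
  have s: "some_chart B p \<in> B" "p \<in> fst (some_chart B p)"
    using some_chart[OF chart_in_points[OF assms(1,2)]] by auto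
  have "dir_deriv B p w f = mderiv (some_chart B p) f p (w (some_chart B p))"
    by (simp add: dir_deriv_def mderiv_def comp_def Let_def)
  then show ?thesis
    using mderiv_trans[OF assms(1) s(1) assms(2) s(2) assms(4)] tangent_coord[OF assms(3,1) s(1) assms(2) s(2)]
    by simp
qed

lemma msmooth_field_change:
  assumes "c \<in> B" "d \<in> B" "p \<in> fst c" "p \<in> fst d" "msmooth B (\<lambda>q. X q c) p"
    "eventually (\<lambda>q. X q \<in> tangent_space B q) (nhdsin mtop p)"
  shows "msmooth B (\<lambda>q. X q d) p"
proof (rule msmooth_cong[OF _ msmooth_dtr[OF assms(1-5)]])
  show "eventually (\<lambda>q. dtr c d q (X q c) = X q d) (nhdsin mtop p)"
    using eventually_in_domain[OF assms(1,3)] eventually_in_domain[OF assms(2,4)] assms(6)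
    by eventually_elim (rule tangent_coord[OF _ assms(1,2), symmetric])
qed

lemma smooth_field_on_iff:
  assumes "openin mtop W"
  shows "smooth_field_on B W X \<longleftrightarrow>
    (\<forall>p\<in>W. X p \<in> tangent_space B p \<and> (\<forall>c\<in>B. p \<in> fst c \<longrightarrow> msmooth B (\<lambda>q. X q c) p))"
proof -
  have "smooth_on (snd c ` (W \<inter> fst c)) (\<lambda>z. X (chart_inv c z) c) \<longleftrightarrow>
      (\<forall>p\<in>W \<inter> fst c. msmooth B (\<lambda>q. X q c) p)" if "c \<in> B" for c
    by (rule smooth_on_chart_iff[OF that assms])
  then show ?thesis
    unfolding smooth_field_on_def by blast
qed

lemma smooth_field_onI:
  assumes "openin mtop W" "\<And>p. p \<in> W \<Longrightarrow> X p \<in> tangent_space B p"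
    "\<And>p. p \<in> W \<Longrightarrow> \<exists>c\<in>B. p \<in> fst c \<and> msmooth B (\<lambda>q. X q c) p"
  shows "smooth_field_on B W X"
  unfolding smooth_field_on_iff[OF assms(1)]
proof (intro ballI conjI impI)
  fix p d assume p: "p \<in> W" and d: "d \<in> B" "p \<in> fst d"
  obtain c where c: "c \<in> B" "p \<in> fst c" "msmooth B (\<lambda>q. X q c) p"
    using assms(3)[OF p] by blast
  show "msmooth B (\<lambda>q. X q d) p"
    by (rule msmooth_field_change[OF c(1) d(1) c(2) d(2), where X = X, OF c(3)])
      (use eventually_nhdsin_openin[OF assms(1) p] assms(2) in \<open>auto elim: eventually_mono\<close>)
qed (use assms(2) in auto)

lemma openin_points: "openin mtop (points B)"
  using openin_topspace[of mtop] by simp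

text \<open>Outside of the manifold no chart contains \<open>p\<close> and the tangent space is
  zero, so the convention of extending fields by zero is absorbed into tangency at every
  \<open>p\<close>.\<close>

lemma vector_fields_iff:
  "X \<in> vector_fields B \<longleftrightarrow> (\<forall>p. X p \<in> tangent_space B p) \<and>
    (\<forall>c\<in>B. \<forall>p\<in>fst c. msmooth B (\<lambda>q. X q c) p)"
proof -
  have "X p \<in> tangent_space B p \<longleftrightarrow> X p = 0" if "p \<notin> points B" for p
  proof
    assume "X p \<in> tangent_space B p"
    then have "X p c = 0" for c
      using tangent_outside[of "X p" p c] that chart_in_points[of c p] by blast
    then show "X p = 0"
      by (simp add: fun_eq_iff)
  qed (simp add: tangent_0)
  then show ?thesis
    unfolding vector_fields_def mem_Collect_eq smooth_field_on_iff[OF openin_points]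
    by (meson chart_in_points)
qed

lemma vector_fieldsI:
  assumes "\<And>p. X p \<in> tangent_space B p"
    "\<And>p. p \<in> points B \<Longrightarrow> \<exists>c\<in>B. p \<in> fst c \<and> msmooth B (\<lambda>q. X q c) p"
  shows "X \<in> vector_fields B"
  using smooth_field_onI[OF openin_points, of X] assms chart_in_points
  by (auto simp: vector_fields_iff smooth_field_on_iff[OF openin_points])

lemma vector_fields_tangent: "X \<in> vector_fields B \<Longrightarrow> X p \<in> tangent_space B p"
  by (simp add: vector_fields_iff)

lemma vector_fields_msmooth:
  "X \<in> vector_fields B \<Longrightarrow> c \<in> B \<Longrightarrow> p \<in> fst c \<Longrightarrow> msmooth B (\<lambda>q. X q c) p"
  by (simp add: vector_fields_iff)

lemma vector_fields_add: "X \<in> vector_fields B \<Longrightarrow> Y \<in> vector_fields B \<Longrightarrow> X + Y \<in> vector_fields B"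
  by (auto simp: vector_fields_iff intro: tangent_add msmooth_add)

lemma vector_fields_scale:
  "X \<in> vector_fields B \<Longrightarrow> smooth_fun B f \<Longrightarrow> (\<lambda>p. f p *\<^sub>R X p) \<in> vector_fields B"
  by (auto simp: vector_fields_iff smooth_fun_iff intro!: tangent_scale msmooth_scaleR intro: chart_in_points)

lemma vector_fields_zero: "0 \<in> vector_fields B"
  by (auto simp: vector_fields_iff intro: tangent_0 msmooth_const chart_in_points)

end

subsection \<open>Cutoff functions and tensoriality\<close>

lemma sum_fun_eq: "(\<Sum>i\<in>I. F i) = (\<lambda>q. \<Sum>i\<in>I. F i q)" for F :: "'i \<Rightarrow> 'b \<Rightarrow> 'c::comm_monoid_add"
  by (induction I rule: infinite_finite_induct) (simp_all add: fun_eq_iff)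

text \<open>Kept apart from \<open>smooth_atlas\<close>, which is also instantiated by the tangent
  bundle: cutoff functions are built on the base manifold only.\<close>

locale hausdorff_atlas = smooth_atlas +
  assumes hausdorff: "Hausdorff_space (atlas_topology B)"
begin

text \<open>A cutoff in coordinates is extended by zero. Its support lies in the image of a closed
  ball, which is compact and hence closed; on the open complement the extension is constantly zero.
  The last conclusion records that it vanishes near, and not only at, the points outside of the
  domain.\<close>

lemma ex_cutoff:
  assumes c: "c \<in> B" "p \<in> fst c" and W: "openin mtop W" "p \<in> W"
  obtains f where "smooth_fun B f" "eventually (\<lambda>q. f q = 1) (nhdsin mtop p)"
    "\<And>q. q \<notin> W \<inter> fst c \<Longrightarrow> f q = 0"
    "\<And>q. q \<in> points B \<Longrightarrow> q \<notin> fst c \<Longrightarrow> eventually (\<lambda>q'. f q' = 0) (nhdsin mtop q)"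
proof -
  have "open (snd c ` (W \<inter> fst c))"
    using W c by (simp add: openin_iff)
  moreover have "snd c p \<in> snd c ` (W \<inter> fst c)"
    using c W by simp
  ultimately obtain e where e: "e > 0" "cball (snd c p) e \<subseteq> snd c ` (W \<inter> fst c)"
    by (meson open_contains_cball)
  \<comment> \<open>The radius \<open>e / 2\<close> is chosen so that \<open>g\<close> vanishes from
    distance \<open>e\<close> on and the support stays in the closed ball of radius
    \<open>e\<close>.\<close>
  obtain g :: "'b \<Rightarrow> real" where g: "\<And>z. smooth_at g z"
    "\<And>z. dist (snd c p) z < e / 2 \<Longrightarrow> g z = 1" "\<And>z. dist (snd c p) z \<ge> 2 * (e / 2) \<Longrightarrow> g z = 0"
    using ex_smooth_cutoff[of "e / 2" "snd c p"] e(1) by auto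
  define f where "f q = (if q \<in> fst c then g (snd c q) else 0)" for q
  define K where "K = chart_inv c ` cball (snd c p) e"
  have "continuous_map (top_of_set (snd c ` fst c)) mtop (chart_inv c)"
    unfolding continuous_map_def
  proof (intro conjI allI impI)
    show "chart_inv c \<in> topspace (top_of_set (snd c ` fst c)) \<rightarrow> topspace mtop"
      using c by (auto simp: chart_in_points)
    fix U assume "openin mtop U"
    then have "open (chart_inv c -` U \<inter> snd c ` fst c)"
      using c by (simp add: openin_iff chart_vimage)
    moreover have "{x \<in> topspace (top_of_set (snd c ` fst c)). chart_inv c x \<in> U} =
        snd c ` fst c \<inter> (chart_inv c -` U \<inter> snd c ` fst c)"
      by auto
    ultimately show "openin (top_of_set (snd c ` fst c))
        {x \<in> topspace (top_of_set (snd c ` fst c)). chart_inv c x \<in> U}"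
      by (simp only: openin_open_Int)
  qed
  moreover have "compactin (top_of_set (snd c ` fst c)) (cball (snd c p) e)"
    using e by (auto simp: compactin_subtopology)
  ultimately have "compactin mtop K"
    unfolding K_def using image_compactin by blast
  then have K: "closedin mtop K"
    using hausdorff by (rule compactin_imp_closedin[rotated])
  have Kc: "K \<subseteq> W \<inter> fst c"
    using e c by (force simp: K_def)
  have fK: "f q = 0" if "q \<notin> K" for q
  proof (cases "q \<in> fst c")
    case True
    then have "snd c q \<notin> cball (snd c p) e"
      using that c by (force simp: K_def)
    then show ?thesis
      using g(3) by (simp add: f_def)
  qed (simp add: f_def)
  have ev0: "eventually (\<lambda>q'. f q' = 0) (nhdsin mtop q)" if "q \<in> points B" "q \<notin> fst c" for q
  proof -
    have "openin mtop (points B - K)"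
      using K openin_closedin_eq closedin_def by (metis topspace_eq)
    then have "eventually (\<lambda>q'. q' \<in> points B - K) (nhdsin mtop q)"
      using that Kc by (intro eventually_nhdsin_openin) auto
    then show ?thesis
      by eventually_elim (simp add: fK)
  qed
  show thesis
  proof
    show "smooth_fun B f"
      unfolding smooth_fun_iff
    proof
      fix q assume q: "q \<in> points B"
      show "msmooth B f q"
      proof (cases "q \<in> fst c")
        case True
        have "eventually (\<lambda>q'. g (snd c q') = f q') (nhdsin mtop q)"
          using eventually_in_domain[OF c(1) True] by eventually_elim (simp add: f_def)
        then show ?thesis
          using msmooth_compose[OF msmooth_chart[OF c(1) True] g(1)] by (rule msmooth_cong)
      next
        case False
        have "eventually (\<lambda>q'. 0 = f q') (nhdsin mtop q)"
          using ev0[OF q False] by eventually_elim simp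
        then show ?thesis
          using msmooth_const[OF q] by (rule msmooth_cong)
      qed
    qed
    have "eventually (\<lambda>z. dist (snd c p) z < e / 2) (nhds (snd c p))"
      using eventually_nhds_in_open[of "ball (snd c p) (e / 2)"] e by simp
    moreover have "eventually (\<lambda>z. z \<in> snd c ` fst c) (nhds (snd c p))"
      using open_image[OF c(1)] c by (intro eventually_nhds_in_open) auto
    ultimately show "eventually (\<lambda>q. f q = 1) (nhdsin mtop p)"
      unfolding eventually_nhdsin_iff[OF c]
      by eventually_elim (simp add: f_def chart_inv_in chart_chart_inv g)
    show "f q = 0" if "q \<notin> W \<inter> fst c" for q
      using fK Kc that by blast
  qed (rule ev0)
qed

text \<open>\<open>Y\<close> gives the components in the chart \<open>c\<close>. Near a point
  outside of the domain the product vanishes identically, so that it is smooth there whatever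
  \<open>Y\<close> is.\<close>

lemma cutoff_field:
  assumes c: "c \<in> B" and f: "smooth_fun B f"
    "\<And>q. q \<notin> fst c \<Longrightarrow> f q = 0"
    "\<And>q. q \<in> points B \<Longrightarrow> q \<notin> fst c \<Longrightarrow> eventually (\<lambda>q'. f q' = 0) (nhdsin mtop q)"
    and Y: "\<And>q. q \<in> fst c \<Longrightarrow> msmooth B Y q"
  shows "(\<lambda>q. f q *\<^sub>R tvec_of B c q (Y q)) \<in> vector_fields B"
proof (rule vector_fieldsI)
  show "f q *\<^sub>R tvec_of B c q (Y q) \<in> tangent_space B q" for q
    by (cases "q \<in> fst c") (simp_all add: tvec_of_in[OF c] tangent_scale f(2) tangent_0)
next
  fix q assume q: "q \<in> points B"
  show "\<exists>d\<in>B. q \<in> fst d \<and> msmooth B (\<lambda>q. (f q *\<^sub>R tvec_of B c q (Y q)) d) q"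
  proof (cases "q \<in> fst c")
    case True
    have "eventually (\<lambda>q'. f q' *\<^sub>R Y q' = (f q' *\<^sub>R tvec_of B c q' (Y q')) c) (nhdsin mtop q)"
      using eventually_in_domain[OF c True] by eventually_elim (simp add: c)
    moreover have "msmooth B (\<lambda>q'. f q' *\<^sub>R Y q') q"
      using f(1) q Y[OF True] by (intro msmooth_scaleR) (auto simp: smooth_fun_iff)
    ultimately show ?thesis
      using True c by (intro bexI[of _ c] conjI) (simp_all only: msmooth_cong)
  next
    case False
    obtain d where d: "d \<in> B" "q \<in> fst d"
      using q by (rule in_pointsE)
    have "eventually (\<lambda>q'. 0 = (f q' *\<^sub>R tvec_of B c q' (Y q')) d) (nhdsin mtop q)"
      using f(3)[OF q False] by eventually_elim simp
    then have "msmooth B (\<lambda>q. (f q *\<^sub>R tvec_of B c q (Y q)) d) q"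
      by (rule msmooth_cong[OF _ msmooth_const[OF q]])
    then show ?thesis
      using d by blast
  qed
qed

text \<open>Provides the global fields over which the definition of \<open>christoffel\<close>
  quantifies; without them the description there would be vacuous.\<close>

lemma ex_field:
  assumes "c \<in> B" "p \<in> fst c"
  obtains X where "X \<in> vector_fields B" "eventually (\<lambda>q. X q = tvec_of B c q u) (nhdsin mtop p)"
proof -
  obtain f where f: "smooth_fun B f" "eventually (\<lambda>q. f q = 1) (nhdsin mtop p)"
    "\<And>q. q \<notin> fst c \<Longrightarrow> f q = 0"
    "\<And>q. q \<in> points B \<Longrightarrow> q \<notin> fst c \<Longrightarrow> eventually (\<lambda>q'. f q' = 0) (nhdsin mtop q)"
    using ex_cutoff[OF assms openin_domain[OF assms(1)] assms(2)] by (metis IntI Int_absorb)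
  have "(\<lambda>q. f q *\<^sub>R tvec_of B c q u) \<in> vector_fields B"
    using assms chart_in_points by (intro cutoff_field f msmooth_const) auto
  moreover have "eventually (\<lambda>q. f q *\<^sub>R tvec_of B c q u = tvec_of B c q u) (nhdsin mtop p)"
    using f(2) by eventually_elim simp
  ultimately show thesis
    by (rule that)
qed

lemma vector_fields_sum:
  "(\<And>i. i \<in> I \<Longrightarrow> F i \<in> vector_fields B) \<Longrightarrow> (\<Sum>i\<in>I. F i) \<in> vector_fields B"
  by (induction I rule: infinite_finite_induct) (auto intro: vector_fields_zero vector_fields_add)

section \<open>Tensoriality: additive maps that are linear over functions depend only on the value
  at a point\<close>

context
  fixes L :: "('a \<Rightarrow> ('a, 'b) tvec) \<Rightarrow> 'v::real_vector" and c p
  assumes L_add: "\<And>X Y. X \<in> vector_fields B \<Longrightarrow> Y \<in> vector_fields B \<Longrightarrow> L (X + Y) = L X + L Y"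
    and L_scale: "\<And>f X. smooth_fun B f \<Longrightarrow> X \<in> vector_fields B \<Longrightarrow>
      L (\<lambda>q. f q *\<^sub>R X q) = f p *\<^sub>R L X"
    and c: "c \<in> B" "p \<in> fst c"
begin

lemma tensorial_sum:
  "(\<And>i. i \<in> I \<Longrightarrow> F i \<in> vector_fields B) \<Longrightarrow> L (\<Sum>i\<in>I. F i) = (\<Sum>i\<in>I. L (F i))"
proof (induction I rule: infinite_finite_induct)
  have "L 0 = 0"
    using L_add[of 0 0] vector_fields_zero by simp
  {
    case (infinite I)
    then show ?case using \<open>L 0 = 0\<close> by (simp only: sum.infinite not_False_eq_True)
  next
    case empty
    then show ?case using \<open>L 0 = 0\<close> by (simp only: sum.empty)
  }
  case (insert i I)
  then have "L (sum F (insert i I)) = L (F i + sum F I)"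
    by (simp only: sum.insert not_False_eq_True)
  also have "\<dots> = L (F i) + L (sum F I)"
    using insert.prems by (intro L_add vector_fields_sum) auto
  also have "L (sum F I) = (\<Sum>i\<in>I. L (F i))"
    using insert by auto
  also have "L (F i) + \<dots> = (\<Sum>i\<in>insert i I. L (F i))"
    using insert(1,2) by simp
  finally show ?case .
qed

lemma tensorial_zero:
  assumes X: "X \<in> vector_fields B" "X p c = 0"
  shows "L X = 0"
proof -
  obtain f where f: "smooth_fun B f" "eventually (\<lambda>q. f q = 1) (nhdsin mtop p)"
    "\<And>q. q \<notin> fst c \<Longrightarrow> f q = 0"
    "\<And>q. q \<in> points B \<Longrightarrow> q \<notin> fst c \<Longrightarrow> eventually (\<lambda>q'. f q' = 0) (nhdsin mtop q)"
    using ex_cutoff[OF c openin_domain[OF c(1)] c(2)] by (metis IntI Int_absorb)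
  \<comment> \<open>Since \<open>f p = 1\<close>, multiplication of the argument by \<open>f\<close>
    or by its square does not change the value of \<open>L\<close>.\<close>
  have fp: "f p = 1"
    using eventually_nhdsin_self[OF chart_in_points[OF c] f(2)] .
  define E where "E b = (\<lambda>q. f q *\<^sub>R tvec_of B c q b)" for b
  define x where "x b q = f q * (X q c \<bullet> b)" for b q
  have E: "E b \<in> vector_fields B" for b
    unfolding E_def using chart_in_points c by (intro cutoff_field f msmooth_const) auto
  have x: "smooth_fun B (x b)" for b
    unfolding smooth_fun_iff
  proof
    fix q assume q: "q \<in> points B"
    show "msmooth B (x b) q"
    proof (cases "q \<in> fst c")
      case True
      show ?thesis
        unfolding x_def[abs_def]
        using f(1) q by (intro msmooth_mult msmooth_linear[OF bounded_linear_inner_left]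
            vector_fields_msmooth[OF X(1) c(1) True]) (simp add: smooth_fun_iff)
    next
      case False
      show ?thesis
        by (rule msmooth_cong[OF eventually_mono[OF f(4)[OF q False]] msmooth_const[OF q]])
          (simp add: x_def)
    qed
  qed
  \<comment> \<open>The square is needed because one factor \<open>f\<close> turns the coordinate
    fields into global fields and the other one turns the components of \<open>X\<close> into global
    functions. These functions vanish at \<open>p\<close>, so \<open>L\<close> kills every
    summand.\<close>
  have "(\<lambda>q. (f q * f q) *\<^sub>R X q) = (\<Sum>b\<in>Basis. (\<lambda>q. x b q *\<^sub>R E b q))"
  proof
    fix q
    show "(f q * f q) *\<^sub>R X q = (\<Sum>b\<in>Basis. (\<lambda>q. x b q *\<^sub>R E b q)) q"
    proof (cases "q \<in> fst c")
      case True
      have "(\<Sum>b\<in>Basis. x b q *\<^sub>R E b q) \<in> tangent_space B q"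
        by (intro subspace_sum[OF subspace_tangent_space] tangent_scale vector_fields_tangent E)
      moreover have "(f q * f q) *\<^sub>R X q \<in> tangent_space B q"
        by (intro tangent_scale vector_fields_tangent X)
      moreover have "((f q * f q) *\<^sub>R X q) c = (\<Sum>b\<in>Basis. x b q *\<^sub>R E b q) c"
      proof -
        have "(f q * f q) *\<^sub>R X q c = (f q * f q) *\<^sub>R (\<Sum>b\<in>Basis. (X q c \<bullet> b) *\<^sub>R b)"
          by (simp add: euclidean_representation)
        also have "\<dots> = (\<Sum>b\<in>Basis. (x b q *\<^sub>R E b q) c)"
          by (simp add: scaleR_sum_right x_def E_def c(1) True mult_ac)
        finally show ?thesis
          by (simp add: sum_fun_eq)
      qed
      ultimately show ?thesis
        using tangent_eqI[OF _ _ c(1) True] by (simp add: sum_fun_eq[of "\<lambda>b q. x b q *\<^sub>R E b q"])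
    qed (simp add: f(3) sum_fun_eq x_def fun_eq_iff)
  qed
  moreover have "L (\<lambda>q. (f q * f q) *\<^sub>R X q) = L X"
    using L_scale[of "\<lambda>q. f q * f q" X] f(1) X(1) fp
    by (simp add: smooth_fun_iff msmooth_mult)
  moreover have "L (\<Sum>b\<in>Basis. (\<lambda>q. x b q *\<^sub>R E b q)) = (\<Sum>b\<in>Basis. L (\<lambda>q. x b q *\<^sub>R E b q))"
    by (intro tensorial_sum vector_fields_scale E x)
  moreover have "L (\<lambda>q. x b q *\<^sub>R E b q) = 0" for b
    by (simp add: L_scale[OF x E]) (simp add: x_def X)
  ultimately show ?thesis
    by simp
qed

lemma tensorial_expansion:
  assumes "finite I" "X \<in> vector_fields B" "\<And>i. i \<in> I \<Longrightarrow> E i \<in> vector_fields B"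
    "X p c = (\<Sum>i\<in>I. k i *\<^sub>R E i p c)"
  shows "L X = (\<Sum>i\<in>I. k i *\<^sub>R L (E i))"
proof -
  have const: "smooth_fun B (\<lambda>q. r)" for r
    by (simp add: smooth_fun_iff msmooth_const)
  \<comment> \<open>The negative of the proposed expansion, so that \<open>X + Z\<close> vanishes at
    \<open>p\<close> and \<open>tensorial_zero\<close> applies.\<close>
  define Z where "Z = (\<Sum>i\<in>I. (\<lambda>q. (- k i) *\<^sub>R E i q))"
  have Z: "Z \<in> vector_fields B"
    unfolding Z_def by (intro vector_fields_sum vector_fields_scale const assms)
  have "L Z = (\<Sum>i\<in>I. L (\<lambda>q. (- k i) *\<^sub>R E i q))"
    unfolding Z_def by (intro tensorial_sum vector_fields_scale const assms)
  also have "\<dots> = (\<Sum>i\<in>I. (- k i) *\<^sub>R L (E i))"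
    using assms(3) by (intro sum.cong L_scale[OF const]) auto
  also have "\<dots> = - (\<Sum>i\<in>I. k i *\<^sub>R L (E i))"
    by (simp add: sum_negf)
  finally have "L (X + Z) = L X - (\<Sum>i\<in>I. k i *\<^sub>R L (E i))"
    using L_add[OF assms(2) Z] by simp
  moreover have "L (X + Z) = 0"
    using assms(4) by (intro tensorial_zero vector_fields_add assms Z)
      (simp add: Z_def sum_fun_eq sum_negf)
  ultimately show ?thesis
    by simp
qed

end

end

section \<open>The tangent bundle\<close>

lemma in_T_chart [simp]: "v \<in> fst (T_chart B c) \<longleftrightarrow> fst v \<in> fst c \<and> snd v \<in> tangent_space B (fst v)"
  and snd_T_chart: "snd (T_chart B c) v = (snd c (fst v), snd v c)"
  by (cases v, auto simp: T_chart_def)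

context smooth_atlas
begin

lemma inj_on_T_chart: "c \<in> B \<Longrightarrow> inj_on (snd (T_chart B c)) (fst (T_chart B c))"
proof (rule inj_onI)
  fix v w assume c: "c \<in> B" and vw: "v \<in> fst (T_chart B c)" "w \<in> fst (T_chart B c)"
    and eq: "snd (T_chart B c) v = snd (T_chart B c) w"
  have "fst v = fst w"
    using vw eq inj_onD[OF inj[OF c]] by (simp add: snd_T_chart)
  moreover have "snd v = snd w"
    using vw eq c tangent_eqI[of "snd v" "fst v" "snd w" c] calculation by (simp add: snd_T_chart)
  ultimately show "v = w"
    by (simp add: prod_eq_iff)
qed

lemma chart_inv_T_chart:
  "c \<in> B \<Longrightarrow> p \<in> fst c \<Longrightarrow> chart_inv (T_chart B c) (snd c p, y) = (p, tvec_of B c p y)"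
  by (intro inv_into_f_eq inj_on_T_chart) (auto simp: tvec_of_in snd_T_chart)

lemma T_chart_overlap:
  assumes "c \<in> B" "d \<in> B"
  shows "snd (T_chart B c) ` (fst (T_chart B c) \<inter> fst (T_chart B d)) = snd c ` (fst c \<inter> fst d) \<times> UNIV"
proof
  show "snd c ` (fst c \<inter> fst d) \<times> UNIV \<subseteq>
      snd (T_chart B c) ` (fst (T_chart B c) \<inter> fst (T_chart B d))"
  proof clarify
    fix p y
    assume "p \<in> fst c" "p \<in> fst d"
    then show "(snd c p, y) \<in> snd (T_chart B c) ` (fst (T_chart B c) \<inter> fst (T_chart B d))"
      using assms by (intro image_eqI[of _ _ "(p, tvec_of B c p y)"]) (auto simp: tvec_of_in snd_T_chart)
  qed
qed (auto simp: snd_T_chart)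

text \<open>The transition maps are \<open>(x, y) \<mapsto> (\<tau> x, D\<tau>(x) y)\<close>, and
  \<open>smooth_at_frechet_at\<close> gives the smoothness of the second component jointly in
  \<open>x\<close> and \<open>y\<close>.\<close>

lemma smooth_atlas_T_atlas: "smooth_atlas (T_atlas B)"
proof
  fix C D assume "C \<in> T_atlas B" "D \<in> T_atlas B"
  then obtain c d where c: "c \<in> B" "C = T_chart B c" and d: "d \<in> B" "D = T_chart B d"
    by (auto simp: T_atlas_def)
  show "inj_on (snd C) (fst C)"
    unfolding c(2) by (rule inj_on_T_chart[OF c(1)])
  show "open (snd C ` fst C)"
    using T_chart_overlap[OF c(1,1)] open_image[OF c(1)] unfolding c(2) by (simp add: open_Times)
  show o: "open (snd C ` (fst C \<inter> fst D))"
    unfolding c(2) d(2) T_chart_overlap[OF c(1) d(1)]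
    by (intro open_Times open_overlap c d open_UNIV)
  show "smooth_on (snd C ` (fst C \<inter> fst D)) (snd D \<circ> chart_inv C)"
    unfolding smooth_on_iff_smooth_at[OF o]
  proof
    fix z assume "z \<in> snd C ` (fst C \<inter> fst D)"
    then obtain p y where p: "p \<in> fst c" "p \<in> fst d" and z: "z = (snd c p, y)"
      unfolding c(2) d(2) T_chart_overlap[OF c(1) d(1)] by blast
    let ?f = "\<lambda>x. snd d (chart_inv c x)"
    have sf: "smooth_at ?f (fst z)"
      using smooth_at_transition[OF c(1) d(1) p] by (simp add: z)
    have "smooth_at (\<lambda>z. (?f (fst z), frechet_derivative ?f (at (fst z)) (snd z))) z"
      by (intro smooth_at_Pair smooth_at_frechet_at smooth_at_fst smooth_at_snd smooth_at_ident
          smooth_at_compose[of fst z ?f] sf)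
    moreover have "eventually (\<lambda>z. z \<in> snd C ` (fst C \<inter> fst D)) (nhds z)"
      using o \<open>z \<in> _\<close> by (rule eventually_nhds_in_open)
    then have "eventually (\<lambda>z. (?f (fst z), frechet_derivative ?f (at (fst z)) (snd z)) =
        (snd D \<circ> chart_inv C) z) (nhds z)"
    proof eventually_elim
      fix z' assume "z' \<in> snd C ` (fst C \<inter> fst D)"
      then obtain p y where p: "p \<in> fst c" "p \<in> fst d" and z': "z' = (snd c p, y)"
        unfolding c(2) d(2) T_chart_overlap[OF c(1) d(1)] by blast
      show "(?f (fst z'), frechet_derivative ?f (at (fst z')) (snd z')) = (snd D \<circ> chart_inv C) z'"
        using p c d by (simp add: z' chart_inv_T_chart tvec_of_apply dtr_def mderiv_def snd_T_chart)
    qed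
    ultimately show "smooth_at (snd D \<circ> chart_inv C) z"
      by (rule smooth_at_cong[rotated])
  qed
qed

end

locale tangent_atlas = smooth_atlas \<A>
  for \<A> :: "('a, 'e::euclidean_space) chart set"
begin

abbreviation "T \<equiv> T_chart \<A>"
abbreviation "TA \<equiv> T_atlas \<A>"
abbreviation "TM \<equiv> Sigma (points \<A>) (tangent_space \<A>)"

end

text \<open>The calculus in charts becomes available on the tangent bundle under the prefix
  \<open>TM\<close>; names without the prefix refer to the base manifold.\<close>

sublocale tangent_atlas \<subseteq> TM: smooth_atlas "T_atlas \<A>"
  by (rule smooth_atlas_T_atlas)

context tangent_atlas
begin

lemma T_in [simp]: "c \<in> \<A> \<Longrightarrow> T c \<in> TA"
  by (simp add: T_atlas_def)

lemma T_inE: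
  assumes "C \<in> TA"
  obtains c where "c \<in> \<A>" "C = T c"
  using assms by (auto simp: T_atlas_def)

lemma points_T_atlas: "points TA = TM"
  by (fastforce simp: points_def T_atlas_def)

lemma msmooth_fibre:
  assumes "c \<in> \<A>" "v \<in> TM" "fst v \<in> fst c"
  shows "msmooth TA (\<lambda>v. snd v c) v"
  using TM.msmooth_linear[OF bounded_linear_snd TM.msmooth_chart[of "T c" v]] assms
  by (auto simp: snd_T_chart)

lemma T_chart_has_derivative:
  assumes "c \<in> \<A>" "v \<in> TM" "fst v \<in> fst c"
  shows "((\<lambda>z. snd (T c) (chart_inv (T c) z)) has_derivative (\<lambda>u. u)) (at (snd (T c) v))"
proof -
  have v: "T c \<in> TA" "v \<in> fst (T c)"
    using assms by auto
  have "mderiv (T c) (snd (T c)) v = (\<lambda>u. u)"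
    using TM.dtr_self[OF v] by (simp add: dtr_def fun_eq_iff)
  then show ?thesis
    using TM.mderiv_has_derivative[OF v TM.msmooth_chart[OF v]] by simp
qed

lemma mderiv_fibre:
  assumes "c \<in> \<A>" "v \<in> TM" "fst v \<in> fst c"
  shows "mderiv (T c) (\<lambda>v. snd v c) v u = snd u"
  using has_derivative_snd[OF T_chart_has_derivative[OF assms]]
  by (intro fun_cong[OF mderivI]) (simp add: snd_T_chart)

text \<open>Continuity of the projection in terms of filters: in induced coordinates it is
  \<open>fst\<close>.\<close>

lemma eventually_base:
  assumes "v \<in> TM" "eventually P (nhdsin mtop (fst v))"
  shows "eventually (\<lambda>v. P (fst v)) (nhdsin TM.mtop v)"
proof -
  obtain c where c: "c \<in> \<A>" "fst v \<in> fst c"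
    using assms(1) by (auto elim: in_pointsE)
  have v: "T c \<in> TA" "v \<in> fst (T c)"
    using assms c by auto
  define h where "h = (\<lambda>z. fst (snd (T c) (chart_inv (T c) z)))"
  have hv: "h (snd (T c) v) = snd c (fst v)"
    unfolding h_def TM.chart_inv_chart[OF v] by (simp add: snd_T_chart)
  have "isCont h (snd (T c) v)"
    unfolding h_def
    using has_derivative_continuous[OF has_derivative_fst[OF T_chart_has_derivative[OF c(1) assms(1) c(2)]]] .
  then have "eventually (\<lambda>z. h z \<in> snd c ` fst c \<and> P (chart_inv c (h z))) (nhds (snd (T c) v))"
    by (rule eventually_isCont_compose) (use assms(2) in \<open>simp add: hv flip: eventually_nhdsin_iff[OF c]\<close>)
  moreover have "eventually (\<lambda>z. z \<in> snd (T c) ` fst (T c)) (nhds (snd (T c) v))"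
    using v TM.open_image[OF v(1)] by (intro eventually_nhds_in_open) auto
  ultimately show ?thesis
    unfolding TM.eventually_nhdsin_iff[OF v]
  proof eventually_elim
    fix z assume z: "h z \<in> snd c ` fst c \<and> P (chart_inv c (h z))" "z \<in> snd (T c) ` fst (T c)"
    have "fst (chart_inv (T c) z) \<in> fst c"
      using TM.chart_inv_in[OF z(2)] by auto
    then have "chart_inv c (h z) = fst (chart_inv (T c) z)"
      using chart_inv_chart[OF c(1)] by (simp add: h_def snd_T_chart)
    then show "z \<in> snd (T c) ` fst (T c) \<and> P (fst (chart_inv (T c) z))"
      using z by simp
  qed
qed

lemma msmooth_base:
  assumes "msmooth \<A> F (fst v)" "v \<in> TM"
  shows "msmooth TA (\<lambda>v. F (fst v)) v"
proof -
  obtain c where c: "c \<in> \<A>" "fst v \<in> fst c"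
    using assms(2) by (auto elim: in_pointsE)
  have v: "T c \<in> TA" "v \<in> fst (T c)"
    using assms c by auto
  have "msmooth TA (\<lambda>v. F (chart_inv c (fst (snd (T c) v)))) v"
    using assms(1) msmooth_iff[OF c, of F]
    by (intro TM.msmooth_compose[of "\<lambda>v. fst (snd (T c) v)" v "\<lambda>x. F (chart_inv c x)"]
        TM.msmooth_linear[OF bounded_linear_fst] TM.msmooth_chart v) (simp add: snd_T_chart)
  then show ?thesis
    by (rule TM.msmooth_cong[rotated])
      (rule eventually_mono[OF eventually_base[OF assms(2) eventually_in_domain[OF c]]], simp add: c snd_T_chart)
qed

text \<open>In induced coordinates a function pulled back from the base does not depend on
  \<open>y\<close>, so only the first component of the direction counts.\<close>

lemma mderiv_base:
  assumes "c \<in> \<A>" "msmooth \<A> F (fst v)" "v \<in> TM" "fst v \<in> fst c"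
  shows "mderiv (T c) (\<lambda>v. F (fst v)) v u = mderiv c F (fst v) (fst u)"
proof -
  have v: "T c \<in> TA" "v \<in> fst (T c)"
    using assms by auto
  have "mderiv (T c) (\<lambda>v. F (fst v)) v u = mderiv (T c) (\<lambda>v. F (chart_inv c (fst (snd (T c) v)))) v u"
    by (intro fun_cong[OF TM.mderiv_cong] v
        eventually_mono[OF eventually_base[OF assms(3) eventually_in_domain[OF assms(1,4)]]])
      (simp add: assms(1) snd_T_chart)
  also have "mderiv (T c) (\<lambda>v. F (chart_inv c (fst (snd (T c) v)))) v =
      (\<lambda>u. mderiv c F (fst v) (fst u))"
  proof (rule mderivI)
    have 1: "((\<lambda>z. F (chart_inv c z)) has_derivative mderiv c F (fst v))
        (at (fst (snd (T c) (chart_inv (T c) (snd (T c) v)))))"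
      unfolding TM.chart_inv_chart[OF v]
      using mderiv_has_derivative[OF assms(1,4,2)] by (simp add: snd_T_chart)
    show "((\<lambda>z. F (chart_inv c (fst (snd (T c) (chart_inv (T c) z))))) has_derivative
        (\<lambda>u. mderiv c F (fst v) (fst u))) (at (snd (T c) v))"
      by (rule has_derivative_compose[OF has_derivative_fst[OF T_chart_has_derivative[OF assms(1,3,4)]] 1])
  qed
  finally show ?thesis .
qed

text \<open>The Jacobian of \<open>(x, y) \<mapsto> (\<tau> x, D\<tau>(x) y)\<close>. The
  \<open>d2tr\<close> term, which is linear in the fibre coordinate, is the inhomogeneous term in
  the law of nonlinear connections.\<close>

lemma dtr_T_chart:
  assumes "c \<in> \<A>" "d \<in> \<A>" "v \<in> TM" "fst v \<in> fst c" "fst v \<in> fst d"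
  shows "dtr (T c) (T d) v (u, w) =
    (dtr c d (fst v) u, d2tr c d (fst v) u (snd v c) + dtr c d (fst v) w)"
proof -
  have v: "T c \<in> TA" "v \<in> fst (T c)" "T d \<in> TA" "v \<in> fst (T d)"
    using assms by auto
  have D: "((\<lambda>z. snd (T d) (chart_inv (T c) z)) has_derivative dtr (T c) (T d) v) (at (snd (T c) v))"
    using TM.mderiv_has_derivative[OF v(1,2) TM.msmooth_chart[OF v(3,4)]]
    by (simp add: dtr_def[abs_def])
  have "mderiv (T c) (\<lambda>v. snd d (fst v)) v = (\<lambda>u. fst (dtr (T c) (T d) v u))"
    using has_derivative_fst[OF D] by (intro mderivI) (simp add: snd_T_chart)
  then have "fst (dtr (T c) (T d) v (u, w)) = mderiv (T c) (\<lambda>v. snd d (fst v)) v (u, w)"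
    by simp
  also have "\<dots> = dtr c d (fst v) u"
    unfolding dtr_def mderiv_base[OF assms(1) msmooth_chart[OF assms(2,5)] assms(3,4)] by simp
  finally have 1: "fst (dtr (T c) (T d) v (u, w)) = dtr c d (fst v) u" .
  have "mderiv (T c) (\<lambda>v. snd v d) v = (\<lambda>u. snd (dtr (T c) (T d) v u))"
    using has_derivative_snd[OF D] by (intro mderivI) (simp add: snd_T_chart)
  then have "snd (dtr (T c) (T d) v (u, w)) = mderiv (T c) (\<lambda>v. snd v d) v (u, w)"
    by simp
  also have "\<dots> = mderiv (T c) (\<lambda>v. \<Sum>b\<in>Basis. (snd v c \<bullet> b) *\<^sub>R dtr c d (fst v) b) v (u, w)"
  proof (intro fun_cong[OF TM.mderiv_cong] v)
    have "eventually (\<lambda>v. v \<in> fst (T c) \<and> v \<in> fst (T d)) (nhdsin TM.mtop v)"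
      by (intro eventually_conj TM.eventually_in_domain v)
    then show "eventually (\<lambda>v. snd v d = (\<Sum>b\<in>Basis. (snd v c \<bullet> b) *\<^sub>R dtr c d (fst v) b))
        (nhdsin TM.mtop v)"
    proof eventually_elim
      fix v assume "v \<in> fst (T c) \<and> v \<in> fst (T d)"
      then have v: "snd v \<in> tangent_space \<A> (fst v)" "fst v \<in> fst c" "fst v \<in> fst d"
        by auto
      have "snd v d = dtr c d (fst v) (snd v c)"
        using tangent_coord[OF v(1) assms(1,2) v(2,3)] .
      also have "\<dots> = (\<Sum>b\<in>Basis. (snd v c \<bullet> b) *\<^sub>R dtr c d (fst v) b)"
        by (rule linear_expansion_Basis[OF linear_dtr[OF assms(1,2) v(2,3)]])
      finally show "snd v d = (\<Sum>b\<in>Basis. (snd v c \<bullet> b) *\<^sub>R dtr c d (fst v) b)" .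
    qed
  qed
  also have "\<dots> = d2tr c d (fst v) u (snd v c) + dtr c d (fst v) w"
  proof -
    have gb: "msmooth TA (\<lambda>v. snd v c \<bullet> b) v" for b
      by (rule TM.msmooth_linear[OF bounded_linear_inner_left msmooth_fibre[OF assms(1,3,4)]])
    have mb: "msmooth \<A> (\<lambda>q. dtr c d q b) (fst v)" for b
      by (intro msmooth_dtr msmooth_const assms chart_in_points[OF assms(1,4)])
    have ib: "mderiv (T c) (\<lambda>v. snd v c \<bullet> b) v = (\<lambda>u. snd u \<bullet> b)" for b
    proof -
      have "mderiv (T c) (\<lambda>v. snd v c) v = snd"
        using mderiv_fibre[OF assms(1,3,4)] by (simp add: fun_eq_iff)
      then show ?thesis
        using has_derivative_inner_left[OF TM.mderiv_has_derivative[OF v(1,2)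
              msmooth_fibre[OF assms(1,3,4)]], of b] by (intro mderivI) simp
    qed
    have "mderiv (T c) (\<lambda>v. \<Sum>b\<in>Basis. (snd v c \<bullet> b) *\<^sub>R dtr c d (fst v) b) v (u, w) =
        (\<Sum>b\<in>Basis. mderiv (T c) (\<lambda>v. (snd v c \<bullet> b) *\<^sub>R dtr c d (fst v) b) v (u, w))"
      by (intro fun_cong[OF mderivI] has_derivative_sum TM.mderiv_has_derivative v TM.msmooth_scaleR
          gb msmooth_base[OF mb assms(3)])
    also have "\<dots> = (\<Sum>b\<in>Basis. (snd v c \<bullet> b) *\<^sub>R d2tr c d (fst v) u b) +
        (\<Sum>b\<in>Basis. (w \<bullet> b) *\<^sub>R dtr c d (fst v) b)"
      by (simp add: TM.mderiv_scaleR[OF v(1,2) gb msmooth_base[OF mb assms(3)]] ib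
          mderiv_base[OF assms(1) mb assms(3,4)] d2tr_def sum.distrib add.commute)
    finally show ?thesis
      using linear_expansion_Basis[OF linear_d2tr(1)[OF assms(1,2,4,5)], of u "snd v c"]
        linear_expansion_Basis[OF linear_dtr[OF assms(1,2,4,5)], of w] by simp
  qed
  finally show ?thesis
    using 1 by (simp add: prod_eq_iff)
qed

end

section \<open>Anisotropic connections in coordinates\<close>

lemma linear_expansion_axis:
  fixes f :: "real^'n \<Rightarrow> 'v::real_vector"
  assumes "linear f"
  shows "f u = (\<Sum>i\<in>UNIV. u $ i *\<^sub>R f (axis i 1))"
proof -
  have "f u = f (\<Sum>i\<in>UNIV. u $ i *\<^sub>R axis i 1)"
    by (simp only: vec_expansion[symmetric])
  then show ?thesis
    using assms by (simp add: linear_sum linear_scale)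
qed

lemma bilinear_expansion_axis:
  fixes f :: "real^'n \<Rightarrow> real^'n \<Rightarrow> 'v::real_vector"
  assumes "bilinear f"
  shows "f u w = (\<Sum>i\<in>UNIV. \<Sum>j\<in>UNIV. (u $ i * w $ j) *\<^sub>R f (axis i 1) (axis j 1))"
proof -
  have "f u w = (\<Sum>i\<in>UNIV. u $ i *\<^sub>R f (axis i 1) w)"
    using assms by (intro linear_expansion_axis[of "\<lambda>u. f u w"]) (simp add: bilinear_def)
  also have "f (axis i 1) w = (\<Sum>j\<in>UNIV. w $ j *\<^sub>R f (axis i 1) (axis j 1))" for i
    using assms by (intro linear_expansion_axis) (simp add: bilinear_def)
  then have "(\<Sum>i\<in>UNIV. u $ i *\<^sub>R f (axis i 1) w) =
      (\<Sum>i\<in>UNIV. \<Sum>j\<in>UNIV. (u $ i * w $ j) *\<^sub>R f (axis i 1) (axis j 1))"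
    by (simp add: scaleR_sum_right)
  finally show ?thesis .
qed

text \<open>The Christoffel symbols gathered into one bilinear map, so that the transformation laws
  can be handled without indices.\<close>

definition Gam :: "('a, real^'n) chart set \<Rightarrow> ('a, 'n::finite) aniso_conn \<Rightarrow> ('a, real^'n) chart \<Rightarrow>
    ('a, real^'n) tpoint \<Rightarrow> real^'n \<Rightarrow> real^'n \<Rightarrow> real^'n"
  where "Gam \<A> D c v u w =
    (\<Sum>i\<in>UNIV. \<Sum>j\<in>UNIV. (u $ i * w $ j) *\<^sub>R (\<chi> a. christoffel \<A> D c a i j v))"

lemma bilinear_Gam: "bilinear (Gam \<A> D c v)"
  unfolding bilinear_def Gam_def
  by (auto intro!: linearI simp: algebra_simps sum.distrib scaleR_sum_right)

lemma sum_axis_scaleR: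
  "(\<Sum>i\<in>UNIV. (axis k (1::real) $ i) *\<^sub>R F i) = F (k::'n)" for F :: "'n::finite \<Rightarrow> 'v::real_vector"
proof -
  have "(\<Sum>i\<in>UNIV. (axis k (1::real) $ i) *\<^sub>R F i) = (\<Sum>i\<in>UNIV. if i = k then F i else 0)"
    by (intro sum.cong) (auto simp: axis_def)
  then show ?thesis by simp
qed

lemma Gam_axis [simp]: "Gam \<A> D c v (axis i 1) (axis j 1) $ a = christoffel \<A> D c a i j v"
proof -
  have "Gam \<A> D c v (axis i 1) (axis j 1) = (\<chi> a. christoffel \<A> D c a i j v)"
    unfolding Gam_def by (simp add: sum_axis_scaleR flip: scaleR_scaleR scaleR_sum_right)
  then show ?thesis by simp
qed

locale conic_domain = tangent_atlas \<A> + hausdorff_atlas \<A>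
  for \<A> :: "('a, real^'n::finite) chart set" +
  fixes A :: "('a, real^'n) tpoint set"
  assumes open_A: "openin (atlas_topology (T_atlas \<A>)) A"
    and conic: "conic_set A"
    and base_A: "fst ` A = points \<A>"
begin

lemma A_TM: "A \<subseteq> TM"
  using openin_subset[OF open_A] by (simp add: points_T_atlas)

lemma A_tangent: "v \<in> A \<Longrightarrow> snd v \<in> tangent_space \<A> (fst v)"
  using A_TM by auto

lemma A_points: "v \<in> A \<Longrightarrow> fst v \<in> points \<A>"
  using A_TM by auto

lemma A_in_T: "v \<in> A \<Longrightarrow> fst v \<in> fst c \<Longrightarrow> v \<in> fst (T c)"
  using A_tangent by simp

lemma A_chartE:
  assumes "v \<in> A"
  obtains c where "c \<in> \<A>" "fst v \<in> fst c"
  using A_points[OF assms] by (rule in_pointsE)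

lemma dom_in_iff: "v \<in> dom_in \<A> A c \<longleftrightarrow> v \<in> A \<and> fst v \<in> fst c"
  unfolding dom_in_def using A_tangent by auto

lemma eventually_A: "v \<in> A \<Longrightarrow> eventually (\<lambda>v. v \<in> A) (nhdsin TM.mtop v)"
  by (rule TM.eventually_nhdsin_openin[OF open_A])

lemma eventually_dom:
  assumes "c \<in> \<A>" "v \<in> A" "fst v \<in> fst c"
  shows "eventually (\<lambda>v. v \<in> A \<and> fst v \<in> fst c) (nhdsin TM.mtop v)"
  using assms A_TM by (intro eventually_conj eventually_A eventually_base eventually_in_domain) auto

lemma smooth_in_chart_iff:
  assumes "c \<in> \<A>"
  shows "smooth_in_chart \<A> A c F \<longleftrightarrow> (\<forall>v\<in>A. fst v \<in> fst c \<longrightarrow> msmooth TA F v)"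
  unfolding smooth_in_chart_def dom_in_def comp_def TM.smooth_on_chart_iff[OF T_in[OF assms] open_A]
  using A_tangent by auto

lemma aniso_fields_iff: "Z \<in> aniso_fields \<A> A \<longleftrightarrow>
    (\<forall>v\<in>A. Z v \<in> tangent_space \<A> (fst v)) \<and> (\<forall>v. v \<notin> A \<longrightarrow> Z v = 0) \<and>
    (\<forall>c\<in>\<A>. \<forall>v\<in>A. fst v \<in> fst c \<longrightarrow> msmooth TA (\<lambda>v. Z v c) v)"
  unfolding aniso_fields_def using smooth_in_chart_iff by blast

lemma msmooth_dtr_base:
  assumes "c \<in> \<A>" "d \<in> \<A>" "v \<in> A" "fst v \<in> fst c" "fst v \<in> fst d" "msmooth TA G v"
  shows "msmooth TA (\<lambda>v. dtr c d (fst v) (G v)) v"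
  unfolding dtr_def mderiv_def
  using assms A_TM by (intro TM.msmooth_frechet_at smooth_at_transition msmooth_base msmooth_chart) auto

text \<open>The components in \<open>d\<close> are the Jacobian applied to those in
  \<open>c\<close>, so \<open>mderiv_dtr\<close> yields the second-derivative term. A connection has
  to compensate exactly this term.\<close>

lemma mderiv_field_change:
  assumes "c \<in> \<A>" "d \<in> \<A>" "p \<in> fst c" "p \<in> fst d" "Y \<in> vector_fields \<A>"
  shows "mderiv d (\<lambda>q. Y q d) p (dtr c d p u) =
    d2tr c d p u (Y p c) + dtr c d p (mderiv c (\<lambda>q. Y q c) p u)"
proof -
  have "mderiv d (\<lambda>q. Y q d) p (dtr c d p u) = mderiv c (\<lambda>q. Y q d) p u"
    by (rule mderiv_trans[OF assms(1-4) vector_fields_msmooth[OF assms(5,2,4)]])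
  also have "\<dots> = mderiv c (\<lambda>q. dtr c d q (Y q c)) p u"
  proof (rule fun_cong[OF mderiv_cong[OF assms(1,3)]])
    have "eventually (\<lambda>q. q \<in> fst c \<and> q \<in> fst d) (nhdsin mtop p)"
      by (intro eventually_conj eventually_in_domain assms)
    then show "eventually (\<lambda>q. Y q d = dtr c d q (Y q c)) (nhdsin mtop p)"
      by eventually_elim (rule tangent_coord[OF vector_fields_tangent[OF assms(5)] assms(1,2)], auto)
  qed
  also have "\<dots> = d2tr c d p u (Y p c) + dtr c d p (mderiv c (\<lambda>q. Y q c) p u)"
    by (rule mderiv_dtr[OF assms(1-4) vector_fields_msmooth[OF assms(5,1,3)]])
  finally show ?thesis .
qed

text \<open>The law of the Christoffel symbols, solved so that only the transition from
  \<open>c\<close> to \<open>d\<close> occurs and no inverse Jacobian. Smoothness is required for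
  fixed arguments only, which is why smoothness for varying arguments is always derived from an
  expansion.\<close>

definition aniso_data :: "(('a, real^'n) chart \<Rightarrow> ('a, real^'n) tpoint \<Rightarrow> real^'n \<Rightarrow> real^'n \<Rightarrow> real^'n) \<Rightarrow> bool"
  where "aniso_data G \<longleftrightarrow> (\<forall>c\<in>\<A>. \<forall>v\<in>A. fst v \<in> fst c \<longrightarrow> bilinear (G c v) \<and>
    (\<forall>u w. msmooth TA (\<lambda>v. G c v u w) v) \<and>
    (\<forall>d\<in>\<A>. fst v \<in> fst d \<longrightarrow> (\<forall>u w. G d v (dtr c d (fst v) u) (dtr c d (fst v) w) +
      d2tr c d (fst v) u w = dtr c d (fst v) (G c v u w))))"

lemma aniso_dataD:
  assumes "aniso_data G" "c \<in> \<A>" "v \<in> A" "fst v \<in> fst c"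
  shows "bilinear (G c v)" and "msmooth TA (\<lambda>v. G c v u w) v"
    and "d \<in> \<A> \<Longrightarrow> fst v \<in> fst d \<Longrightarrow>
      G d v (dtr c d (fst v) u) (dtr c d (fst v) w) =
      dtr c d (fst v) (G c v u w) - d2tr c d (fst v) u w"
  using assms unfolding aniso_data_def eq_diff_eq by blast+

lemma ex_coord_field:
  assumes "c \<in> \<A>" "p \<in> fst c"
  obtains E where "\<And>i. E i \<in> vector_fields \<A>"
    "\<And>i. eventually (\<lambda>q. E i q = coord_field \<A> c i q) (nhdsin mtop p)"
proof -
  have "\<exists>X. X \<in> vector_fields \<A> \<and> eventually (\<lambda>q. X q = coord_field \<A> c i q) (nhdsin mtop p)" for i
    unfolding coord_field_def using ex_field[OF assms, of "axis i 1"] by blast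
  then show thesis
    using that by metis
qed

text \<open>A coordinate field has constant components near \<open>p\<close>. The vanishing
  derivative is what makes the covariant derivative of two such fields a pure Christoffel
  symbol.\<close>

lemma coord_field_near:
  assumes "c \<in> \<A>" "p \<in> fst c" "eventually (\<lambda>q. X q = coord_field \<A> c i q) (nhdsin mtop p)"
  shows "X p c = axis i 1" and "mderiv c (\<lambda>q. X q c) p = (\<lambda>u. 0)"
proof -
  show "X p c = axis i 1"
    using eventually_nhdsin_self[OF chart_in_points[OF assms(1,2)] assms(3)] assms(1,2)
    by (simp add: coord_field_def)
  have "eventually (\<lambda>q. X q c = axis i 1) (nhdsin mtop p)"
    using assms(3) eventually_in_domain[OF assms(1,2)]
    by eventually_elim (simp add: coord_field_def assms(1))
  then have "mderiv c (\<lambda>q. X q c) p = mderiv c (\<lambda>q. axis i 1) p"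
    by (rule mderiv_cong[OF assms(1,2)])
  then show "mderiv c (\<lambda>q. X q c) p = (\<lambda>u. 0)"
    by (simp add: fun_eq_iff)
qed

lemma coord_agree_near:
  "c \<in> \<A> \<Longrightarrow> p \<in> fst c \<Longrightarrow> agree_near \<A> p X (coord_field \<A> c i) \<longleftrightarrow>
    eventually (\<lambda>q. X q = coord_field \<A> c i q) (nhdsin mtop p)"
  using agree_near_iff[OF chart_in_points] by blast

text \<open>The connection minus the flat connection of the chart \<open>c\<close>. The derivative
  terms of the two Leibniz rules cancel, so the difference is linear over functions in both
  arguments.\<close>

definition conn_diff :: "('a, 'n) aniso_conn \<Rightarrow> ('a, real^'n) chart \<Rightarrow> ('a, real^'n) tpoint \<Rightarrow>
    ('a \<Rightarrow> ('a, real^'n) tvec) \<Rightarrow> ('a \<Rightarrow> ('a, real^'n) tvec) \<Rightarrow> real^'n" where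
  "conn_diff D c v X Y = D X Y v c - mderiv c (\<lambda>q. Y q c) (fst v) (X (fst v) c)"

section \<open>Christoffel symbols of a given anisotropic connection\<close>

context
  fixes D :: "('a, 'n) aniso_conn"
  assumes D: "D \<in> aniso_connections \<A> A"
begin

lemma aniso_conn_field:
  "X \<in> vector_fields \<A> \<Longrightarrow> Y \<in> vector_fields \<A> \<Longrightarrow> D X Y \<in> aniso_fields \<A> A"
  using D unfolding aniso_connections_def by blast

lemma aniso_conn_tangent:
  "X \<in> vector_fields \<A> \<Longrightarrow> Y \<in> vector_fields \<A> \<Longrightarrow> v \<in> A \<Longrightarrow> D X Y v \<in> tangent_space \<A> (fst v)"
  using aniso_conn_field aniso_fields_iff by blast

lemma aniso_conn_add:
  assumes "X \<in> vector_fields \<A>" "Y \<in> vector_fields \<A>" "Z \<in> vector_fields \<A>"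
  shows "D (X + Y) Z = D X Z + D Y Z" "D X (Y + Z) = D X Y + D X Z"
  using D assms unfolding aniso_connections_def by blast+

lemma aniso_conn_Leibniz:
  assumes "X \<in> vector_fields \<A>" "Y \<in> vector_fields \<A>" "smooth_fun \<A> f" "v \<in> A"
  shows "D X (\<lambda>p. f p *\<^sub>R Y p) v =
    dir_deriv \<A> (fst v) (X (fst v)) f *\<^sub>R Y (fst v) + f (fst v) *\<^sub>R D X Y v"
  using D assms unfolding aniso_connections_def by blast

lemma aniso_conn_scale:
  assumes "X \<in> vector_fields \<A>" "Y \<in> vector_fields \<A>" "smooth_fun \<A> f" "v \<in> A"
  shows "D (\<lambda>p. f p *\<^sub>R X p) Y v = f (fst v) *\<^sub>R D X Y v"
proof -
  have "smooth_fun \<A> (\<lambda>p. 0)"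
    by (simp add: smooth_fun_iff msmooth_const)
  then have "D (\<lambda>p. f p *\<^sub>R X p + 0 *\<^sub>R X p) Y v = f (fst v) *\<^sub>R D X Y v + 0 *\<^sub>R D X Y v"
    using D assms unfolding aniso_connections_def by blast
  then show ?thesis
    by (simp only: scaleR_zero_left add_0_right)
qed

context
  fixes c v
  assumes c: "c \<in> \<A>" and v: "v \<in> A" "fst v \<in> fst c"
begin

lemma conn_diff_add:
  assumes "X \<in> vector_fields \<A>" "Y \<in> vector_fields \<A>" "Z \<in> vector_fields \<A>"
  shows "conn_diff D c v (X + Y) Z = conn_diff D c v X Z + conn_diff D c v Y Z"
    and "conn_diff D c v X (Y + Z) = conn_diff D c v X Y + conn_diff D c v X Z"
proof -
  note ms = vector_fields_msmooth[OF _ c v(2)]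
  show "conn_diff D c v (X + Y) Z = conn_diff D c v X Z + conn_diff D c v Y Z"
    using linear_add[OF linear_mderiv[OF c v(2) ms[OF assms(3)]]]
    by (simp only: conn_diff_def aniso_conn_add[OF assms] plus_fun_apply)
      (simp add: algebra_simps)
  show "conn_diff D c v X (Y + Z) = conn_diff D c v X Y + conn_diff D c v X Z"
    using mderiv_add[OF c v(2) ms[OF assms(2)] ms[OF assms(3)]]
    by (simp only: conn_diff_def aniso_conn_add[OF assms] plus_fun_apply)
      (simp add: algebra_simps)
qed

lemma conn_diff_scale:
  assumes "X \<in> vector_fields \<A>" "Y \<in> vector_fields \<A>" "smooth_fun \<A> f"
  shows "conn_diff D c v (\<lambda>q. f q *\<^sub>R X q) Y = f (fst v) *\<^sub>R conn_diff D c v X Y"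
    and "conn_diff D c v X (\<lambda>q. f q *\<^sub>R Y q) = f (fst v) *\<^sub>R conn_diff D c v X Y"
proof -
  note ms = vector_fields_msmooth[OF _ c v(2)]
  have f: "msmooth \<A> f (fst v)"
    using assms(3) A_points[OF v(1)] by (simp add: smooth_fun_iff)
  show "conn_diff D c v (\<lambda>q. f q *\<^sub>R X q) Y = f (fst v) *\<^sub>R conn_diff D c v X Y"
    using linear_scale[OF linear_mderiv[OF c v(2) ms[OF assms(2)]]]
    by (simp add: conn_diff_def aniso_conn_scale[OF assms v(1)] algebra_simps)
  show "conn_diff D c v X (\<lambda>q. f q *\<^sub>R Y q) = f (fst v) *\<^sub>R conn_diff D c v X Y"
    using mderiv_scaleR[OF c v(2) f ms[OF assms(2)]]
      dir_deriv_eq[OF c v(2) vector_fields_tangent[OF assms(1)] f]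
    by (simp add: conn_diff_def aniso_conn_Leibniz[OF assms v(1)] algebra_simps)
qed

lemma conn_diff_expansion:
  assumes "finite I" "\<And>i. i \<in> I \<Longrightarrow> E i \<in> vector_fields \<A>" "X \<in> vector_fields \<A>" "Y \<in> vector_fields \<A>"
  shows "X (fst v) c = (\<Sum>i\<in>I. k i *\<^sub>R E i (fst v) c) \<Longrightarrow>
      conn_diff D c v X Y = (\<Sum>i\<in>I. k i *\<^sub>R conn_diff D c v (E i) Y)"
    and "Y (fst v) c = (\<Sum>i\<in>I. k i *\<^sub>R E i (fst v) c) \<Longrightarrow>
      conn_diff D c v X Y = (\<Sum>i\<in>I. k i *\<^sub>R conn_diff D c v X (E i))"
  by (rule tensorial_expansion[where L = "\<lambda>X. conn_diff D c v X Y"];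
      simp only: assms conn_diff_add conn_diff_scale c v)
    (rule tensorial_expansion[where L = "\<lambda>Y. conn_diff D c v X Y"];
      simp only: assms conn_diff_add conn_diff_scale c v)

lemma conn_diff_cong:
  assumes "X \<in> vector_fields \<A>" "Y \<in> vector_fields \<A>" "X' \<in> vector_fields \<A>" "Y' \<in> vector_fields \<A>"
    "X (fst v) c = X' (fst v) c" "Y (fst v) c = Y' (fst v) c"
  shows "conn_diff D c v X Y = conn_diff D c v X' Y'"
  \<comment> \<open>An expansion with a single term and coefficient 1 is an equality of values at
    the base point.\<close>
  using conn_diff_expansion(1)[of "{0::nat}" "\<lambda>i. X'" X Y "\<lambda>i. 1"]
    conn_diff_expansion(2)[of "{0::nat}" "\<lambda>i. Y'" X' Y "\<lambda>i. 1"] assms by simp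

text \<open>Two admissible choices of fields have the same values and zero derivatives of components
  at the base point. Hence \<open>conn_diff_cong\<close> makes the covariant derivatives equal, and
  the description in \<open>christoffel\<close> has a unique solution.\<close>

lemma christoffel_eq:
  assumes X: "X \<in> vector_fields \<A>" "eventually (\<lambda>q. X q = coord_field \<A> c i q) (nhdsin mtop (fst v))"
    and Y: "Y \<in> vector_fields \<A>" "eventually (\<lambda>q. Y q = coord_field \<A> c j q) (nhdsin mtop (fst v))"
  shows "christoffel \<A> D c a i j v = D X Y v c $ a"
  unfolding christoffel_def coord_agree_near[OF c v(2)]
proof (rule the_equality)
  show "\<forall>X'\<in>vector_fields \<A>. \<forall>Y'\<in>vector_fields \<A>.
      eventually (\<lambda>q. X' q = coord_field \<A> c i q) (nhdsin mtop (fst v)) \<and>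
      eventually (\<lambda>q. Y' q = coord_field \<A> c j q) (nhdsin mtop (fst v)) \<longrightarrow>
      D X' Y' v c $ a = D X Y v c $ a"
  proof (intro ballI impI)
    fix X' Y' assume X': "X' \<in> vector_fields \<A>" and Y': "Y' \<in> vector_fields \<A>"
      and near: "eventually (\<lambda>q. X' q = coord_field \<A> c i q) (nhdsin mtop (fst v)) \<and>
      eventually (\<lambda>q. Y' q = coord_field \<A> c j q) (nhdsin mtop (fst v))"
    have "conn_diff D c v X' Y' = conn_diff D c v X Y"
      by (intro conn_diff_cong X Y X' Y')
        (simp_all only: coord_field_near(1)[OF c v(2) conjunct1[OF near]] coord_field_near(1)[OF c v(2) X(2)]
          coord_field_near(1)[OF c v(2) conjunct2[OF near]] coord_field_near(1)[OF c v(2) Y(2)])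
    then show "D X' Y' v c $ a = D X Y v c $ a"
      by (simp add: conn_diff_def coord_field_near(2)[OF c v(2) conjunct2[OF near]]
          coord_field_near(2)[OF c v(2) Y(2)])
  qed
qed (use X Y in blast)

text \<open>Tensoriality of \<open>conn_diff\<close> allows both arguments to be expanded in the
  coordinate frame. In particular a connection is determined by its Christoffel symbols.\<close>

lemma aniso_conn_formula:
  assumes "X \<in> vector_fields \<A>" "Y \<in> vector_fields \<A>"
  shows "D X Y v c = mderiv c (\<lambda>q. Y q c) (fst v) (X (fst v) c) +
    Gam \<A> D c v (X (fst v) c) (Y (fst v) c)"
proof -
  obtain E where E: "\<And>i. E i \<in> vector_fields \<A>"
    "\<And>i. eventually (\<lambda>q. E i q = coord_field \<A> c i q) (nhdsin mtop (fst v))"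
    using ex_coord_field[OF c v(2)] by blast
  have Ev: "E i (fst v) c = axis i 1" for i
    by (rule coord_field_near(1)[OF c v(2) E(2)])
  have EE: "conn_diff D c v (E i) (E j) = (\<chi> a. christoffel \<A> D c a i j v)" for i j
    using coord_field_near(2)[OF c v(2) E(2)]
    by (simp add: vec_eq_iff conn_diff_def christoffel_eq[OF E E])
  have "conn_diff D c v X Y = (\<Sum>i\<in>UNIV. X (fst v) c $ i *\<^sub>R conn_diff D c v (E i) Y)"
    by (rule conn_diff_expansion(1)) (simp_all only: E assms Ev finite flip: vec_expansion)
  also have "\<dots> = (\<Sum>i\<in>UNIV. X (fst v) c $ i *\<^sub>R (\<Sum>j\<in>UNIV. Y (fst v) c $ j *\<^sub>R conn_diff D c v (E i) (E j)))"
    by (intro sum.cong refl arg_cong[where f = "(*\<^sub>R) _"] conn_diff_expansion(2))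
      (simp_all only: E assms Ev finite flip: vec_expansion)
  also have "\<dots> = Gam \<A> D c v (X (fst v) c) (Y (fst v) c)"
    by (simp add: Gam_def EE scaleR_sum_right)
  finally show ?thesis
    by (simp add: conn_diff_def algebra_simps)
qed

end

lemma msmooth_christoffel:
  assumes c: "c \<in> \<A>" and v: "v \<in> A" "fst v \<in> fst c"
  shows "msmooth TA (\<lambda>v. christoffel \<A> D c a i j v) v"
proof -
  obtain E where E: "\<And>i. E i \<in> vector_fields \<A>"
    "\<And>i. eventually (\<lambda>q. E i q = coord_field \<A> c i q) (nhdsin mtop (fst v))"
    using ex_coord_field[OF c v(2)] by blast
  have "msmooth TA (\<lambda>v. D (E i) (E j) v c) v"
    using aniso_conn_field[OF E(1) E(1), of i j] v c by (simp add: aniso_fields_iff)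
  then have "msmooth TA (\<lambda>v. D (E i) (E j) v c $ a) v"
    by (rule TM.msmooth_linear[OF bounded_linear_vec_nth])
  moreover have "eventually (\<lambda>v. D (E i) (E j) v c $ a = christoffel \<A> D c a i j v) (nhdsin TM.mtop v)"
  proof -
    have "v \<in> TM"
      using A_TM v by blast
    \<comment> \<open>A field that agrees with a coordinate field near the base point does so near
      every neighbouring point, so the same global fields compute the Christoffel symbols at all
      nearby \<open>v\<close>.\<close>
    note ev = eventually_base[OF this eventually_eventually_nhdsin[OF E(2)]]
    show ?thesis
      using eventually_dom[OF c v] ev[of i] ev[of j]
      by eventually_elim (simp add: christoffel_eq[OF c _ _ E(1) _ E(1)])
  qed
  ultimately show ?thesis
    by (rule TM.msmooth_cong[rotated])
qed

text \<open>\<open>D X Y v\<close> is a tangent vector, hence its components in \<open>c\<close> and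
  \<open>d\<close> are related by the Jacobian. Inserting the coordinate formula on both sides, for
  fields with components \<open>u\<close> and \<open>w\<close> in \<open>c\<close>, the derivative
  terms cancel up to \<open>d2tr\<close>.\<close>

lemma aniso_data_Gam: "aniso_data (Gam \<A> D)"
  unfolding aniso_data_def
proof (intro ballI impI conjI allI)
  fix c v assume c: "c \<in> \<A>" and v: "v \<in> A" "fst v \<in> fst c"
  show "bilinear (Gam \<A> D c v)"
    by (rule bilinear_Gam)
  have TMv: "v \<in> points TA"
    using A_TM v by (auto simp: points_T_atlas)
  show "msmooth TA (\<lambda>v. Gam \<A> D c v u w) v" for u w
    unfolding Gam_def
    by (intro TM.msmooth_sum TM.msmooth_scaleR TM.msmooth_const TMv)
      (simp add: TM.msmooth_vec_iff msmooth_christoffel c v)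
  fix d u w assume d: "d \<in> \<A>" "fst v \<in> fst d"
  obtain X where X: "X \<in> vector_fields \<A>" "eventually (\<lambda>q. X q = tvec_of \<A> c q u) (nhdsin mtop (fst v))"
    using ex_field[OF c v(2)] by blast
  obtain Y where Y: "Y \<in> vector_fields \<A>" "eventually (\<lambda>q. Y q = tvec_of \<A> c q w) (nhdsin mtop (fst v))"
    using ex_field[OF c v(2)] by blast
  have Xv: "X (fst v) c = u" "X (fst v) d = dtr c d (fst v) u"
    using eventually_nhdsin_self[OF A_points[OF v(1)] X(2)] c d v by (simp_all add: tvec_of_apply)
  have Yv: "Y (fst v) c = w" "Y (fst v) d = dtr c d (fst v) w"
    using eventually_nhdsin_self[OF A_points[OF v(1)] Y(2)] c d v by (simp_all add: tvec_of_apply)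
  have "D X Y v d = dtr c d (fst v) (D X Y v c)"
    using tangent_coord[OF aniso_conn_tangent[OF X(1) Y(1) v(1)] c d(1) v(2) d(2)] .
  then show "Gam \<A> D d v (dtr c d (fst v) u) (dtr c d (fst v) w) + d2tr c d (fst v) u w =
      dtr c d (fst v) (Gam \<A> D c v u w)"
    unfolding aniso_conn_formula[OF c v X(1) Y(1)] aniso_conn_formula[OF d(1) v(1) d(2) X(1) Y(1)]
      Xv Yv linear_add[OF linear_dtr[OF c d(1) v(2) d(2)]] mderiv_field_change[OF c d(1) v(2) d(2) Y(1)]
    by (simp add: algebra_simps)
qed

end

text \<open>The uniqueness half of the definite descriptions of connections. On arguments that are
  not vector fields and at points outside of \<open>A\<close> the values are fixed by convention;
  elsewhere \<open>aniso_conn_formula\<close> determines them.\<close>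

lemma aniso_connections_eqI:
  assumes D: "D \<in> aniso_connections \<A> A" "D' \<in> aniso_connections \<A> A"
    and eq: "\<And>c v a i j. c \<in> \<A> \<Longrightarrow> v \<in> A \<Longrightarrow> fst v \<in> fst c \<Longrightarrow>
      christoffel \<A> D c a i j v = christoffel \<A> D' c a i j v"
  shows "D = D'"
proof (intro ext)
  fix X Y v c
  have "D \<in> vector_fields \<A> \<rightarrow>\<^sub>E vector_fields \<A> \<rightarrow>\<^sub>E aniso_fields \<A> A"
    if "D \<in> aniso_connections \<A> A" for D
    using that unfolding aniso_connections_def mem_Collect_eq by (rule conjunct1)
  note mem = this[OF D(1)] this[OF D(2)]
  consider "X \<notin> vector_fields \<A>" | "X \<in> vector_fields \<A>" "Y \<notin> vector_fields \<A>"
    | "X \<in> vector_fields \<A>" "Y \<in> vector_fields \<A>" by blast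
  then have "D X Y v = D' X Y v"
  proof cases
    case 1
    then show ?thesis
      using PiE_arb[OF mem(1) 1] PiE_arb[OF mem(2) 1] by simp
  next
    case 2
    show ?thesis
      using PiE_arb[OF PiE_mem[OF mem(1) 2(1)] 2(2)] PiE_arb[OF PiE_mem[OF mem(2) 2(1)] 2(2)] by simp
  next
    case 3
    show ?thesis
    proof (cases "v \<in> A")
      case True
      obtain c where c: "c \<in> \<A>" "fst v \<in> fst c"
        using True by (rule A_chartE)
      have "Gam \<A> D c v = Gam \<A> D' c v"
        using eq[OF c(1) True c(2)] by (simp add: Gam_def fun_eq_iff)
      then have "D X Y v c = D' X Y v c"
        using aniso_conn_formula[OF D(1) c(1) True c(2) 3] aniso_conn_formula[OF D(2) c(1) True c(2) 3]
        by simp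
      then show ?thesis
        using tangent_eqI[OF aniso_conn_tangent[OF D(1) 3 True] aniso_conn_tangent[OF D(2) 3 True] c] by blast
    next
      case False
      then show ?thesis
        using aniso_conn_field[OF D(1) 3] aniso_conn_field[OF D(2) 3] unfolding aniso_fields_iff by metis
    qed
  qed
  then show "D X Y v c = D' X Y v c"
    by simp
qed

text \<open>The chart is arbitrary and may vary from point to point in an uncontrolled way. The
  transformation law makes the result independent of it, see \<open>conn_of_data_formula\<close>,
  and only this yields smoothness.\<close>

definition conn_of_data :: "(('a, real^'n) chart \<Rightarrow> ('a, real^'n) tpoint \<Rightarrow> real^'n \<Rightarrow> real^'n \<Rightarrow> real^'n) \<Rightarrow>
    ('a, 'n) aniso_conn" where
  "conn_of_data G = (\<lambda>X\<in>vector_fields \<A>. \<lambda>Y\<in>vector_fields \<A>. \<lambda>v. if v \<in> A then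
     let p = fst v; c = some_chart \<A> p in
       tvec_of \<A> c p (mderiv c (\<lambda>q. Y q c) p (X p c) + G c v (X p c) (Y p c)) else 0)"

section \<open>The anisotropic connection with prescribed coordinate data\<close>

context
  fixes G assumes G: "aniso_data G"
begin

lemma conn_of_data_tangent:
  assumes "X \<in> vector_fields \<A>" "Y \<in> vector_fields \<A>" "v \<in> A"
  shows "conn_of_data G X Y v \<in> tangent_space \<A> (fst v)"
  using assms some_chart[OF A_points[OF assms(3)]] by (simp add: conn_of_data_def Let_def tvec_of_in)

text \<open>Under a change of chart the derivative of the components of \<open>Y\<close> gains a
  \<open>d2tr\<close> term and \<open>G\<close> loses the same one, so their sum transforms like a
  vector.\<close>

lemma conn_of_data_formula:
  assumes XY: "X \<in> vector_fields \<A>" "Y \<in> vector_fields \<A>" and v: "v \<in> A" and d: "d \<in> \<A>" "fst v \<in> fst d"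
  shows "conn_of_data G X Y v d =
    mderiv d (\<lambda>q. Y q d) (fst v) (X (fst v) d) + G d v (X (fst v) d) (Y (fst v) d)"
proof -
  define c where "c = some_chart \<A> (fst v)"
  have c: "c \<in> \<A>" "fst v \<in> fst c"
    using some_chart[OF A_points[OF v]] by (simp_all add: c_def)
  have X: "X (fst v) d = dtr c d (fst v) (X (fst v) c)" and Y: "Y (fst v) d = dtr c d (fst v) (Y (fst v) c)"
    using tangent_coord[OF vector_fields_tangent c(1) d(1) c(2) d(2)] XY by blast+
  have "conn_of_data G X Y v d = dtr c d (fst v)
      (mderiv c (\<lambda>q. Y q c) (fst v) (X (fst v) c) + G c v (X (fst v) c) (Y (fst v) c))"
    using XY v d by (simp add: conn_of_data_def Let_def tvec_of_apply flip: c_def)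
  then show ?thesis
    unfolding X Y linear_add[OF linear_dtr[OF c(1) d(1) c(2) d(2)]]
      mderiv_field_change[OF c(1) d(1) c(2) d(2) XY(2)] aniso_dataD(3)[OF G c(1) v c(2) d]
    by simp
qed

lemma conn_of_data_in: "conn_of_data G \<in> aniso_connections \<A> A"
proof -
  let ?D = "conn_of_data G"
  have eqI: "Z = Z'" if "v \<in> A" "Z \<in> tangent_space \<A> (fst v)" "Z' \<in> tangent_space \<A> (fst v)"
    "\<And>c. c \<in> \<A> \<Longrightarrow> fst v \<in> fst c \<Longrightarrow> Z c = Z' c" for v Z Z'
    using that A_chartE tangent_eqI by metis
  have out: "?D X Y v = 0" if "X \<in> vector_fields \<A>" "Y \<in> vector_fields \<A>" "v \<notin> A" for X Y v
    using that by (simp add: conn_of_data_def)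
  have sm: "msmooth TA (\<lambda>v. ?D X Y v c) v"
    if XY: "X \<in> vector_fields \<A>" "Y \<in> vector_fields \<A>" and c: "c \<in> \<A>" and v: "v \<in> A" "fst v \<in> fst c"
    for X Y c v
  proof (rule TM.msmooth_cong)
    have vT: "v \<in> TM" "v \<in> points TA"
      using A_TM v by (auto simp: points_T_atlas)
    \<comment> \<open>The coordinate formula with \<open>G\<close> expanded in the standard basis,
      since \<open>G\<close> is known to be smooth for constant arguments only.\<close>
    show "eventually (\<lambda>v. mderiv c (\<lambda>q. Y q c) (fst v) (X (fst v) c) +
        (\<Sum>i\<in>UNIV. \<Sum>j\<in>UNIV. (X (fst v) c $ i * Y (fst v) c $ j) *\<^sub>R G c v (axis i 1) (axis j 1)) =
        ?D X Y v c) (nhdsin TM.mtop v)"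
      using eventually_dom[OF c v]
    proof eventually_elim
      fix v assume v: "v \<in> A \<and> fst v \<in> fst c"
      then show "mderiv c (\<lambda>q. Y q c) (fst v) (X (fst v) c) +
        (\<Sum>i\<in>UNIV. \<Sum>j\<in>UNIV. (X (fst v) c $ i * Y (fst v) c $ j) *\<^sub>R G c v (axis i 1) (axis j 1)) =
        ?D X Y v c"
        using bilinear_expansion_axis[OF aniso_dataD(1)[OF G c], of v "X (fst v) c" "Y (fst v) c"]
          conn_of_data_formula[OF XY _ c, of v] by simp
    qed
    have XYs: "msmooth \<A> (\<lambda>q. X q c) (fst v)" "msmooth \<A> (\<lambda>q. Y q c) (fst v)"
      using XY c v(2) vector_fields_msmooth by blast+
    show "msmooth TA (\<lambda>v. mderiv c (\<lambda>q. Y q c) (fst v) (X (fst v) c) +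
        (\<Sum>i\<in>UNIV. \<Sum>j\<in>UNIV. (X (fst v) c $ i * Y (fst v) c $ j) *\<^sub>R G c v (axis i 1) (axis j 1))) v"
    proof (intro TM.msmooth_add TM.msmooth_sum vT TM.msmooth_scaleR TM.msmooth_mult
          TM.msmooth_linear[OF bounded_linear_vec_nth] aniso_dataD(2)[OF G c v])
      show "msmooth TA (\<lambda>v. mderiv c (\<lambda>q. Y q c) (fst v) (X (fst v) c)) v"
        by (rule msmooth_base[OF msmooth_mderiv[OF c v(2) XYs(2,1)] vT(1)])
    qed (rule msmooth_base[OF XYs(1) vT(1)], rule msmooth_base[OF XYs(2) vT(1)])
  qed
  have fields: "?D X Y \<in> aniso_fields \<A> A" if "X \<in> vector_fields \<A>" "Y \<in> vector_fields \<A>" for X Y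
    unfolding aniso_fields_iff using that sm out conn_of_data_tangent by blast
  have mem: "?D \<in> vector_fields \<A> \<rightarrow>\<^sub>E vector_fields \<A> \<rightarrow>\<^sub>E aniso_fields \<A> A"
    using fields by (auto simp: PiE_iff extensional_def conn_of_data_def)
  note lin = linear_mderiv[OF _ _ vector_fields_msmooth]
  have bil: "bilinear (G c v)" if "c \<in> \<A>" "v \<in> A" "fst v \<in> fst c" for c v
    using aniso_dataD(1)[OF G that] .
  show ?thesis
    unfolding aniso_connections_def
  proof (intro CollectI conjI ballI allI impI mem)
    fix X Y Z assume XYZ: "X \<in> vector_fields \<A>" "Y \<in> vector_fields \<A>" "Z \<in> vector_fields \<A>"
    show "?D (X + Y) Z = ?D X Z + ?D Y Z"
    proof
      fix v
      show "?D (X + Y) Z v = (?D X Z + ?D Y Z) v"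
      proof (cases "v \<in> A")
        case True
        have "?D (X + Y) Z v = ?D X Z v + ?D Y Z v"
        proof (rule eqI[OF True])
          fix c assume c: "c \<in> \<A>" "fst v \<in> fst c"
          show "?D (X + Y) Z v c = (?D X Z v + ?D Y Z v) c"
            unfolding plus_fun_apply conn_of_data_formula[OF vector_fields_add[OF XYZ(1,2)] XYZ(3) True c]
              conn_of_data_formula[OF XYZ(1,3) True c] conn_of_data_formula[OF XYZ(2,3) True c]
              linear_add[OF lin[OF c XYZ(3) c]] bilinear_ladd[OF bil[OF c(1) True c(2)]]
            by (simp add: algebra_simps)
        qed (intro tangent_add conn_of_data_tangent vector_fields_add XYZ True)+
        then show ?thesis
          by (simp only: plus_fun_apply)
      qed (simp only: plus_fun_apply out vector_fields_add XYZ add_0_right not_False_eq_True)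
    qed
    show "?D X (Y + Z) = ?D X Y + ?D X Z"
    proof
      fix v
      show "?D X (Y + Z) v = (?D X Y + ?D X Z) v"
      proof (cases "v \<in> A")
        case True
        have "?D X (Y + Z) v = ?D X Y v + ?D X Z v"
        proof (rule eqI[OF True])
          fix c assume c: "c \<in> \<A>" "fst v \<in> fst c"
          show "?D X (Y + Z) v c = (?D X Y v + ?D X Z v) c"
            unfolding plus_fun_apply conn_of_data_formula[OF XYZ(1) vector_fields_add[OF XYZ(2,3)] True c]
              conn_of_data_formula[OF XYZ(1,2) True c] conn_of_data_formula[OF XYZ(1,3) True c]
              mderiv_add[OF c vector_fields_msmooth[OF XYZ(2) c] vector_fields_msmooth[OF XYZ(3) c]]
              bilinear_radd[OF bil[OF c(1) True c(2)]]
            by (simp add: algebra_simps)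
        qed (intro tangent_add conn_of_data_tangent vector_fields_add XYZ True)+
        then show ?thesis
          by (simp only: plus_fun_apply)
      qed (simp only: plus_fun_apply out vector_fields_add XYZ add_0_right not_False_eq_True)
    qed
  next
    fix X Y f v assume XY: "X \<in> vector_fields \<A>" "Y \<in> vector_fields \<A>" and f: "smooth_fun \<A> f" and v: "v \<in> A"
    show "?D X (\<lambda>p. f p *\<^sub>R Y p) v =
        dir_deriv \<A> (fst v) (X (fst v)) f *\<^sub>R Y (fst v) + f (fst v) *\<^sub>R ?D X Y v"
    proof (rule eqI[OF v])
      fix c assume c: "c \<in> \<A>" "fst v \<in> fst c"
      have ms: "msmooth \<A> f (fst v)"
        using f A_points[OF v] by (simp add: smooth_fun_iff)
      show "?D X (\<lambda>p. f p *\<^sub>R Y p) v c =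
          (dir_deriv \<A> (fst v) (X (fst v)) f *\<^sub>R Y (fst v) + f (fst v) *\<^sub>R ?D X Y v) c"
        unfolding plus_fun_apply scaleR_fun_apply
          conn_of_data_formula[OF XY(1) vector_fields_scale[OF XY(2) f] v c]
          conn_of_data_formula[OF XY v c] dir_deriv_eq[OF c vector_fields_tangent[OF XY(1)] ms]
          mderiv_scaleR[OF c ms vector_fields_msmooth[OF XY(2) c]] bilinear_rmul[OF bil[OF c(1) v c(2)]]
        by (simp add: algebra_simps)
    qed (intro tangent_add tangent_scale conn_of_data_tangent vector_fields_scale vector_fields_tangent XY v f)+
  next
    fix X Y Z f h v
    assume XYZ: "X \<in> vector_fields \<A>" "Y \<in> vector_fields \<A>" "Z \<in> vector_fields \<A>"
      and fh: "smooth_fun \<A> f \<and> smooth_fun \<A> h" and v: "v \<in> A"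
    have W: "(\<lambda>p. f p *\<^sub>R X p + h p *\<^sub>R Y p) \<in> vector_fields \<A>"
      using vector_fields_add[OF vector_fields_scale vector_fields_scale, of X f Y h] XYZ fh
      by (simp add: plus_fun_def)
    show "?D (\<lambda>p. f p *\<^sub>R X p + h p *\<^sub>R Y p) Z v = f (fst v) *\<^sub>R ?D X Z v + h (fst v) *\<^sub>R ?D Y Z v"
    proof (rule eqI[OF v])
      fix c assume c: "c \<in> \<A>" "fst v \<in> fst c"
      show "?D (\<lambda>p. f p *\<^sub>R X p + h p *\<^sub>R Y p) Z v c =
          (f (fst v) *\<^sub>R ?D X Z v + h (fst v) *\<^sub>R ?D Y Z v) c"
        unfolding plus_fun_apply scaleR_fun_apply conn_of_data_formula[OF W XYZ(3) v c]
          conn_of_data_formula[OF XYZ(1,3) v c] conn_of_data_formula[OF XYZ(2,3) v c]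
          linear_add[OF lin[OF c XYZ(3) c]] linear_scale[OF lin[OF c XYZ(3) c]]
          bilinear_ladd[OF bil[OF c(1) v c(2)]] bilinear_lmul[OF bil[OF c(1) v c(2)]]
        by (simp add: algebra_simps)
    qed (intro tangent_add tangent_scale conn_of_data_tangent W XYZ v)+
  qed
qed

lemma christoffel_conn_of_data:
  assumes "c \<in> \<A>" "v \<in> A" "fst v \<in> fst c"
  shows "christoffel \<A> (conn_of_data G) c a i j v = G c v (axis i 1) (axis j 1) $ a"
proof -
  obtain E where E: "\<And>i. E i \<in> vector_fields \<A>"
    "\<And>i. eventually (\<lambda>q. E i q = coord_field \<A> c i q) (nhdsin mtop (fst v))"
    using ex_coord_field[OF assms(1,3)] by blast
  show ?thesis
    unfolding christoffel_eq[OF conn_of_data_in assms E E] conn_of_data_formula[OF E(1,1) assms(2,1,3)]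
      coord_field_near[OF assms(1,3) E(2)]
    by simp
qed

lemma Gam_conn_of_data:
  assumes "c \<in> \<A>" "v \<in> A" "fst v \<in> fst c"
  shows "Gam \<A> (conn_of_data G) c v = G c v"
proof (intro ext)
  fix u w
  have "(\<chi> a. G c v (axis i 1) (axis j 1) $ a) = G c v (axis i 1) (axis j 1)" for i j
    by (simp add: vec_eq_iff)
  then show "Gam \<A> (conn_of_data G) c v u w = G c v u w"
    using bilinear_expansion_axis[OF aniso_dataD(1)[OF G assms], of u w]
    by (simp add: Gam_def christoffel_conn_of_data[OF assms])
qed

end

end

section \<open>Nonlinear connections in coordinates\<close>

text \<open>A complement of the second factor is a graph: \<open>full\<close> gives a value over
  each \<open>x\<close>, and \<open>triv\<close> makes it unique, hence linear. The minus sign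
  follows the convention for the components of a nonlinear connection.\<close>

lemma graph_subspaceE:
  fixes L :: "('x::real_vector \<times> 'y::real_vector) set"
  assumes L: "subspace L" and triv: "\<And>y. (0, y) \<in> L \<Longrightarrow> y = 0" and full: "\<And>x. \<exists>y. (x, y) \<in> L"
  obtains n where "linear n" "L = range (\<lambda>x. (x, - n x))"
proof -
  define n where "n x = - (SOME y. (x, y) \<in> L)" for x
  have n: "(x, - n x) \<in> L" for x
    using someI_ex[OF full[of x]] by (simp add: n_def)
  have uniq: "y = - n x" if "(x, y) \<in> L" for x y
    using triv[of "y + n x"] subspace_diff[OF L that n[of x]] by (simp add: eq_neg_iff_add_eq_0)
  have "linear n"
  proof (rule linearI)
    fix x y
    have "- n x + - n y = - n (x + y)"
      using uniq[of "x + y" "- n x + - n y"] subspace_add[OF L n[of x] n[of y]] by simp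
    then have "- (n x + n y) = - n (x + y)"
      by simp
    then show "n (x + y) = n x + n y"
      by (simp only: neg_equal_iff_equal)
  next
    show "n (r *\<^sub>R x) = r *\<^sub>R n x" for r x
      using uniq[of "r *\<^sub>R x" "- (r *\<^sub>R n x)"] subspace_scale[OF L n[of x], of r] by simp
  qed
  moreover have "L = range (\<lambda>x. (x, - n x))"
    using n uniq by auto
  ultimately show thesis
    by (rule that)
qed

lemma span_graph:
  fixes n :: "real^'n \<Rightarrow> 'y::real_vector"
  assumes "linear n"
  shows "span (range (\<lambda>i. (axis i 1, - n (axis i 1)))) = range (\<lambda>u. (u, - n u))"
proof -
  have g: "linear (\<lambda>u. (u, - n u))"
    by (rule linearI) (simp_all add: linear_add[OF assms] linear_scale[OF assms])
  have "x \<in> span (range (\<lambda>i. axis i (1::real)))" for x :: "real^'n"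
    by (subst vec_expansion) (intro span_sum span_scale span_base rangeI)
  then have "span (range (\<lambda>i. axis i (1::real))) = (UNIV :: (real^'n) set)"
    by blast
  then show ?thesis
    using linear_span_image[OF g, of "range (\<lambda>i. axis i 1)"] by (simp add: image_image)
qed

lemma axis_diff_sum:
  "(axis i 1, 0) - (\<Sum>a\<in>UNIV. N a *\<^sub>R (0, axis a 1)) =
    (axis i (1::real) :: real^'n, - (\<chi> a. N a) :: real^'n)"
proof -
  have "(\<Sum>a\<in>UNIV. N a *\<^sub>R ((0::real^'n), axis a 1)) = (0, (\<chi> a. N a) :: real^'n)"
    using vec_expansion[of "(\<chi> a. N a) :: real^'n"] by (simp add: prod_eq_iff fst_sum snd_sum)
  then show ?thesis
    unfolding \<open>_ = (0, _)\<close> by simp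
qed

definition Nl :: "('a, real^'n) chart set \<Rightarrow> ('a, 'n::finite) distr \<Rightarrow> ('a, real^'n) chart \<Rightarrow>
    ('a, real^'n) tpoint \<Rightarrow> real^'n \<Rightarrow> real^'n"
  where "Nl \<A> H c v u = (\<Sum>i\<in>UNIV. u $ i *\<^sub>R (\<chi> a. nl_comp \<A> H c i a v))"

lemma linear_Nl: "linear (Nl \<A> H c v)"
  unfolding Nl_def by (rule linearI) (simp_all add: algebra_simps sum.distrib scaleR_sum_right)

lemma Nl_axis: "Nl \<A> H c v (axis i 1) $ a = nl_comp \<A> H c i a v"
  by (simp add: Nl_def sum_axis_scaleR)

text \<open>Shows that the description in \<open>nl_comp\<close> has a unique solution: a graph is
  spanned by its vectors over the standard basis, and it contains only one vector over each of
  them.\<close>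

lemma nl_comp_graph:
  fixes n :: "real^'n \<Rightarrow> real^'n"
  assumes n: "linear n" and L: "(\<lambda>w. w (T_chart \<A> c)) ` (H `` {v}) = range (\<lambda>u. (u, - n u))"
  shows "nl_comp \<A> H c i a v = n (axis i 1) $ a" and "Nl \<A> H c v = n"
proof -
  have *: "nl_comp \<A> H c i a v = n (axis i 1) $ a" for i a
    unfolding nl_comp_def L axis_diff_sum
  proof (subst the_equality[where a = "\<lambda>i a. n (axis i 1) $ a"])
    have "(\<chi> a. n (axis i 1) $ a) = n (axis i 1)" for i
      by (simp add: vec_eq_iff)
    then show "range (\<lambda>u. (u, - n u)) = span (range (\<lambda>i. (axis i 1, - (\<chi> a. n (axis i 1) $ a))))"
      by (simp add: span_graph[OF n])
  next
    fix N :: "'n \<Rightarrow> 'n \<Rightarrow> real"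
    assume N: "range (\<lambda>u. (u, - n u)) = span (range (\<lambda>i. (axis i 1, - (\<chi> a. N i a))))"
    have "N i a = n (axis i 1) $ a" for i a
    proof -
      have "(axis i 1, - (\<chi> a. N i a)) \<in> range (\<lambda>u. (u, - n u))"
        unfolding N by (intro span_base rangeI)
      then have "(\<chi> a. N i a) = n (axis i 1)"
        by auto
      then show ?thesis
        by (metis vec_lambda_beta)
    qed
    then show "N = (\<lambda>i a. n (axis i 1) $ a)"
      by blast
  qed (rule refl)
  show "nl_comp \<A> H c i a v = n (axis i 1) $ a"
    by (rule *)
  have "(\<chi> a. n (axis i 1) $ a) = n (axis i 1)" for i
    by (simp add: vec_eq_iff)
  then have "Nl \<A> H c v u = n u" for u
    unfolding Nl_def * using linear_expansion_axis[OF n, of u] by simp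
  then show "Nl \<A> H c v = n"
    by blast
qed

context conic_domain
begin

lemma T_tangent_change:
  assumes "w \<in> tangent_space TA v" "c \<in> \<A>" "d \<in> \<A>" "v \<in> A" "fst v \<in> fst c" "fst v \<in> fst d"
  shows "fst (w (T d)) = dtr c d (fst v) (fst (w (T c)))"
    and "snd (w (T d)) = d2tr c d (fst v) (fst (w (T c))) (snd v c) + dtr c d (fst v) (snd (w (T c)))"
proof -
  have "w (T d) = dtr (T c) (T d) v (w (T c))"
    using assms A_in_T by (intro TM.tangent_coord[of w v]) simp_all
  also have "\<dots> = (dtr c d (fst v) (fst (w (T c))),
      d2tr c d (fst v) (fst (w (T c))) (snd v c) + dtr c d (fst v) (snd (w (T c))))"
    using dtr_T_chart[of c d v "fst (w (T c))" "snd (w (T c))"] assms A_TM by auto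
  finally show "fst (w (T d)) = dtr c d (fst v) (fst (w (T c)))"
    "snd (w (T d)) = d2tr c d (fst v) (fst (w (T c))) (snd v c) + dtr c d (fst v) (snd (w (T c)))"
    by simp_all
qed

lemma some_T_chartE:
  assumes "v \<in> A"
  obtains e where "e \<in> \<A>" "fst v \<in> fst e" "some_chart TA v = T e"
proof -
  have "some_chart TA v \<in> TA" "v \<in> fst (some_chart TA v)"
    using TM.some_chart[of v] assms A_TM by (auto simp: points_T_atlas)
  then show thesis
    using that by (auto elim!: T_inE)
qed

lemma tangent_map_fst:
  assumes w: "w \<in> tangent_space TA v" and v: "v \<in> A"
  shows "tangent_map TA \<A> fst v w d = (if d \<in> \<A> \<and> fst v \<in> fst d then fst (w (T d)) else 0)"
proof (cases "d \<in> \<A> \<and> fst v \<in> fst d")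
  case True
  obtain e where e: "e \<in> \<A>" "fst v \<in> fst e" "some_chart TA v = T e"
    using some_T_chartE[OF v] .
  have "tangent_map TA \<A> fst v w d = mderiv (T e) (\<lambda>v. snd d (fst v)) v (w (T e))"
    using True by (simp add: tangent_map_def e(3) mderiv_def comp_def Let_def)
  also have "\<dots> = dtr e d (fst v) (fst (w (T e)))"
    unfolding dtr_def using True e v A_TM by (intro mderiv_base msmooth_chart) auto
  also have "\<dots> = fst (w (T d))"
    using T_tangent_change(1)[OF w e(1) _ v e(2), of d] True by simp
  finally show ?thesis
    using True by simp
next
  case False
  show ?thesis
    by (simp only: tangent_map_def if_not_P[OF False] if_False)
qed

text \<open>In induced coordinates the projection is \<open>fst\<close>, so its differential keeps
  the first component. One chart suffices because the first components transform linearly among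
  themselves.\<close>

lemma vertical_space_iff:
  assumes "v \<in> A" "c \<in> \<A>" "fst v \<in> fst c"
  shows "w \<in> vertical_space \<A> v \<longleftrightarrow> w \<in> tangent_space TA v \<and> fst (w (T c)) = 0"
proof -
  have "tangent_map TA \<A> fst v w = 0 \<longleftrightarrow> fst (w (T c)) = 0" if w: "w \<in> tangent_space TA v"
  proof
    assume "tangent_map TA \<A> fst v w = 0"
    then have "tangent_map TA \<A> fst v w c = 0"
      by simp
    then show "fst (w (T c)) = 0"
      using tangent_map_fst[OF w assms(1), of c] assms by simp
  next
    assume 0: "fst (w (T c)) = 0"
    have "tangent_map TA \<A> fst v w d = 0" for d
    proof (cases "d \<in> \<A> \<and> fst v \<in> fst d")
      case True
      then show ?thesis
        using tangent_map_fst[OF w assms(1), of d] T_tangent_change(1)[OF w assms(2) _ assms(1,3), of d] 0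
          linear_0[OF linear_dtr[of c d "fst v"]] assms by simp
    next
      case False
      then show ?thesis
        using tangent_map_fst[OF w assms(1), of d] by (simp only: if_not_P[OF False] if_False)
    qed
    then show "tangent_map TA \<A> fst v w = 0"
      by (simp add: fun_eq_iff)
  qed
  then show ?thesis
    unfolding vertical_space_def by blast
qed

text \<open>The counterpart of \<open>aniso_data\<close> for components of nonlinear connections.
  The second argument of the second derivative is now the fibre coordinate of \<open>v\<close>
  itself.\<close>

definition nl_data :: "(('a, real^'n) chart \<Rightarrow> ('a, real^'n) tpoint \<Rightarrow> real^'n \<Rightarrow> real^'n) \<Rightarrow> bool"
  where "nl_data N \<longleftrightarrow> (\<forall>c\<in>\<A>. \<forall>v\<in>A. fst v \<in> fst c \<longrightarrow> linear (N c v) \<and>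
    (\<forall>u. msmooth TA (\<lambda>v. N c v u) v) \<and>
    (\<forall>d\<in>\<A>. fst v \<in> fst d \<longrightarrow> (\<forall>u. N d v (dtr c d (fst v) u) + d2tr c d (fst v) u (snd v c) =
      dtr c d (fst v) (N c v u))))"

lemma nl_dataD:
  assumes "nl_data N" "c \<in> \<A>" "v \<in> A" "fst v \<in> fst c"
  shows "linear (N c v)" and "msmooth TA (\<lambda>v. N c v u) v"
    and "d \<in> \<A> \<Longrightarrow> fst v \<in> fst d \<Longrightarrow>
      N d v (dtr c d (fst v) u) = dtr c d (fst v) (N c v u) - d2tr c d (fst v) u (snd v c)"
  using assms unfolding nl_data_def eq_diff_eq by blast+

lemma T_eval_linear: "linear (\<lambda>w :: (('a, real^'n) tpoint, (real^'n) \<times> (real^'n)) tvec. w C)"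
  by (rule linearI) simp_all

lemma T_tangent_eqI:
  assumes "w \<in> tangent_space TA v" "w' \<in> tangent_space TA v" "c \<in> \<A>" "v \<in> A" "fst v \<in> fst c"
    "w (T c) = w' (T c)"
  shows "w = w'"
  using TM.tangent_eqI[OF assms(1,2) T_in[OF assms(3)] A_in_T[OF assms(4,5)] assms(6)] .

lemma T_tvec_of:
  assumes "c \<in> \<A>" "v \<in> A" "fst v \<in> fst c"
  shows "tvec_of TA (T c) v z \<in> tangent_space TA v" and "tvec_of TA (T c) v z (T c) = z"
  using TM.tvec_of_in[OF T_in[OF assms(1)] A_in_T[OF assms(2,3)]]
    TM.tvec_of_self[OF T_in[OF assms(1)] A_in_T[OF assms(2,3)]] by blast+

section \<open>Components of a given nonlinear connection\<close>

context
  fixes H assumes H: "H \<in> nonlinear_connections \<A> A"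
begin

lemma nl_distribution: "smooth_distribution_on TA A H"
  using H unfolding nonlinear_connections_def by blast

lemma nl_sub: "H \<subseteq> Sigma A (tangent_space TA)"
  using nl_distribution unfolding smooth_distribution_on_def by blast

lemma nl_subspace:
  assumes "v \<in> A"
  shows "subspace (H `` {v})"
proof -
  obtain S where "H `` {v} = span S"
    using nl_distribution assms unfolding smooth_distribution_on_def by blast
  then show ?thesis
    by (simp add: subspace_span)
qed

text \<open>The two halves of the splitting into horizontal and vertical vectors are the two
  hypotheses of \<open>graph_subspaceE\<close>: trivial intersection gives uniqueness of the second
  component and the sum condition gives its existence.\<close>

lemma nl_graph:
  assumes c: "c \<in> \<A>" and v: "v \<in> A" "fst v \<in> fst c"
  shows "(\<lambda>w. w (T c)) ` (H `` {v}) = range (\<lambda>u. (u, - Nl \<A> H c v u))"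
proof -
  let ?L = "(\<lambda>w. w (T c)) ` (H `` {v})"
  have "\<forall>v\<in>A. H `` {v} \<inter> vertical_space \<A> v = {0} \<and>
    {h + u |h u. h \<in> H `` {v} \<and> u \<in> vertical_space \<A> v} = tangent_space TA v"
    using H unfolding nonlinear_connections_def mem_Collect_eq by (rule conjunct2)
  note V = bspec[OF this v(1)]
  note V = conjunct1[OF V] conjunct2[OF V]
  have sub: "w \<in> tangent_space TA v" if "w \<in> H `` {v}" for w
    using nl_sub that by blast
  have "subspace ?L"
    by (rule linear_subspace_image[OF T_eval_linear nl_subspace[OF v(1)]])
  moreover have "y = 0" if "(0, y) \<in> ?L" for y
  proof -
    from that obtain w where w: "(0, y) = w (T c)" "w \<in> H `` {v}"
      by (rule imageE)
    have "fst (w (T c)) = 0"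
      unfolding w(1)[symmetric] by simp
    then have "w \<in> H `` {v} \<inter> vertical_space \<A> v"
      using vertical_space_iff[OF v(1) c v(2), of w] sub[OF w(2)] w(2) by blast
    then have "w = 0"
      using V(1) by blast
    then show ?thesis
      using w(1) by (simp add: zero_prod_def)
  qed
  moreover have "\<exists>y. (x, y) \<in> ?L" for x
  proof -
    \<comment> \<open>Any vector over \<open>x\<close> would do here; its horizontal part still has
      first component \<open>x\<close>.\<close>
    have "tvec_of TA (T c) v (x, 0) \<in> {h + u |h u. h \<in> H `` {v} \<and> u \<in> vertical_space \<A> v}"
      unfolding V(2) by (rule T_tvec_of[OF c v])
    then obtain h u where hu: "tvec_of TA (T c) v (x, 0) = h + u" "h \<in> H `` {v}" "u \<in> vertical_space \<A> v"
      by blast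
    have "(x, 0) = h (T c) + u (T c)"
      using T_tvec_of(2)[OF c v, of "(x, 0)"] unfolding hu(1) plus_fun_apply by simp
    moreover have "fst (u (T c)) = 0"
      using hu(3) vertical_space_iff[OF v(1) c v(2)] by blast
    ultimately have "h (T c) = (x, snd (h (T c)))"
      by (simp add: prod_eq_iff)
    then have "(x, snd (h (T c))) \<in> ?L"
      using hu(2) by (intro image_eqI[of _ _ h]) simp_all
    then show ?thesis ..
  qed
  ultimately obtain n where n: "linear n" "?L = range (\<lambda>x. (x, - n x))"
    using graph_subspaceE[of ?L] by blast
  then show ?thesis
    using nl_comp_graph(2)[OF n] by simp
qed

lemma nl_fibre:
  assumes c: "c \<in> \<A>" and v: "v \<in> A" "fst v \<in> fst c"
  shows "(v, w) \<in> H \<longleftrightarrow> w \<in> tangent_space TA v \<and> snd (w (T c)) = - Nl \<A> H c v (fst (w (T c)))"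
proof
  assume w: "(v, w) \<in> H"
  then have "w (T c) \<in> range (\<lambda>u. (u, - Nl \<A> H c v u))"
    unfolding nl_graph[OF assms, symmetric] by blast
  then show "w \<in> tangent_space TA v \<and> snd (w (T c)) = - Nl \<A> H c v (fst (w (T c)))"
    using nl_sub w by auto
next
  assume w: "w \<in> tangent_space TA v \<and> snd (w (T c)) = - Nl \<A> H c v (fst (w (T c)))"
  then have "w (T c) \<in> (\<lambda>w. w (T c)) ` (H `` {v})"
    unfolding nl_graph[OF assms] by (intro range_eqI[of _ _ "fst (w (T c))"]) (simp add: prod_eq_iff)
  then obtain w' where w': "(v, w') \<in> H" "w (T c) = w' (T c)"
    by blast
  then have "w = w'"
    using T_tangent_eqI[OF _ _ c v] w nl_sub by blast
  then show "(v, w) \<in> H"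
    using w' by simp
qed

text \<open>A local frame of the distribution is unrelated to the coordinates, and its length
  \<open>k\<close> is not compared with the dimension. Instead, combinations with constant
  coefficients are formed that are the horizontal lifts of the standard basis at \<open>v\<close>.
  Their base parts stay linearly independent near \<open>v\<close>, so a fixed vector
  \<open>e\<close> can be expressed by them with smooth coefficients.\<close>

lemma msmooth_Nl:
  assumes c: "c \<in> \<A>" and v: "v \<in> A" "fst v \<in> fst c"
  shows "msmooth TA (\<lambda>v. Nl \<A> H c v e) v"
proof -
  have vT: "v \<in> points TA"
    using A_TM v by (auto simp: points_T_atlas)
  obtain k :: nat and W E where W: "openin TM.mtop W" "v \<in> W" "W \<subseteq> A"
    and E: "\<And>i. i < k \<Longrightarrow> smooth_field_on TA W (E i)"
    and inj: "inj_on (\<lambda>i. E i v) {..<k}"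
    and span: "\<And>q. q \<in> W \<Longrightarrow> H `` {q} = span ((\<lambda>i. E i q) ` {..<k})"
    using nl_distribution v(1) unfolding smooth_distribution_on_def by metis
  \<comment> \<open>The horizontal lift of each standard basis vector at \<open>v\<close> is a
    combination of the frame; the coefficients found at \<open>v\<close> are kept fixed
    nearby.\<close>
  have "\<forall>j. \<exists>m. (\<Sum>i<k. m i *\<^sub>R E i v (T c)) = (axis j 1, - Nl \<A> H c v (axis j 1))"
  proof
    fix j
    have "tvec_of TA (T c) v (axis j 1, - Nl \<A> H c v (axis j 1)) \<in> span ((\<lambda>i. E i v) ` {..<k})"
      unfolding span[OF W(2), symmetric] Image_singleton_iff nl_fibre[OF c v]
      by (simp add: T_tvec_of[OF c v])
    then obtain m where m: "tvec_of TA (T c) v (axis j 1, - Nl \<A> H c v (axis j 1)) =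
        (\<Sum>w\<in>(\<lambda>i. E i v) ` {..<k}. m w *\<^sub>R w)"
      by (auto simp: span_finite)
    also have "\<dots> = (\<Sum>i<k. m (E i v) *\<^sub>R E i v)"
      using inj by (simp add: sum.reindex)
    finally have "tvec_of TA (T c) v (axis j 1, - Nl \<A> H c v (axis j 1)) (T c) =
        (\<Sum>i<k. m (E i v) *\<^sub>R E i v) (T c)"
      by simp
    then show "\<exists>m. (\<Sum>i<k. m i *\<^sub>R E i v (T c)) = (axis j 1, - Nl \<A> H c v (axis j 1))"
      unfolding T_tvec_of(2)[OF c v] by (intro exI[of _ "\<lambda>i. m (E i v)"]) (simp add: sum_fun_eq)
  qed
  from choice[OF this] obtain m
    where m: "\<forall>j. (\<Sum>i<k. m j i *\<^sub>R E i v (T c)) = (axis j 1, - Nl \<A> H c v (axis j 1))" ..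
  define F where "F j q = (\<Sum>i<k. m j i *\<^sub>R E i q (T c))" for j q
  have sF: "msmooth TA (F j) v" for j
    unfolding F_def
  proof (intro TM.msmooth_sum vT TM.msmooth_scaleR TM.msmooth_const)
    fix i assume "i \<in> {..<k}"
    then show "msmooth TA (\<lambda>q. E i q (T c)) v"
      using E[of i] W(2) A_in_T[OF v] T_in[OF c] unfolding TM.smooth_field_on_iff[OF W(1)] by blast
  qed
  have F: "snd (F j q) = - Nl \<A> H c q (fst (F j q))" if q: "q \<in> W" "fst q \<in> fst c" for j q
  proof -
    have "(\<Sum>i<k. m j i *\<^sub>R E i q) \<in> H `` {q}"
      unfolding span[OF q(1)] by (intro span_sum span_scale span_base) auto
    then show ?thesis
      using nl_fibre[OF c _ q(2), of "\<Sum>i<k. m j i *\<^sub>R E i q"] q W(3) by (auto simp: F_def sum_fun_eq)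
  qed
  \<comment> \<open>Its columns are the base parts of the fields \<open>F j\<close>, so it is the
    identity matrix at \<open>v\<close> and invertible near \<open>v\<close>.\<close>
  define M :: "('a, real^'n) tpoint \<Rightarrow> real^'n^'n" where "M q = (\<chi> i j. fst (F j q) $ i)" for q
  have sM: "msmooth TA (\<lambda>q. M q $ i $ j) v" for i j
    unfolding M_def vec_lambda_beta
    by (intro TM.msmooth_linear[OF bounded_linear_vec_nth] TM.msmooth_linear[OF bounded_linear_fst] sF)
  have dM: "msmooth TA (\<lambda>q. det (M q)) v"
    by (rule TM.msmooth_det[OF vT sM])
  have "M v = mat 1"
    using m by (auto simp: M_def F_def mat_def vec_eq_iff axis_def)
  then have d1: "det (M v) \<noteq> 0"
    by simp
  \<comment> \<open>The solution of the system with matrix \<open>M q\<close> and right-hand side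
    \<open>e\<close> by Cramer's rule: a quotient of smooth determinants.\<close>
  define t where "t q k = det (\<chi> i j. if j = k then e $ i else M q $ i $ j) / det (M q)" for q k
  have st: "msmooth TA (\<lambda>q. t q k) v" for k
    unfolding t_def
  proof (intro TM.msmooth_divide dM d1 TM.msmooth_det vT)
    show "msmooth TA (\<lambda>q. (\<chi> i j. if j = k then e $ i else M q $ i $ j) $ i $ j) v" for i j
      using sM by (cases "j = k") (simp_all add: TM.msmooth_const[OF vT])
  qed
  have "eventually (\<lambda>q. - (\<Sum>j\<in>UNIV. t q j *\<^sub>R snd (F j q)) = Nl \<A> H c q e) (nhdsin TM.mtop v)"
    using TM.eventually_msmooth_nonzero[OF dM d1] TM.eventually_nhdsin_openin[OF W(1,2)]
      eventually_dom[OF c v]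
  proof eventually_elim
    fix q assume q: "det (M q) \<noteq> 0" "q \<in> W" "q \<in> A \<and> fst q \<in> fst c"
    have "M q *v (\<chi> k. t q k) = e"
      unfolding cramer[OF q(1)] t_def by simp
    then have e: "e = (\<Sum>j\<in>UNIV. t q j *\<^sub>R fst (F j q))"
      by (simp add: matrix_vector_mult_def M_def vec_eq_iff mult.commute)
    have "Nl \<A> H c q e = (\<Sum>j\<in>UNIV. t q j *\<^sub>R Nl \<A> H c q (fst (F j q)))"
      unfolding e by (simp add: linear_sum[OF linear_Nl] linear_scale[OF linear_Nl])
    then show "- (\<Sum>j\<in>UNIV. t q j *\<^sub>R snd (F j q)) = Nl \<A> H c q e"
      using F q by (simp add: sum_negf)
  qed
  moreover have "msmooth TA (\<lambda>q. - (\<Sum>j\<in>UNIV. t q j *\<^sub>R snd (F j q))) v"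
    by (intro TM.msmooth_minus TM.msmooth_sum vT TM.msmooth_scaleR st
        TM.msmooth_linear[OF bounded_linear_snd] sF)
  ultimately show ?thesis
    by (rule TM.msmooth_cong)
qed

lemma nl_data_Nl: "nl_data (Nl \<A> H)"
  unfolding nl_data_def
proof (intro ballI impI conjI allI linear_Nl msmooth_Nl)
  fix c d v u assume c: "c \<in> \<A>" and v: "v \<in> A" "fst v \<in> fst c" and d: "d \<in> \<A>" "fst v \<in> fst d"
  \<comment> \<open>The horizontal lift of \<open>u\<close>. Being horizontal can be tested in
    \<open>c\<close> and in \<open>d\<close>, and the comparison of the two tests is the
    transformation law.\<close>
  define w where "w = tvec_of TA (T c) v (u, - Nl \<A> H c v u)"
  have w: "w \<in> tangent_space TA v" "w (T c) = (u, - Nl \<A> H c v u)"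
    unfolding w_def by (rule T_tvec_of[OF c v])+
  then have "(v, w) \<in> H"
    by (simp add: nl_fibre[OF c v])
  then have "snd (w (T d)) = - Nl \<A> H d v (fst (w (T d)))"
    using nl_fibre[OF d(1) v(1) d(2)] by blast
  then have "d2tr c d (fst v) u (snd v c) + dtr c d (fst v) (- Nl \<A> H c v u) =
      - Nl \<A> H d v (dtr c d (fst v) u)"
    using T_tangent_change[OF w(1) c d(1) v d(2)] by (simp add: w(2))
  then show "Nl \<A> H d v (dtr c d (fst v) u) + d2tr c d (fst v) u (snd v c) =
      dtr c d (fst v) (Nl \<A> H c v u)"
    using linear_neg[OF linear_dtr[OF c d(1) v(2) d(2)]] by (simp add: algebra_simps)
qed

end

lemma nonlinear_connections_eqI:
  assumes H: "H \<in> nonlinear_connections \<A> A" "H' \<in> nonlinear_connections \<A> A"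
    and eq: "\<And>c v i a. c \<in> \<A> \<Longrightarrow> v \<in> A \<Longrightarrow> fst v \<in> fst c \<Longrightarrow> nl_comp \<A> H c i a v = nl_comp \<A> H' c i a v"
  shows "H = H'"
proof -
  have "(v, w) \<in> H \<longleftrightarrow> (v, w) \<in> H'" for v w
  proof (cases "v \<in> A")
    case True
    obtain c where c: "c \<in> \<A>" "fst v \<in> fst c"
      using True by (rule A_chartE)
    have "Nl \<A> H c v = Nl \<A> H' c v"
      using eq[OF c(1) True c(2)] by (simp add: Nl_def fun_eq_iff)
    then show ?thesis
      using nl_fibre[OF H(1) c(1) True c(2)] nl_fibre[OF H(2) c(1) True c(2)] by simp
  next
    case False
    then show ?thesis
      using nl_sub[OF H(1)] nl_sub[OF H(2)] by blast
  qed
  then show ?thesis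
    by auto
qed

definition distr_of_data :: "(('a, real^'n) chart \<Rightarrow> ('a, real^'n) tpoint \<Rightarrow> real^'n \<Rightarrow> real^'n) \<Rightarrow> ('a, 'n) distr"
  where "distr_of_data N = {(v, w). v \<in> A \<and> w \<in> tangent_space TA v \<and>
    (\<forall>c\<in>\<A>. fst v \<in> fst c \<longrightarrow> snd (w (T c)) = - N c v (fst (w (T c))))}"

section \<open>The nonlinear connection with prescribed components\<close>

context
  fixes N assumes N: "nl_data N"
begin

text \<open>The condition in one chart implies that in all others, since the \<open>d2tr\<close>
  term in the change of the second component of \<open>w\<close> cancels against that in the law of
  \<open>N\<close>.\<close>

lemma distr_of_data_iff:
  assumes c: "c \<in> \<A>" and v: "v \<in> A" "fst v \<in> fst c"
  shows "(v, w) \<in> distr_of_data N \<longleftrightarrow> w \<in> tangent_space TA v \<and> snd (w (T c)) = - N c v (fst (w (T c)))"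
proof -
  have "snd (w (T d)) = - N d v (fst (w (T d)))"
    if w: "w \<in> tangent_space TA v" "snd (w (T c)) = - N c v (fst (w (T c)))" and d: "d \<in> \<A>" "fst v \<in> fst d"
    for d
    unfolding T_tangent_change[OF w(1) c d(1) v d(2)] w(2) nl_dataD(3)[OF N c v d]
      linear_neg[OF linear_dtr[OF c d(1) v(2) d(2)]]
    by simp
  then show ?thesis
    unfolding distr_of_data_def using c v by blast
qed

lemma distr_of_data_graph:
  assumes c: "c \<in> \<A>" and v: "v \<in> A" "fst v \<in> fst c"
  shows "(\<lambda>w. w (T c)) ` (distr_of_data N `` {v}) = range (\<lambda>u. (u, - N c v u))"
proof (intro equalityI subsetI)
  fix z assume "z \<in> (\<lambda>w. w (T c)) ` (distr_of_data N `` {v})"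
  then obtain w where "(v, w) \<in> distr_of_data N" "z = w (T c)"
    by blast
  then show "z \<in> range (\<lambda>u. (u, - N c v u))"
    using distr_of_data_iff[OF assms, of w] by (intro range_eqI[of _ _ "fst (w (T c))"]) (simp add: prod_eq_iff)
next
  fix z assume "z \<in> range (\<lambda>u. (u, - N c v u))"
  then obtain u where u: "z = (u, - N c v u)"
    by blast
  have "(v, tvec_of TA (T c) v z) \<in> distr_of_data N"
    using T_tvec_of[OF c v, of z] by (simp add: distr_of_data_iff[OF assms] u)
  moreover have "z = tvec_of TA (T c) v z (T c)"
    by (rule T_tvec_of(2)[OF c v, symmetric])
  ultimately show "z \<in> (\<lambda>w. w (T c)) ` (distr_of_data N `` {v})"
    by blast
qed

lemma distr_of_data_subspace:
  assumes c: "c \<in> \<A>" and v: "v \<in> A" "fst v \<in> fst c"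
  shows "subspace (distr_of_data N `` {v})"
proof (rule subspaceI)
  note l = nl_dataD(1)[OF N assms]
  show "0 \<in> distr_of_data N `` {v}"
    unfolding Image_singleton_iff distr_of_data_iff[OF assms]
    using TM.tangent_0[of v] linear_0[OF l] by simp
  show "x + y \<in> distr_of_data N `` {v}"
    if "x \<in> distr_of_data N `` {v}" "y \<in> distr_of_data N `` {v}" for x y
    using that unfolding Image_singleton_iff distr_of_data_iff[OF assms]
    using TM.tangent_add[of x v y] linear_add[OF l] by simp
  show "r *\<^sub>R x \<in> distr_of_data N `` {v}" if "x \<in> distr_of_data N `` {v}" for r x
    using that unfolding Image_singleton_iff distr_of_data_iff[OF assms]
    using TM.tangent_scale[of x v r] linear_scale[OF l] by simp
qed

text \<open>Over a whole chart domain the horizontal lifts of the coordinate vectors form a smooth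
  frame. Independence and spanning both follow from one formula for its linear combinations.\<close>

lemma distr_of_data_distribution: "smooth_distribution_on TA A (distr_of_data N)"
  unfolding smooth_distribution_on_def
proof (intro conjI exI[of _ "CARD('n)"] ballI)
  show "distr_of_data N \<subseteq> Sigma A (tangent_space TA)"
    by (auto simp: distr_of_data_def)
  \<comment> \<open>Frames are indexed by natural numbers, coordinates by the type
    \<open>'n\<close>; this bijection translates between them.\<close>
  obtain \<sigma> where "bij_betw \<sigma> {0..<CARD('n)} (UNIV :: 'n set)"
    using ex_bij_betw_nat_finite[of "UNIV :: 'n set"] by auto
  then have \<sigma>: "bij_betw \<sigma> {..<CARD('n)} (UNIV :: 'n set)"
    by (simp add: atLeast0LessThan)
  fix v assume vA: "v \<in> A"
  obtain c where c: "c \<in> \<A>" "fst v \<in> fst c"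
    using vA by (rule A_chartE)
  define W where "W = A \<inter> fst (T c)"
  have W: "q \<in> W \<longleftrightarrow> q \<in> A \<and> fst q \<in> fst c" for q
    using A_in_T by (auto simp: W_def)
  have oW: "openin TM.mtop W"
    unfolding W_def by (intro openin_Int open_A TM.openin_domain T_in c)
  define E where "E i q = tvec_of TA (T c) q (axis (\<sigma> i) 1, - N c q (axis (\<sigma> i) 1))" for i :: nat and q
  have E: "E i q \<in> tangent_space TA q" "E i q (T c) = (axis (\<sigma> i) 1, - N c q (axis (\<sigma> i) 1))"
    if "q \<in> W" for i q
    unfolding E_def using that T_tvec_of[OF c(1)] by (simp_all add: W)
  \<comment> \<open>A combination of the frame is the horizontal lift of its coefficient vector. Its
    first component shows independence, and its second one that every horizontal vector is
    obtained.\<close>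
  have comb: "(\<Sum>i<CARD('n). f (\<sigma> i) *\<^sub>R E i q) (T c) = ((\<chi> j. f j), - N c q (\<chi> j. f j))"
    if q: "q \<in> W" for f q
  proof -
    have l: "linear (N c q)"
      using nl_dataD(1)[OF N c(1)] q by (simp add: W)
    have "(\<Sum>i<CARD('n). f (\<sigma> i) *\<^sub>R E i q) (T c) =
        (\<Sum>i<CARD('n). f (\<sigma> i) *\<^sub>R (axis (\<sigma> i) 1, - N c q (axis (\<sigma> i) 1)))"
      by (simp add: sum_fun_eq E[OF q])
    also have "\<dots> = (\<Sum>j\<in>UNIV. f j *\<^sub>R (axis j 1, - N c q (axis j 1)))"
      by (rule sum.reindex_bij_betw[OF \<sigma>])
    also have "\<dots> = ((\<chi> j. f j), - N c q (\<chi> j. f j))"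
    proof (rule prod_eqI)
      show "fst (\<Sum>j\<in>UNIV. f j *\<^sub>R (axis j 1, - N c q (axis j 1))) = fst ((\<chi> j. f j), - N c q (\<chi> j. f j))"
        unfolding fst_sum using vec_expansion[of "\<chi> j. f j"] by simp
      show "snd (\<Sum>j\<in>UNIV. f j *\<^sub>R (axis j 1, - N c q (axis j 1))) = snd ((\<chi> j. f j), - N c q (\<chi> j. f j))"
        unfolding snd_sum using linear_expansion_axis[OF l, of "\<chi> j. f j"] by (simp add: sum_negf)
    qed
    finally show ?thesis .
  qed
  show "\<exists>W E. openin TM.mtop W \<and> v \<in> W \<and> W \<subseteq> A \<and> (\<forall>i<CARD('n). smooth_field_on TA W (E i)) \<and>
      (\<forall>q\<in>W. inj_on (\<lambda>i. E i q) {..<CARD('n)} \<and> independent ((\<lambda>i. E i q) ` {..<CARD('n)}) \<and>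
         distr_of_data N `` {q} = span ((\<lambda>i. E i q) ` {..<CARD('n)}))"
  proof (intro exI[of _ W] exI[of _ E] conjI allI impI ballI oW)
    show "v \<in> W" "W \<subseteq> A"
      using vA c by (auto simp: W)
    fix i :: nat assume "i < CARD('n)"
    show "smooth_field_on TA W (E i)"
    proof (rule TM.smooth_field_onI[OF oW E(1)])
      fix q assume q: "q \<in> W"
      have "msmooth TA (\<lambda>q. (axis (\<sigma> i) 1, - N c q (axis (\<sigma> i) 1))) q"
      proof (rule TM.msmooth_compose[of "\<lambda>q. N c q (axis (\<sigma> i) 1)" q "\<lambda>z. (axis (\<sigma> i) 1, - z)"])
        show "msmooth TA (\<lambda>q. N c q (axis (\<sigma> i) 1)) q"
          using nl_dataD(2)[OF N c(1)] q by (simp add: W)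
      qed (intro smooth_at_Pair smooth_at_const smooth_at_minus smooth_at_ident)
      moreover have "eventually (\<lambda>q. (axis (\<sigma> i) 1, - N c q (axis (\<sigma> i) 1)) = E i q (T c)) (nhdsin TM.mtop q)"
        using TM.eventually_nhdsin_openin[OF oW q] by eventually_elim (simp add: E)
      ultimately have "msmooth TA (\<lambda>q. E i q (T c)) q"
        by (rule TM.msmooth_cong[rotated])
      then show "\<exists>C\<in>TA. q \<in> fst C \<and> msmooth TA (\<lambda>q. E i q C) q"
        using q c(1) by (intro bexI[of _ "T c"]) (simp_all add: W_def)
    qed
  next
    fix q assume q: "q \<in> W"
    show inj: "inj_on (\<lambda>i. E i q) {..<CARD('n)}"
    proof (rule inj_onI)
      fix i j assume ij: "i \<in> {..<CARD('n)}" "j \<in> {..<CARD('n)}" "E i q = E j q"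
      then have "E i q (T c) = E j q (T c)"
        by simp
      then have "\<sigma> i = \<sigma> j"
        by (simp add: E[OF q] axis_eq_axis)
      then show "i = j"
        using \<sigma> ij by (simp add: bij_betw_def inj_on_def)
    qed
    show "independent ((\<lambda>i. E i q) ` {..<CARD('n)})"
    proof (rule independent_if_scalars_zero)
      fix f w assume f: "(\<Sum>w\<in>(\<lambda>i. E i q) ` {..<CARD('n)}. f w *\<^sub>R w) = 0"
        and "w \<in> (\<lambda>i. E i q) ` {..<CARD('n)}"
      then obtain i where i: "w = E i q" "i < CARD('n)"
        by blast
      \<comment> \<open>The scalars \<open>f\<close> are attached to vectors; injectivity of the
        frame allows them to be moved to the index type so that \<open>comb\<close> applies.\<close>
      define g where "g j = f (E (inv_into {..<CARD('n)} \<sigma> j) q)" for j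
      have g: "g (\<sigma> i) = f (E i q)" if "i < CARD('n)" for i
        using that \<sigma> by (simp add: g_def bij_betw_def inv_into_f_f)
      have "(\<Sum>i<CARD('n). g (\<sigma> i) *\<^sub>R E i q) = 0"
        using f inj by (simp add: sum.reindex g)
      then have "(\<chi> j. g j) = 0"
        using comb[OF q, of g] by (simp add: zero_prod_def)
      then show "f w = 0"
        using g[OF i(2)] i(1) by (simp add: vec_eq_iff)
    qed simp
    have Wq: "q \<in> A" "fst q \<in> fst c"
      using q by (simp_all add: W)
    show "distr_of_data N `` {q} = span ((\<lambda>i. E i q) ` {..<CARD('n)})"
    proof
      show "span ((\<lambda>i. E i q) ` {..<CARD('n)}) \<subseteq> distr_of_data N `` {q}"
        by (rule span_minimal[OF _ distr_of_data_subspace[OF c(1) Wq]])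
          (auto simp: distr_of_data_iff[OF c(1) Wq] E[OF q])
      show "distr_of_data N `` {q} \<subseteq> span ((\<lambda>i. E i q) ` {..<CARD('n)})"
      proof
        fix w assume "w \<in> distr_of_data N `` {q}"
        then have w: "w \<in> tangent_space TA q" "snd (w (T c)) = - N c q (fst (w (T c)))"
          by (simp_all add: distr_of_data_iff[OF c(1) Wq])
        define u where "u = fst (w (T c))"
        have "w = (\<Sum>i<CARD('n). u $ \<sigma> i *\<^sub>R E i q)"
        proof (rule T_tangent_eqI[OF w(1) _ c(1) Wq])
          show "(\<Sum>i<CARD('n). u $ \<sigma> i *\<^sub>R E i q) \<in> tangent_space TA q"
            by (intro subspace_sum[OF TM.subspace_tangent_space] TM.tangent_scale E q)
          show "w (T c) = (\<Sum>i<CARD('n). u $ \<sigma> i *\<^sub>R E i q) (T c)"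
            unfolding comb[OF q] using w(2) by (simp add: prod_eq_iff u_def)
        qed
        also have "\<dots> \<in> span ((\<lambda>i. E i q) ` {..<CARD('n)})"
          by (intro span_sum span_scale span_base) auto
        finally show "w \<in> span ((\<lambda>i. E i q) ` {..<CARD('n)})" .
      qed
    qed
  qed
qed

lemma distr_of_data_in: "distr_of_data N \<in> nonlinear_connections \<A> A"
  unfolding nonlinear_connections_def
proof (intro CollectI conjI ballI distr_of_data_distribution)
  fix v assume v: "v \<in> A"
  obtain c where c: "c \<in> \<A>" "fst v \<in> fst c"
    using v by (rule A_chartE)
  note iff = distr_of_data_iff[OF c(1) v c(2)] and vert = vertical_space_iff[OF v c]
  have l: "linear (N c v)"
    by (rule nl_dataD(1)[OF N c(1) v c(2)])
  show "distr_of_data N `` {v} \<inter> vertical_space \<A> v = {0}"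
  proof (intro equalityI subsetI)
    fix w assume "w \<in> distr_of_data N `` {v} \<inter> vertical_space \<A> v"
    then have w: "w \<in> tangent_space TA v" "fst (w (T c)) = 0" "snd (w (T c)) = - N c v (fst (w (T c)))"
      using iff vert by blast+
    then have "w (T c) = 0"
      using linear_0[OF l] by (simp add: prod_eq_iff)
    then show "w \<in> {0}"
      using T_tangent_eqI[OF w(1) TM.tangent_0 c(1) v c(2)] by simp
  next
    fix w :: "(('a, real^'n) tpoint, (real^'n) \<times> (real^'n)) tvec" assume "w \<in> {0}"
    then show "w \<in> distr_of_data N `` {v} \<inter> vertical_space \<A> v"
      using iff[of 0] vert[of 0] TM.tangent_0[of v] linear_0[OF l] by simp
  qed
  show "{h + u |h u. h \<in> distr_of_data N `` {v} \<and> u \<in> vertical_space \<A> v} = tangent_space TA v"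
  proof (intro equalityI subsetI)
    fix z assume "z \<in> {h + u |h u. h \<in> distr_of_data N `` {v} \<and> u \<in> vertical_space \<A> v}"
    then obtain h u where "z = h + u" "(v, h) \<in> distr_of_data N" "u \<in> vertical_space \<A> v"
      by blast
    then show "z \<in> tangent_space TA v"
      using iff vert TM.tangent_add by metis
  next
    fix z assume z: "z \<in> tangent_space TA v"
    \<comment> \<open>The horizontal vector with the same base part as \<open>z\<close>; the
      difference from \<open>z\<close> is then vertical.\<close>
    define h where "h = tvec_of TA (T c) v (fst (z (T c)), - N c v (fst (z (T c))))"
    have h: "h \<in> tangent_space TA v" "h (T c) = (fst (z (T c)), - N c v (fst (z (T c))))"
      unfolding h_def by (rule T_tvec_of[OF c(1) v c(2)])+
    have "h \<in> distr_of_data N `` {v}"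
      unfolding Image_singleton_iff iff by (simp add: h)
    moreover have "z - h \<in> vertical_space \<A> v"
      unfolding vert using subspace_diff[OF TM.subspace_tangent_space z h(1)] h(2) by simp
    moreover have "z = h + (z - h)"
      by (simp only: add_diff_cancel_left' diff_add_cancel add.commute[of h])
    ultimately show "z \<in> {h + u |h u. h \<in> distr_of_data N `` {v} \<and> u \<in> vertical_space \<A> v}"
      by blast
  qed
qed

lemma distr_of_data_comp:
  assumes "c \<in> \<A>" "v \<in> A" "fst v \<in> fst c"
  shows "nl_comp \<A> (distr_of_data N) c i a v = N c v (axis i 1) $ a"
    and "Nl \<A> (distr_of_data N) c v = N c v"
  using nl_comp_graph[OF nl_dataD(1)[OF N assms] distr_of_data_graph[OF assms]] by blast+

end

end

section \<open>From anisotropic to nonlinear connections and back\<close>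

lemma fst_dilate [simp]: "fst (dilate r v) = fst v"
  and snd_dilate [simp]: "snd (dilate r v) = r *\<^sub>R snd v"
  by (simp_all add: dilate_def)

lemma Gam_comp: "Gam \<A> D c v (axis i 1) y $ a = (\<Sum>j\<in>UNIV. christoffel \<A> D c a i j v * y $ j)"
proof -
  have "Gam \<A> D c v (axis i 1) y = (\<Sum>j\<in>UNIV. y $ j *\<^sub>R Gam \<A> D c v (axis i 1) (axis j 1))"
    using bilinear_Gam[of \<A> D c v] by (intro linear_expansion_axis) (simp add: bilinear_def)
  then show ?thesis
    by (simp add: mult.commute)
qed

context conic_domain
begin

lemma dilate_A: "v \<in> A \<Longrightarrow> r > 0 \<Longrightarrow> dilate r v \<in> A"
  using conic unfolding conic_set_def by blast

lemma A_points_T: "v \<in> A \<Longrightarrow> v \<in> points TA"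
  using A_TM by (auto simp: points_T_atlas)

lemma nl_data_aniso_data:
  assumes G: "aniso_data G"
  shows "nl_data (\<lambda>c v u. G c v u (snd v c))"
  unfolding nl_data_def
proof (intro ballI impI conjI allI)
  fix c v assume c: "c \<in> \<A>" and v: "v \<in> A" "fst v \<in> fst c"
  show "linear (\<lambda>u. G c v u (snd v c))"
    using aniso_dataD(1)[OF G c v] by (simp add: bilinear_def)
  show "msmooth TA (\<lambda>v. G c v u (snd v c)) v" for u
  proof (rule TM.msmooth_cong)
    show "eventually (\<lambda>v. (\<Sum>j\<in>UNIV. snd v c $ j *\<^sub>R G c v u (axis j 1)) = G c v u (snd v c))
        (nhdsin TM.mtop v)"
      using eventually_dom[OF c v]
    proof eventually_elim
      fix v assume v: "v \<in> A \<and> fst v \<in> fst c"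
      then have "linear (G c v u)"
        using aniso_dataD(1)[OF G c, of v] by (simp add: bilinear_def)
      then show "(\<Sum>j\<in>UNIV. snd v c $ j *\<^sub>R G c v u (axis j 1)) = G c v u (snd v c)"
        by (rule linear_expansion_axis[symmetric])
    qed
    show "msmooth TA (\<lambda>v. \<Sum>j\<in>UNIV. snd v c $ j *\<^sub>R G c v u (axis j 1)) v"
      using v A_TM by (intro TM.msmooth_sum TM.msmooth_scaleR TM.msmooth_linear[OF bounded_linear_vec_nth]
          msmooth_fibre c aniso_dataD(2)[OF G c v] A_points_T) auto
  qed
  fix d u assume d: "d \<in> \<A>" "fst v \<in> fst d"
  show "G d v (dtr c d (fst v) u) (snd v d) + d2tr c d (fst v) u (snd v c) =
      dtr c d (fst v) (G c v u (snd v c))"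
    \<comment> \<open>The fibre coordinate is itself the component of a tangent vector, so it
      changes by the Jacobian and may be inserted as second argument.\<close>
    using aniso_dataD(3)[OF G c v d, of u "snd v c"]
    by (simp add: tangent_coord[OF A_tangent[OF v(1)] c d(1) v(2) d(2)])
qed

lemma nl_from_aniso_iff:
  "nl_from_aniso \<A> A D H \<longleftrightarrow> H \<in> nonlinear_connections \<A> A \<and>
    (\<forall>c\<in>\<A>. \<forall>v\<in>A. fst v \<in> fst c \<longrightarrow> (\<forall>u. Nl \<A> H c v u = Gam \<A> D c v u (snd v c)))"
proof -
  have *: "(\<forall>i a. nl_comp \<A> H c i a v = (\<Sum>j\<in>UNIV. christoffel \<A> D c a i j v * snd v c $ j)) \<longleftrightarrow>
      (\<forall>u. Nl \<A> H c v u = Gam \<A> D c v u (snd v c))" for c v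
  proof
    assume *: "\<forall>i a. nl_comp \<A> H c i a v = (\<Sum>j\<in>UNIV. christoffel \<A> D c a i j v * snd v c $ j)"
    have l: "linear (\<lambda>u. Gam \<A> D c v u (snd v c))"
      using bilinear_Gam[of \<A> D c v] by (simp add: bilinear_def)
    have "(\<chi> a. nl_comp \<A> H c i a v) = Gam \<A> D c v (axis i 1) (snd v c)" for i
      by (simp add: vec_eq_iff * Gam_comp)
    then have "Nl \<A> H c v u = Gam \<A> D c v u (snd v c)" for u
      unfolding Nl_def using linear_expansion_axis[OF l, of u] by simp
    then show "\<forall>u. Nl \<A> H c v u = Gam \<A> D c v u (snd v c)"
      by blast
  next
    assume *: "\<forall>u. Nl \<A> H c v u = Gam \<A> D c v u (snd v c)"
    show "\<forall>i a. nl_comp \<A> H c i a v = (\<Sum>j\<in>UNIV. christoffel \<A> D c a i j v * snd v c $ j)"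
      using * by (simp flip: Nl_axis Gam_comp)
  qed
  then show ?thesis
    by (simp only: nl_from_aniso_def Ball_def dom_in_iff * imp_conjL)
qed

lemma nl_from_aniso_unique:
  "nl_from_aniso \<A> A D H \<Longrightarrow> nl_from_aniso \<A> A D H' \<Longrightarrow> H = H'"
  unfolding nl_from_aniso_def by (rule nonlinear_connections_eqI) (auto simp: dom_in_iff)

lemma nl_of_eqI:
  assumes "nl_from_aniso \<A> A D H"
  shows "nl_of \<A> A D = H"
  unfolding nl_of_def using assms nl_from_aniso_unique[OF _ assms] by (rule the_equality)

lemma ex1_nl_from_aniso:
  assumes "D \<in> aniso_connections \<A> A"
  shows "\<exists>!H. nl_from_aniso \<A> A D H"
proof (rule ex_ex1I)
  have N: "nl_data (\<lambda>c v u. Gam \<A> D c v u (snd v c))"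
    by (rule nl_data_aniso_data[OF aniso_data_Gam[OF assms]])
  show "\<exists>H. nl_from_aniso \<A> A D H"
  proof
    have "Nl \<A> (distr_of_data (\<lambda>c v u. Gam \<A> D c v u (snd v c))) c v u = Gam \<A> D c v u (snd v c)"
      if "c \<in> \<A>" "v \<in> A" "fst v \<in> fst c" for c v u
      using distr_of_data_comp(2)[OF N that] by simp
    then show "nl_from_aniso \<A> A D (distr_of_data (\<lambda>c v u. Gam \<A> D c v u (snd v c)))"
      unfolding nl_from_aniso_iff using distr_of_data_in[OF N] by blast
  qed
qed (rule nl_from_aniso_unique)

lemma nl_from_aniso_nl_of: "D \<in> aniso_connections \<A> A \<Longrightarrow> nl_from_aniso \<A> A D (nl_of \<A> A D)"
  unfolding nl_of_def by (rule theI') (rule ex1_nl_from_aniso)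

lemma Nl_nl_of:
  assumes "D \<in> aniso_connections \<A> A" "c \<in> \<A>" "v \<in> A" "fst v \<in> fst c"
  shows "Nl \<A> (nl_of \<A> A D) c v u = Gam \<A> D c v u (snd v c)"
  using nl_from_aniso_nl_of[OF assms(1)] assms(2-4) unfolding nl_from_aniso_iff by blast

lemma nl_of_in: "D \<in> aniso_connections \<A> A \<Longrightarrow> nl_of \<A> A D \<in> nonlinear_connections \<A> A"
  using nl_from_aniso_nl_of unfolding nl_from_aniso_iff by blast

subsection \<open>Homogeneity in coordinates\<close>

text \<open>A dilation does not move the base point, so the same fields compute the Christoffel
  symbols at \<open>v\<close> and at its dilation; the converse is the coordinate formula, whose
  derivative term depends only on the base point.\<close>

lemma homogeneous_aniso_iff:
  assumes D: "D \<in> aniso_connections \<A> A"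
  shows "homogeneous_aniso \<A> A D \<longleftrightarrow>
    (\<forall>c\<in>\<A>. \<forall>v\<in>A. fst v \<in> fst c \<longrightarrow> (\<forall>r>0. Gam \<A> D c (dilate r v) = Gam \<A> D c v))"
proof
  assume h: "homogeneous_aniso \<A> A D"
  show "\<forall>c\<in>\<A>. \<forall>v\<in>A. fst v \<in> fst c \<longrightarrow> (\<forall>r>0. Gam \<A> D c (dilate r v) = Gam \<A> D c v)"
  proof (intro ballI impI allI)
    fix c v and r :: real assume c: "c \<in> \<A>" and v: "v \<in> A" "fst v \<in> fst c" and r: "r > 0"
    obtain E where E: "\<And>i. E i \<in> vector_fields \<A>"
      "\<And>i. eventually (\<lambda>q. E i q = coord_field \<A> c i q) (nhdsin mtop (fst v))"
      using ex_coord_field[OF c v(2)] by blast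
    have "christoffel \<A> D c a i j (dilate r v) = D (E i) (E j) (dilate r v) c $ a" for a i j
      by (rule christoffel_eq[OF D c dilate_A[OF v(1) r]]) (simp_all add: v E)
    moreover have "christoffel \<A> D c a i j v = D (E i) (E j) v c $ a" for a i j
      by (rule christoffel_eq[OF D c v E E])
    moreover have "D (E i) (E j) (dilate r v) = D (E i) (E j) v" for i j
      using h E(1) v(1) r unfolding homogeneous_aniso_def by blast
    ultimately show "Gam \<A> D c (dilate r v) = Gam \<A> D c v"
      by (simp add: Gam_def fun_eq_iff)
  qed
next
  assume h: "\<forall>c\<in>\<A>. \<forall>v\<in>A. fst v \<in> fst c \<longrightarrow> (\<forall>r>0. Gam \<A> D c (dilate r v) = Gam \<A> D c v)"
  show "homogeneous_aniso \<A> A D"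
    unfolding homogeneous_aniso_def
  proof (intro ballI allI impI)
    fix X Y v and r :: real
    assume XY: "X \<in> vector_fields \<A>" "Y \<in> vector_fields \<A>" and v: "v \<in> A" and r: "r > 0"
    obtain c where c: "c \<in> \<A>" "fst v \<in> fst c"
      using v by (rule A_chartE)
    note rv = dilate_A[OF v r]
    have "Gam \<A> D c (dilate r v) = Gam \<A> D c v"
      using h c v r by blast
    then have "D X Y (dilate r v) c = D X Y v c"
      using aniso_conn_formula[OF D c(1) v c(2) XY] aniso_conn_formula[OF D c(1) rv _ XY] c(2) by simp
    then show "D X Y (dilate r v) = D X Y v"
      using tangent_eqI[OF _ aniso_conn_tangent[OF D XY v] c] aniso_conn_tangent[OF D XY rv] by simp
  qed
qed

text \<open>The \<open>d2tr\<close> term in the Jacobian is linear in the fibre coordinate, so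
  transition maps commute with \<open>(u, w) \<mapsto> (u, r w)\<close>, the differential of the
  dilation.\<close>

lemma dtr_dilate:
  assumes "c \<in> \<A>" "d \<in> \<A>" "v \<in> A" "fst v \<in> fst c" "fst v \<in> fst d" "r > 0"
  shows "dtr (T c) (T d) (dilate r v) (u, r *\<^sub>R w) =
    (fst (dtr (T c) (T d) v (u, w)), r *\<^sub>R snd (dtr (T c) (T d) v (u, w)))"
proof -
  have "v \<in> TM" "dilate r v \<in> TM"
    using assms dilate_A A_TM by blast+
  then show ?thesis
    using assms dtr_T_chart[of c d v u w] dtr_T_chart[of c d "dilate r v" u "r *\<^sub>R w"]
      linear_scale[OF linear_dtr[of c d "fst v"]] linear_scale[OF linear_d2tr(1)[of c d "fst v"]]
    by (simp add: scaleR_add_right)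
qed

text \<open>In every induced chart the dilation reads \<open>(x, y) \<mapsto> (x, r y)\<close>. The
  chart that \<open>tangent_map\<close> chooses at \<open>v\<close> is removed by the transformation
  law of \<open>w\<close>.\<close>

lemma tangent_map_dilate:
  assumes w: "w \<in> tangent_space TA v" and v: "v \<in> A" and r: "r > 0"
  shows "d \<in> \<A> \<Longrightarrow> fst v \<in> fst d \<Longrightarrow>
      tangent_map TA TA (dilate r) v w (T d) = (fst (w (T d)), r *\<^sub>R snd (w (T d)))"
    and "tangent_map TA TA (dilate r) v w \<in> tangent_space TA (dilate r v)"
proof -
  have *: "tangent_map TA TA (dilate r) v w (T d) = (fst (w (T d)), r *\<^sub>R snd (w (T d)))"
    if d: "d \<in> \<A>" "fst v \<in> fst d" for d
  proof -
    obtain e where e: "e \<in> \<A>" "fst v \<in> fst e" "some_chart TA v = T e"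
      using some_T_chartE[OF v] .
    have vT: "v \<in> fst (T e)" "v \<in> fst (T d)" "dilate r v \<in> fst (T d)"
      using A_in_T[OF v] A_in_T[OF dilate_A[OF v r]] e d by simp_all
    have "tangent_map TA TA (dilate r) v w (T d) =
        mderiv (T e) (\<lambda>v. snd (T d) (dilate r v)) v (w (T e))"
      using d vT unfolding tangent_map_def e(3) mderiv_def comp_def Let_def by simp
    also have "mderiv (T e) (\<lambda>v. snd (T d) (dilate r v)) v =
        (\<lambda>z. (fst (dtr (T e) (T d) v z), r *\<^sub>R snd (dtr (T e) (T d) v z)))"
    proof (rule mderivI)
      have D: "((\<lambda>z. snd (T d) (chart_inv (T e) z)) has_derivative dtr (T e) (T d) v) (at (snd (T e) v))"
        using TM.mderiv_has_derivative[OF T_in[OF e(1)] vT(1) TM.msmooth_chart[OF T_in[OF d(1)] vT(2)]]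
        by (simp add: dtr_def[abs_def])
      have "((\<lambda>z. (fst (snd (T d) (chart_inv (T e) z)), r *\<^sub>R snd (snd (T d) (chart_inv (T e) z))))
          has_derivative (\<lambda>z. (fst (dtr (T e) (T d) v z), r *\<^sub>R snd (dtr (T e) (T d) v z)))) (at (snd (T e) v))"
        by (intro has_derivative_Pair has_derivative_fst has_derivative_scaleR_right has_derivative_snd D)
      then show "((\<lambda>z. snd (T d) (dilate r (chart_inv (T e) z)))
          has_derivative (\<lambda>z. (fst (dtr (T e) (T d) v z), r *\<^sub>R snd (dtr (T e) (T d) v z)))) (at (snd (T e) v))"
        by (simp add: snd_T_chart)
    qed
    also have "dtr (T e) (T d) v (w (T e)) = w (T d)"
      using TM.tangent_coord[OF w T_in[OF e(1)] T_in[OF d(1)] vT(1,2)] by simp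
    finally show ?thesis .
  qed
  then show "d \<in> \<A> \<Longrightarrow> fst v \<in> fst d \<Longrightarrow>
      tangent_map TA TA (dilate r) v w (T d) = (fst (w (T d)), r *\<^sub>R snd (w (T d)))" .
  show "tangent_map TA TA (dilate r) v w \<in> tangent_space TA (dilate r v)"
  proof (rule TM.tangent_spaceI)
    fix C D assume "C \<in> TA" "D \<in> TA" "dilate r v \<in> fst C" "dilate r v \<in> fst D"
    then obtain c d where c: "c \<in> \<A>" "C = T c" "fst v \<in> fst c" and d: "d \<in> \<A>" "D = T d" "fst v \<in> fst d"
      by (auto elim!: T_inE)
    have "w (T d) = dtr (T c) (T d) v (w (T c))"
      using c d A_in_T[OF v] by (intro TM.tangent_coord[OF w]) simp_all
    then show "tangent_map TA TA (dilate r) v w D = dtr C D (dilate r v) (tangent_map TA TA (dilate r) v w C)"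
      using *[OF c(1,3)] *[OF d(1,3)] dtr_dilate[OF c(1) d(1) v c(3) d(3) r, of "fst (w (T c))" "snd (w (T c))"]
      by (simp add: c(2) d(2))
  next
    fix C assume "\<not> (C \<in> TA \<and> dilate r v \<in> fst C)"
    then show "tangent_map TA TA (dilate r) v w C = 0"
      by (simp only: tangent_map_def if_False)
  qed
qed

text \<open>The differential of the dilation sends \<open>(u, - N(v) u)\<close> to
  \<open>(u, - r N(v) u)\<close>, so invariance of the horizontal spaces says that the graphs at the
  dilated vector are those of \<open>- r N(v)\<close>.\<close>

lemma homogeneous_nl_iff:
  assumes H: "H \<in> nonlinear_connections \<A> A"
  shows "homogeneous_nl \<A> A H \<longleftrightarrow>
    (\<forall>c\<in>\<A>. \<forall>v\<in>A. fst v \<in> fst c \<longrightarrow> (\<forall>r>0. \<forall>u. Nl \<A> H c (dilate r v) u = r *\<^sub>R Nl \<A> H c v u))"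
proof
  assume h: "homogeneous_nl \<A> A H"
  show "\<forall>c\<in>\<A>. \<forall>v\<in>A. fst v \<in> fst c \<longrightarrow> (\<forall>r>0. \<forall>u. Nl \<A> H c (dilate r v) u = r *\<^sub>R Nl \<A> H c v u)"
  proof (intro ballI impI allI)
    fix c v u and r :: real assume c: "c \<in> \<A>" and v: "v \<in> A" "fst v \<in> fst c" and r: "r > 0"
    define w where "w = tvec_of TA (T c) v (u, - Nl \<A> H c v u)"
    have w: "w \<in> tangent_space TA v" "w (T c) = (u, - Nl \<A> H c v u)"
      unfolding w_def by (rule T_tvec_of[OF c v])+
    then have "(v, w) \<in> H"
      by (simp add: nl_fibre[OF H c v])
    then have "tangent_map TA TA (dilate r) v w \<in> H `` {dilate r v}"
      using h v(1) r unfolding homogeneous_nl_def by blast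
    then have "snd (tangent_map TA TA (dilate r) v w (T c)) =
        - Nl \<A> H c (dilate r v) (fst (tangent_map TA TA (dilate r) v w (T c)))"
      using nl_fibre[OF H c dilate_A[OF v(1) r]] v(2) by simp
    then show "Nl \<A> H c (dilate r v) u = r *\<^sub>R Nl \<A> H c v u"
      using tangent_map_dilate(1)[OF w(1) v(1) r c v(2)] w(2) by simp
  qed
next
  assume h: "\<forall>c\<in>\<A>. \<forall>v\<in>A. fst v \<in> fst c \<longrightarrow> (\<forall>r>0. \<forall>u. Nl \<A> H c (dilate r v) u = r *\<^sub>R Nl \<A> H c v u)"
  show "homogeneous_nl \<A> A H"
    unfolding homogeneous_nl_def
  proof (intro ballI allI impI equalityI subsetI)
    fix v z and r :: real assume v: "v \<in> A" and r: "r > 0"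
    obtain c where c: "c \<in> \<A>" "fst v \<in> fst c"
      using v by (rule A_chartE)
    have rv: "dilate r v \<in> A" "fst (dilate r v) \<in> fst c"
      using dilate_A[OF v r] c by simp_all
    have N: "Nl \<A> H c (dilate r v) u = r *\<^sub>R Nl \<A> H c v u" for u
      using h c v r by blast
    {
      assume "z \<in> tangent_map TA TA (dilate r) v ` (H `` {v})"
      then obtain w where w: "z = tangent_map TA TA (dilate r) v w" "(v, w) \<in> H"
        by blast
      have w': "w \<in> tangent_space TA v" "snd (w (T c)) = - Nl \<A> H c v (fst (w (T c)))"
        using w(2) nl_fibre[OF H c(1) v c(2)] by blast+
      show "z \<in> H `` {dilate r v}"
        unfolding Image_singleton_iff nl_fibre[OF H c(1) rv] w(1)
        using tangent_map_dilate[OF w'(1) v r] c w'(2) by (simp add: N)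
    next
      assume "z \<in> H `` {dilate r v}"
      then have z: "z \<in> tangent_space TA (dilate r v)" "snd (z (T c)) = - Nl \<A> H c (dilate r v) (fst (z (T c)))"
        using nl_fibre[OF H c(1) rv] by blast+
      define w where "w = tvec_of TA (T c) v (fst (z (T c)), - Nl \<A> H c v (fst (z (T c))))"
      have w: "w \<in> tangent_space TA v" "w (T c) = (fst (z (T c)), - Nl \<A> H c v (fst (z (T c))))"
        unfolding w_def by (rule T_tvec_of[OF c(1) v c(2)])+
      have "(v, w) \<in> H"
        using w by (simp add: nl_fibre[OF H c(1) v c(2)])
      moreover have "z = tangent_map TA TA (dilate r) v w"
      proof (rule T_tangent_eqI[OF z(1) tangent_map_dilate(2)[OF w(1) v r] c(1) rv])
        show "z (T c) = tangent_map TA TA (dilate r) v w (T c)"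
          using tangent_map_dilate(1)[OF w(1) v r c] z(2) w(2) by (simp add: prod_eq_iff N)
      qed
      ultimately show "z \<in> tangent_map TA TA (dilate r) v ` (H `` {v})"
        by blast
    }
  qed
qed

text \<open>The Christoffel symbols are unchanged by the dilation, while the fibre coordinate that
  is inserted into them is multiplied by \<open>r\<close>.\<close>

lemma homogeneous_nl_of:
  assumes D: "D \<in> aniso_connections \<A> A" and h: "homogeneous_aniso \<A> A D"
  shows "homogeneous_nl \<A> A (nl_of \<A> A D)"
  unfolding homogeneous_nl_iff[OF nl_of_in[OF D]]
proof (intro ballI impI allI)
  fix c v u and r :: real assume c: "c \<in> \<A>" and v: "v \<in> A" "fst v \<in> fst c" and r: "r > 0"
  have "Gam \<A> D c (dilate r v) = Gam \<A> D c v"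
    using h c v r unfolding homogeneous_aniso_iff[OF D] by blast
  then show "Nl \<A> (nl_of \<A> A D) c (dilate r v) u = r *\<^sub>R Nl \<A> (nl_of \<A> A D) c v u"
    using Nl_nl_of[OF D c v] Nl_nl_of[OF D c dilate_A[OF v(1) r]] v(2) bilinear_rmul[OF bilinear_Gam]
    by simp
qed

subsection \<open>Vertical derivatives\<close>

definition vderiv :: "(('a, real^'n) chart \<Rightarrow> ('a, real^'n) tpoint \<Rightarrow> real^'n \<Rightarrow> real^'n) \<Rightarrow>
    ('a, real^'n) chart \<Rightarrow> ('a, real^'n) tpoint \<Rightarrow> real^'n \<Rightarrow> real^'n \<Rightarrow> real^'n"
  where "vderiv N c v u w = mderiv (T c) (\<lambda>v. N c v u) v (0, w)"

text \<open>Along a vertical direction the base point does not move, so the linear map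
  \<open>P\<close> behaves like a constant one and the derivative passes through it.\<close>

lemma mderiv_vertical:
  fixes P :: "'a \<Rightarrow> real^'n \<Rightarrow> 'f::euclidean_space"
  assumes c: "c \<in> \<A>" and v: "v \<in> A" "fst v \<in> fst c"
    and lin: "eventually (\<lambda>q. linear (P q)) (nhdsin mtop (fst v))"
    and P: "\<And>b. msmooth \<A> (\<lambda>q. P q b) (fst v)" and F: "msmooth TA F v"
  shows "mderiv (T c) (\<lambda>v. P (fst v) (F v)) v (0, w) = P (fst v) (mderiv (T c) F v (0, w))"
proof -
  have vT: "T c \<in> TA" "v \<in> fst (T c)" "v \<in> TM"
    using c A_in_T[OF v] v A_TM by auto
  have Fb: "msmooth TA (\<lambda>v. F v \<bullet> b) v" for b
    by (rule TM.msmooth_linear[OF bounded_linear_inner_left F])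
  have Pb: "msmooth TA (\<lambda>v. P (fst v) b) v" for b
    by (rule msmooth_base[OF P vT(3)])
  have P0: "mderiv (T c) (\<lambda>v. P (fst v) b) v (0, w) = 0" for b
    unfolding mderiv_base[OF c P vT(3) v(2)] using linear_0[OF linear_mderiv[OF c v(2) P]] by simp
  have F0: "mderiv (T c) (\<lambda>v. F v \<bullet> b) v = (\<lambda>z. mderiv (T c) F v z \<bullet> b)" for b
    by (intro mderivI has_derivative_inner_left TM.mderiv_has_derivative vT F)
  have "mderiv (T c) (\<lambda>v. P (fst v) (F v)) v (0, w) =
      mderiv (T c) (\<lambda>v. \<Sum>b\<in>Basis. (F v \<bullet> b) *\<^sub>R P (fst v) b) v (0, w)"
  proof (intro fun_cong[OF TM.mderiv_cong] vT)
    show "eventually (\<lambda>v. P (fst v) (F v) = (\<Sum>b\<in>Basis. (F v \<bullet> b) *\<^sub>R P (fst v) b)) (nhdsin TM.mtop v)"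
      using eventually_base[OF vT(3) lin] by eventually_elim (rule linear_expansion_Basis)
  qed
  also have "\<dots> = (\<Sum>b\<in>Basis. mderiv (T c) (\<lambda>v. (F v \<bullet> b) *\<^sub>R P (fst v) b) v (0, w))"
    by (intro fun_cong[OF mderivI] has_derivative_sum TM.mderiv_has_derivative vT TM.msmooth_scaleR Fb Pb)
  also have "\<dots> = (\<Sum>b\<in>Basis. (mderiv (T c) F v (0, w) \<bullet> b) *\<^sub>R P (fst v) b)"
    by (simp add: TM.mderiv_scaleR[OF vT(1,2) Fb Pb] P0 F0)
  also have "\<dots> = P (fst v) (mderiv (T c) F v (0, w))"
    using eventually_nhdsin_self[OF A_points[OF v(1)] lin] by (rule linear_expansion_Basis[symmetric])
  finally show ?thesis .
qed

text \<open>In the law of \<open>N\<close> the Jacobian and the second derivative in direction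
  \<open>u\<close> are linear maps that depend only on the base point, so
  \<open>mderiv_vertical\<close> differentiates both terms. The second derivative with inserted
  \<open>y\<close> becomes the one with inserted \<open>w\<close>, which is the term in the law of
  Christoffel symbols.\<close>

lemma aniso_data_vderiv:
  assumes N: "nl_data N"
  shows "aniso_data (vderiv N)"
  unfolding aniso_data_def
proof (intro ballI impI conjI allI)
  fix c v assume c: "c \<in> \<A>" and v: "v \<in> A" "fst v \<in> fst c"
  have vT: "T c \<in> TA" "v \<in> fst (T c)" "v \<in> TM" "v \<in> points TA"
    using c A_in_T[OF v] v A_TM A_points_T by auto
  note sN = nl_dataD(2)[OF N c v]
  have lin_w: "linear (vderiv N d v u)" if d: "d \<in> \<A>" "fst v \<in> fst d" for d u
  proof -
    have l: "linear (mderiv (T d) (\<lambda>v. N d v u) v)"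
      using TM.linear_mderiv[OF T_in[OF d(1)] A_in_T[OF v(1) d(2)] nl_dataD(2)[OF N d(1) v(1) d(2)]] .
    show ?thesis
    proof (rule linearI)
      show "vderiv N d v u (w + w') = vderiv N d v u w + vderiv N d v u w'" for w w'
        unfolding vderiv_def using linear_add[OF l, of "(0, w)" "(0, w')"] by simp
      show "vderiv N d v u (r *\<^sub>R w) = r *\<^sub>R vderiv N d v u w" for r w
        unfolding vderiv_def using linear_scale[OF l, of r "(0, w)"] by simp
    qed
  qed
  have lin_u: "linear (\<lambda>u. vderiv N d v u w)" if d: "d \<in> \<A>" "fst v \<in> fst d" for d w
  proof (rule linearI)
    note dT = T_in[OF d(1)] A_in_T[OF v(1) d(2)] and sNd = nl_dataD(2)[OF N d(1) v(1) d(2)]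
    have ev: "eventually (\<lambda>v. linear (N d v)) (nhdsin TM.mtop v)"
      using eventually_dom[OF d(1) v(1) d(2)] by eventually_elim (use nl_dataD(1)[OF N d(1)] in blast)
    show "vderiv N d v (u + u') w = vderiv N d v u w + vderiv N d v u' w" for u u'
      unfolding vderiv_def TM.mderiv_add[OF dT sNd sNd, symmetric]
      using ev by (intro fun_cong[OF TM.mderiv_cong[OF dT]]) (auto elim: eventually_mono simp: linear_add)
    fix r u
    have "vderiv N d v (r *\<^sub>R u) w = mderiv (T d) (\<lambda>v. r *\<^sub>R N d v u) v (0, w)"
      unfolding vderiv_def
      using ev by (intro fun_cong[OF TM.mderiv_cong[OF dT]]) (auto elim: eventually_mono simp: linear_scale)
    also have "\<dots> = r *\<^sub>R vderiv N d v u w"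
      using TM.mderiv_scaleR[OF dT TM.msmooth_const[OF vT(4)] sNd] by (simp add: vderiv_def)
    finally show "vderiv N d v (r *\<^sub>R u) w = r *\<^sub>R vderiv N d v u w" .
  qed
  show "bilinear (vderiv N c v)"
    unfolding bilinear_def using lin_w[OF c v(2)] lin_u[OF c v(2)] by blast
  show "msmooth TA (\<lambda>v. vderiv N c v u w) v" for u w
    unfolding vderiv_def by (intro TM.msmooth_mderiv vT sN TM.msmooth_const)
  fix d u w assume d: "d \<in> \<A>" "fst v \<in> fst d"
  note dT = T_in[OF d(1)] A_in_T[OF v(1) d(2)] and sNd = nl_dataD(2)[OF N d(1) v(1) d(2)]
  have p: "fst v \<in> points \<A>"
    by (rule A_points[OF v(1)])
  have ev: "eventually (\<lambda>q. q \<in> fst c \<and> q \<in> fst d) (nhdsin mtop (fst v))"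
    by (intro eventually_conj eventually_in_domain c d v)
  have s_dtr: "msmooth \<A> (\<lambda>q. dtr c d q b) (fst v)" for b
    by (intro msmooth_dtr msmooth_const c d v p)
  have lin_dtr: "eventually (\<lambda>q. linear (dtr c d q)) (nhdsin mtop (fst v))"
    using ev by eventually_elim (use linear_dtr[OF c d(1)] in blast)
  have lin_d2: "eventually (\<lambda>q. linear (d2tr c d q u)) (nhdsin mtop (fst v))"
    using ev by eventually_elim (use linear_d2tr(1)[OF c d(1)] in blast)
  have s_d2: "msmooth \<A> (\<lambda>q. d2tr c d q u b) (fst v)" for b
    unfolding d2tr_def by (intro msmooth_mderiv c v s_dtr msmooth_const p)
  have sy: "msmooth TA (\<lambda>v. snd v c) v"
    by (rule msmooth_fibre[OF c vT(3) v(2)])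
  have s1: "msmooth TA (\<lambda>v. dtr c d (fst v) (N c v u)) v"
    by (rule msmooth_dtr_base[OF c d(1) v d(2) sN])
  have lN: "linear (N d v)" if "v \<in> A" "fst v \<in> fst d" for v
    by (rule nl_dataD(1)[OF N d(1) that])
  have db: "msmooth TA (\<lambda>v. dtr c d (fst v) u \<bullet> b) v" for b
    by (rule TM.msmooth_linear[OF bounded_linear_inner_left msmooth_base[OF s_dtr vT(3)]])
  have db0: "mderiv (T c) (\<lambda>v. dtr c d (fst v) u \<bullet> b) v (0, w) = 0" for b
  proof -
    have m: "msmooth \<A> (\<lambda>q. dtr c d q u \<bullet> b) (fst v)"
      by (rule msmooth_linear[OF bounded_linear_inner_left s_dtr])
    show ?thesis
      using mderiv_base[OF c m vT(3) v(2), of "(0, w)"] linear_0[OF linear_mderiv[OF c v(2) m]] by simp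
  qed
  \<comment> \<open>A vertical vector has base part zero, so its change of chart involves the
    Jacobian of the base only and it stays vertical.\<close>
  have nb: "mderiv (T c) (\<lambda>v. N d v b) v (0, w) = vderiv N d v b (dtr c d (fst v) w)" for b
  proof -
    have "mderiv (T c) (\<lambda>v. N d v b) v (0, w) = mderiv (T d) (\<lambda>v. N d v b) v (dtr (T c) (T d) v (0, w))"
      using TM.mderiv_trans[OF vT(1) dT(1) vT(2) dT(2) sNd] by simp
    then show ?thesis
      using dtr_T_chart[OF c d(1) vT(3) v(2) d(2), of 0 w] linear_0[OF linear_dtr[OF c d(1) v(2) d(2)]]
        linear_0[OF linear_d2tr(2)[OF c d(1) v(2) d(2)]]
      by (simp add: vderiv_def)
  qed
  have "dtr c d (fst v) (vderiv N c v u w) = mderiv (T c) (\<lambda>v. dtr c d (fst v) (N c v u)) v (0, w)"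
    unfolding vderiv_def by (rule mderiv_vertical[OF c v lin_dtr s_dtr sN, symmetric])
  \<comment> \<open>The argument of \<open>N d v\<close> moves with the base point, so it is
    expanded in \<open>Basis\<close>. The coefficients have vertical derivative zero, and only the
    values of \<open>N\<close> at fixed vectors are differentiated.\<close>
  also have "\<dots> = mderiv (T c) (\<lambda>v. (\<Sum>b\<in>Basis. (dtr c d (fst v) u \<bullet> b) *\<^sub>R N d v b) +
      d2tr c d (fst v) u (snd v c)) v (0, w)"
  proof (intro fun_cong[OF TM.mderiv_cong] vT)
    show "eventually (\<lambda>v. dtr c d (fst v) (N c v u) = (\<Sum>b\<in>Basis. (dtr c d (fst v) u \<bullet> b) *\<^sub>R N d v b) +
        d2tr c d (fst v) u (snd v c)) (nhdsin TM.mtop v)"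
      using eventually_dom[OF c v] eventually_dom[OF d(1) v(1) d(2)]
    proof eventually_elim
      fix v assume v: "v \<in> A \<and> fst v \<in> fst c" "v \<in> A \<and> fst v \<in> fst d"
      have "N d v (dtr c d (fst v) u) = (\<Sum>b\<in>Basis. (dtr c d (fst v) u \<bullet> b) *\<^sub>R N d v b)"
        by (rule linear_expansion_Basis) (use lN v in blast)
      then show "dtr c d (fst v) (N c v u) = (\<Sum>b\<in>Basis. (dtr c d (fst v) u \<bullet> b) *\<^sub>R N d v b) +
          d2tr c d (fst v) u (snd v c)"
        using nl_dataD(3)[OF N c _ _ d(1), of v u] v by (simp add: algebra_simps)
    qed
  qed
  also have "\<dots> = mderiv (T c) (\<lambda>v. \<Sum>b\<in>Basis. (dtr c d (fst v) u \<bullet> b) *\<^sub>R N d v b) v (0, w) +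
      mderiv (T c) (\<lambda>v. d2tr c d (fst v) u (snd v c)) v (0, w)"
  proof (rule TM.mderiv_add[OF vT(1,2)])
    show "msmooth TA (\<lambda>v. d2tr c d (fst v) u (snd v c)) v"
      unfolding d2tr_def
    proof (rule TM.msmooth_cong)
      have e: "eventually (\<lambda>v. fst v \<in> fst c \<and> fst v \<in> fst d) (nhdsin TM.mtop v)"
        by (rule eventually_base[OF vT(3) ev])
      show "eventually (\<lambda>v. (\<Sum>b\<in>Basis. (snd v c \<bullet> b) *\<^sub>R d2tr c d (fst v) u b) =
          mderiv c (\<lambda>q. dtr c d q (snd v c)) (fst v) u) (nhdsin TM.mtop v)"
        using e unfolding d2tr_def[symmetric]
        by eventually_elim (rule linear_expansion_Basis[symmetric], use linear_d2tr(1)[OF c d(1)] in blast)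
      show "msmooth TA (\<lambda>v. \<Sum>b\<in>Basis. (snd v c \<bullet> b) *\<^sub>R d2tr c d (fst v) u b) v"
        by (intro TM.msmooth_sum vT TM.msmooth_scaleR TM.msmooth_linear[OF bounded_linear_inner_left sy]
            msmooth_base[OF s_d2 vT(3)])
    qed
    show "msmooth TA (\<lambda>v. \<Sum>b\<in>Basis. (dtr c d (fst v) u \<bullet> b) *\<^sub>R N d v b) v"
      by (intro TM.msmooth_sum vT TM.msmooth_scaleR db sNd)
  qed
  also have "mderiv (T c) (\<lambda>v. d2tr c d (fst v) u (snd v c)) v (0, w) = d2tr c d (fst v) u w"
    using mderiv_vertical[OF c v lin_d2 s_d2 sy, of w] mderiv_fibre[OF c vT(3) v(2), of "(0, w)"] by simp
  also have "mderiv (T c) (\<lambda>v. \<Sum>b\<in>Basis. (dtr c d (fst v) u \<bullet> b) *\<^sub>R N d v b) v (0, w) =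
      (\<Sum>b\<in>Basis. mderiv (T c) (\<lambda>v. (dtr c d (fst v) u \<bullet> b) *\<^sub>R N d v b) v (0, w))"
    by (intro fun_cong[OF mderivI] has_derivative_sum TM.mderiv_has_derivative vT TM.msmooth_scaleR db sNd)
  also have "\<dots> = (\<Sum>b\<in>Basis. (dtr c d (fst v) u \<bullet> b) *\<^sub>R vderiv N d v b (dtr c d (fst v) w))"
    by (simp add: TM.mderiv_scaleR[OF vT(1,2) db sNd] db0 nb)
  also have "\<dots> = vderiv N d v (dtr c d (fst v) u) (dtr c d (fst v) w)"
    by (rule linear_expansion_Basis[OF lin_u[OF d], symmetric])
  finally show "vderiv N d v (dtr c d (fst v) u) (dtr c d (fst v) w) + d2tr c d (fst v) u w =
      dtr c d (fst v) (vderiv N c v u w)" ..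
qed

lemma aniso_from_nl_vderiv:
  assumes H: "H \<in> nonlinear_connections \<A> A"
  shows "aniso_from_nl \<A> A H (conn_of_data (vderiv (Nl \<A> H)))"
proof -
  note G = aniso_data_vderiv[OF nl_data_Nl[OF H]]
  have "christoffel \<A> (conn_of_data (vderiv (Nl \<A> H))) c a i j v = partial_y \<A> c j (nl_comp \<A> H c i a) v"
    if c: "c \<in> \<A>" and v: "v \<in> A" "fst v \<in> fst c" for c v a i j
  proof -
    have "((\<lambda>z. Nl \<A> H c (chart_inv (T c) z) (axis i 1)) has_derivative
        mderiv (T c) (\<lambda>v. Nl \<A> H c v (axis i 1)) v) (at (snd (T c) v))"
      by (rule TM.mderiv_has_derivative[OF T_in[OF c] A_in_T[OF v] msmooth_Nl[OF H c v]])
    then have "((\<lambda>z. nl_comp \<A> H c i a (chart_inv (T c) z)) has_derivative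
        (\<lambda>z. mderiv (T c) (\<lambda>v. Nl \<A> H c v (axis i 1)) v z $ a)) (at (snd (T c) v))"
      unfolding Nl_axis[symmetric] by (rule bounded_linear.has_derivative[OF bounded_linear_vec_nth])
    then have "partial_y \<A> c j (nl_comp \<A> H c i a) v = mderiv (T c) (\<lambda>v. Nl \<A> H c v (axis i 1)) v (0, axis j 1) $ a"
      unfolding partial_y_def comp_def using frechet_derivative_at by metis
    then show ?thesis
      by (simp add: christoffel_conn_of_data[OF G c v] vderiv_def)
  qed
  then show ?thesis
    by (simp add: aniso_from_nl_def dom_in_iff conn_of_data_in[OF G])
qed

lemma aniso_from_nl_unique:
  "aniso_from_nl \<A> A H D \<Longrightarrow> aniso_from_nl \<A> A H D' \<Longrightarrow> D = D'"
  unfolding aniso_from_nl_def by (rule aniso_connections_eqI) (auto simp: dom_in_iff)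

lemma ex1_aniso_from_nl: "H \<in> nonlinear_connections \<A> A \<Longrightarrow> \<exists>!D. aniso_from_nl \<A> A H D"
  using aniso_from_nl_vderiv aniso_from_nl_unique by blast

lemma aniso_of_eq: "H \<in> nonlinear_connections \<A> A \<Longrightarrow> aniso_of \<A> A H = conn_of_data (vderiv (Nl \<A> H))"
  unfolding aniso_of_def by (rule the_equality) (auto intro: aniso_from_nl_vderiv aniso_from_nl_unique)

lemma aniso_from_nl_aniso_of:
  "H \<in> nonlinear_connections \<A> A \<Longrightarrow> aniso_from_nl \<A> A H (aniso_of \<A> A H)"
  using aniso_from_nl_vderiv aniso_of_eq by simp

lemma aniso_of_in: "H \<in> nonlinear_connections \<A> A \<Longrightarrow> aniso_of \<A> A H \<in> aniso_connections \<A> A"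
  using aniso_from_nl_aniso_of unfolding aniso_from_nl_def by blast

lemma Gam_aniso_of:
  assumes "H \<in> nonlinear_connections \<A> A" "c \<in> \<A>" "v \<in> A" "fst v \<in> fst c"
  shows "Gam \<A> (aniso_of \<A> A H) c v = vderiv (Nl \<A> H) c v"
  unfolding aniso_of_eq[OF assms(1)] by (rule Gam_conn_of_data[OF aniso_data_vderiv[OF nl_data_Nl] assms(2-)]) (rule assms)

text \<open>The chain rule for the dilation, which in the chart \<open>T c\<close> is the linear map
  \<open>m\<close>.\<close>

lemma mderiv_dilate:
  assumes c: "c \<in> \<A>" and v: "v \<in> A" "fst v \<in> fst c" and r: "r > 0" and F: "msmooth TA F (dilate r v)"
  shows "mderiv (T c) (\<lambda>v. F (dilate r v)) v (u, w) = mderiv (T c) F (dilate r v) (u, r *\<^sub>R w)"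
proof -
  have vT: "T c \<in> TA" "v \<in> fst (T c)" "v \<in> TM" "dilate r v \<in> fst (T c)"
    using c A_in_T[OF v] v A_TM A_in_T[OF dilate_A[OF v(1) r]] by auto
  define m where "m z = (fst z, r *\<^sub>R snd z)" for z :: "(real^'n) \<times> (real^'n)"
  have m: "m (snd (T c) v) = snd (T c) (dilate r v)" for v
    by (simp add: m_def snd_T_chart)
  have "mderiv (T c) (\<lambda>v. F (dilate r v)) v = mderiv (T c) (\<lambda>v. F (chart_inv (T c) (m (snd (T c) v)))) v"
  proof (rule TM.mderiv_cong[OF vT(1,2)])
    show "eventually (\<lambda>v. F (dilate r v) = F (chart_inv (T c) (m (snd (T c) v)))) (nhdsin TM.mtop v)"
      using eventually_dom[OF c v]
    proof eventually_elim
      fix v assume "v \<in> A \<and> fst v \<in> fst c"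
      then have "dilate r v \<in> fst (T c)"
        using A_in_T[OF dilate_A[OF _ r], of v c] by simp
      then show "F (dilate r v) = F (chart_inv (T c) (m (snd (T c) v)))"
        using TM.chart_inv_chart[OF vT(1)] by (simp only: m)
    qed
  qed
  also have "\<dots> = (\<lambda>z. mderiv (T c) F (dilate r v) (m z))"
  proof (rule mderivI)
    have D1: "((\<lambda>z. m (snd (T c) (chart_inv (T c) z))) has_derivative m) (at (snd (T c) v))"
      unfolding m_def
      by (intro has_derivative_Pair has_derivative_fst has_derivative_scaleR_right has_derivative_snd
          T_chart_has_derivative c v vT)
    have D2: "((\<lambda>z. F (chart_inv (T c) z)) has_derivative mderiv (T c) F (dilate r v))
        (at (m (snd (T c) (chart_inv (T c) (snd (T c) v)))))"
      unfolding TM.chart_inv_chart[OF vT(1,2)] m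
      by (rule TM.mderiv_has_derivative[OF vT(1,4) F])
    show "((\<lambda>z. F (chart_inv (T c) (m (snd (T c) (chart_inv (T c) z))))) has_derivative
        (\<lambda>z. mderiv (T c) F (dilate r v) (m z))) (at (snd (T c) v))"
      by (rule has_derivative_compose[OF D1 D2])
  qed
  finally show ?thesis
    by (simp add: m_def)
qed

text \<open>Both sides are derivatives at \<open>t = 1\<close> along the ray through
  \<open>v\<close>. The ray stays in \<open>A\<close> for positive \<open>t\<close> because
  \<open>A\<close> is conic, and \<open>F\<close> is linear along it.\<close>

lemma mderiv_Euler:
  assumes c: "c \<in> \<A>" and v: "v \<in> A" "fst v \<in> fst c" and F: "msmooth TA F v"
    and hom: "\<And>r. r > 0 \<Longrightarrow> F (dilate r v) = r *\<^sub>R F v"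
  shows "mderiv (T c) F v (0, snd v c) = F v"
proof -
  have vT: "T c \<in> TA" "v \<in> fst (T c)"
    using c A_in_T[OF v] by auto
  let ?l = "\<lambda>t. (snd c (fst v), t *\<^sub>R snd v c)"
  have "(?l has_derivative (\<lambda>h. (0, h *\<^sub>R snd v c))) (at 1)"
    by (intro has_derivative_Pair has_derivative_const has_derivative_scaleR_left has_derivative_ident)
  moreover have "((\<lambda>z. F (chart_inv (T c) z)) has_derivative mderiv (T c) F v) (at (?l 1))"
    using TM.mderiv_has_derivative[OF vT F] by (simp add: snd_T_chart)
  ultimately have D: "((\<lambda>t. F (chart_inv (T c) (?l t))) has_derivative
      (\<lambda>h. mderiv (T c) F v (0, h *\<^sub>R snd v c))) (at 1)"
    by (rule has_derivative_compose)
  have "((\<lambda>t. t *\<^sub>R F v) has_derivative (\<lambda>h. mderiv (T c) F v (0, h *\<^sub>R snd v c))) (at 1)"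
  proof (rule has_derivative_transform_within_open[OF D, of "{0<..}"])
    fix t :: real assume "t \<in> {0<..}"
    then have t: "t > 0" by simp
    have "?l t = snd (T c) (dilate t v)"
      by (simp add: snd_T_chart)
    moreover have "dilate t v \<in> fst (T c)"
      using A_in_T[OF dilate_A[OF v(1) t]] v(2) by simp
    ultimately have "chart_inv (T c) (?l t) = dilate t v"
      using TM.chart_inv_chart[OF vT(1)] by (simp only:)
    then show "F (chart_inv (T c) (?l t)) = t *\<^sub>R F v"
      by (simp only: hom[OF t])
  qed simp_all
  moreover have "((\<lambda>t. t *\<^sub>R F v) has_derivative (\<lambda>h. h *\<^sub>R F v)) (at 1)"
    by (intro has_derivative_scaleR_left has_derivative_ident)
  ultimately have "(\<lambda>h. mderiv (T c) F v (0, h *\<^sub>R snd v c)) = (\<lambda>h. h *\<^sub>R F v)"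
    by (rule has_derivative_unique)
  from fun_cong[OF this, of 1] show ?thesis
    by simp
qed

context
  fixes H assumes H: "H \<in> nonlinear_connections \<A> A" and hom: "homogeneous_nl \<A> A H"
begin

lemma Nl_homogeneous:
  "c \<in> \<A> \<Longrightarrow> v \<in> A \<Longrightarrow> fst v \<in> fst c \<Longrightarrow> r > 0 \<Longrightarrow> Nl \<A> H c (dilate r v) u = r *\<^sub>R Nl \<A> H c v u"
  using hom unfolding homogeneous_nl_iff[OF H] by blast

text \<open>Differentiating the homogeneity relation for \<open>N\<close> in a vertical direction
  produces a factor \<open>r\<close> on both sides: on the left from the inner derivative of the
  dilation, on the right from the degree of homogeneity.\<close>

lemma homogeneous_aniso_of: "homogeneous_aniso \<A> A (aniso_of \<A> A H)"
  unfolding homogeneous_aniso_iff[OF aniso_of_in[OF H]]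
proof (intro ballI impI allI ext)
  fix c v u w and r :: real assume c: "c \<in> \<A>" and v: "v \<in> A" "fst v \<in> fst c" and r: "r > 0"
  note rv = dilate_A[OF v(1) r]
  have rv2: "fst (dilate r v) \<in> fst c"
    using v by simp
  have "r *\<^sub>R vderiv (Nl \<A> H) c (dilate r v) u w = vderiv (Nl \<A> H) c (dilate r v) u (r *\<^sub>R w)"
    using bilinear_rmul[OF aniso_dataD(1)[OF aniso_data_vderiv[OF nl_data_Nl[OF H]] c rv rv2]] by simp
  also have "\<dots> = mderiv (T c) (\<lambda>v. Nl \<A> H c (dilate r v) u) v (0, w)"
    unfolding vderiv_def by (rule mderiv_dilate[OF c v r msmooth_Nl[OF H c rv rv2], symmetric])
  also have "\<dots> = mderiv (T c) (\<lambda>v. r *\<^sub>R Nl \<A> H c v u) v (0, w)"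
    using eventually_dom[OF c v] Nl_homogeneous[OF c _ _ r]
    by (intro fun_cong[OF TM.mderiv_cong[OF T_in[OF c] A_in_T[OF v]]]) (auto elim: eventually_mono)
  also have "\<dots> = r *\<^sub>R vderiv (Nl \<A> H) c v u w"
    using TM.mderiv_scaleR[OF T_in[OF c] A_in_T[OF v] TM.msmooth_const[OF A_points_T[OF v(1)]] msmooth_Nl[OF H c v]]
    by (simp add: vderiv_def)
  finally have "vderiv (Nl \<A> H) c (dilate r v) u w = vderiv (Nl \<A> H) c v u w"
    using r by simp
  then show "Gam \<A> (aniso_of \<A> A H) c (dilate r v) u w = Gam \<A> (aniso_of \<A> A H) c v u w"
    by (simp only: Gam_aniso_of[OF H c rv rv2] Gam_aniso_of[OF H c v])
qed

lemma Gam_aniso_of_self: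
  assumes "c \<in> \<A>" "v \<in> A" "fst v \<in> fst c"
  shows "Gam \<A> (aniso_of \<A> A H) c v u (snd v c) = Nl \<A> H c v u"
  unfolding Gam_aniso_of[OF H assms] vderiv_def
  by (rule mderiv_Euler[OF assms msmooth_Nl[OF H assms] Nl_homogeneous[OF assms]])

lemma nl_of_aniso_of: "nl_of \<A> A (aniso_of \<A> A H) = H"
  by (rule nl_of_eqI) (simp add: nl_from_aniso_iff H Gam_aniso_of_self)

end

end

section \<open>Tensors and affine connections\<close>

context conic_domain
begin

definition tensor_data :: "(('a, real^'n) chart \<Rightarrow> ('a, real^'n) tpoint \<Rightarrow> real^'n \<Rightarrow> real^'n \<Rightarrow> real^'n) \<Rightarrow> bool"
  where "tensor_data G \<longleftrightarrow> (\<forall>c\<in>\<A>. \<forall>v\<in>A. fst v \<in> fst c \<longrightarrow> bilinear (G c v) \<and>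
    (\<forall>u w. msmooth TA (\<lambda>v. G c v u w) v) \<and>
    (\<forall>d\<in>\<A>. fst v \<in> fst d \<longrightarrow> (\<forall>u w. G d v (dtr c d (fst v) u) (dtr c d (fst v) w) =
      dtr c d (fst v) (G c v u w))))"

lemma tensor_dataD:
  assumes "tensor_data G" "c \<in> \<A>" "v \<in> A" "fst v \<in> fst c"
  shows "bilinear (G c v)" and "msmooth TA (\<lambda>v. G c v u w) v"
    and "d \<in> \<A> \<Longrightarrow> fst v \<in> fst d \<Longrightarrow>
      G d v (dtr c d (fst v) u) (dtr c d (fst v) w) = dtr c d (fst v) (G c v u w)"
  using assms unfolding tensor_data_def by blast+

lemma aniso_data_add:
  assumes G: "aniso_data G" and Q: "tensor_data Q"
  shows "aniso_data (\<lambda>c v u w. G c v u w + Q c v u w)"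
  unfolding aniso_data_def
proof (intro ballI impI conjI allI)
  fix c v assume c: "c \<in> \<A>" and v: "v \<in> A" "fst v \<in> fst c"
  show "bilinear (\<lambda>u w. G c v u w + Q c v u w)"
    using aniso_dataD(1)[OF G c v] tensor_dataD(1)[OF Q c v]
    by (simp add: bilinear_def linear_compose_add)
  show "msmooth TA (\<lambda>v. G c v u w + Q c v u w) v" for u w
    by (rule TM.msmooth_add[OF aniso_dataD(2)[OF G c v] tensor_dataD(2)[OF Q c v]])
  fix d u w assume d: "d \<in> \<A>" "fst v \<in> fst d"
  show "G d v (dtr c d (fst v) u) (dtr c d (fst v) w) + Q d v (dtr c d (fst v) u) (dtr c d (fst v) w) +
      d2tr c d (fst v) u w = dtr c d (fst v) (G c v u w + Q c v u w)"
    using aniso_dataD(3)[OF G c v d] tensor_dataD(3)[OF Q c v d]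
    by (simp add: linear_add[OF linear_dtr[OF c d(1) v(2) d(2)]])
qed

text \<open>The inhomogeneous term is the same for all connections and cancels in the
  difference.\<close>

lemma tensor_data_diff:
  assumes G: "aniso_data G" and G': "aniso_data G'"
  shows "tensor_data (\<lambda>c v u w. G c v u w - G' c v u w)"
  unfolding tensor_data_def
proof (intro ballI impI conjI allI)
  fix c v assume c: "c \<in> \<A>" and v: "v \<in> A" "fst v \<in> fst c"
  show "bilinear (\<lambda>u w. G c v u w - G' c v u w)"
    using aniso_dataD(1)[OF G c v] aniso_dataD(1)[OF G' c v]
    by (simp add: bilinear_def linear_compose_sub)
  show "msmooth TA (\<lambda>v. G c v u w - G' c v u w) v" for u w
    by (rule TM.msmooth_diff[OF aniso_dataD(2)[OF G c v] aniso_dataD(2)[OF G' c v]])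
  fix d u w assume d: "d \<in> \<A>" "fst v \<in> fst d"
  show "G d v (dtr c d (fst v) u) (dtr c d (fst v) w) - G' d v (dtr c d (fst v) u) (dtr c d (fst v) w) =
      dtr c d (fst v) (G c v u w - G' c v u w)"
    using aniso_dataD(3)[OF G c v d] aniso_dataD(3)[OF G' c v d]
    by (simp add: linear_diff[OF linear_dtr[OF c d(1) v(2) d(2)]])
qed

definition data_of_tensor :: "(('a, real^'n) tpoint \<Rightarrow> ('a, real^'n) tvec \<Rightarrow> ('a, real^'n) tvec \<Rightarrow> ('a, real^'n) tvec) \<Rightarrow>
    ('a, real^'n) chart \<Rightarrow> ('a, real^'n) tpoint \<Rightarrow> real^'n \<Rightarrow> real^'n \<Rightarrow> real^'n"
  where "data_of_tensor Q c v u w = Q v (tvec_of \<A> c (fst v) u) (tvec_of \<A> c (fst v) w) c"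

lemma data_of_tensor_axis: "data_of_tensor Q c v (axis i 1) (axis j 1) $ k = tensor_comp \<A> Q c i j k v"
  by (simp add: data_of_tensor_def tensor_comp_def coord_field_def)

lemma tvec_of_linear:
  assumes "c \<in> \<A>" "p \<in> fst c"
  shows "tvec_of \<A> c p (r *\<^sub>R u + s *\<^sub>R u') = r *\<^sub>R tvec_of \<A> c p u + s *\<^sub>R tvec_of \<A> c p u'"
  by (rule tangent_eqI[OF _ _ assms]) (simp_all add: tvec_of_in assms tangent_add tangent_scale)

lemma tensor_data_of_tensor:
  assumes Q: "Q \<in> aniso_tensors_1_2 \<A> A"
  shows "tensor_data (data_of_tensor Q)"
  unfolding tensor_data_def
proof (intro ballI impI conjI allI)
  have QT: "Q v w u \<in> tangent_space \<A> (fst v)"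
    and Q1: "w' \<in> tangent_space \<A> (fst v) \<Longrightarrow> Q v (r *\<^sub>R w + s *\<^sub>R w') u = r *\<^sub>R Q v w u + s *\<^sub>R Q v w' u"
    and Q2: "u' \<in> tangent_space \<A> (fst v) \<Longrightarrow> Q v w (r *\<^sub>R u + s *\<^sub>R u') = r *\<^sub>R Q v w u + s *\<^sub>R Q v w u'"
    if "v \<in> A" "w \<in> tangent_space \<A> (fst v)" "u \<in> tangent_space \<A> (fst v)" for v w u w' u' r s
    using Q that unfolding aniso_tensors_1_2_def Let_def by blast+
  have Qs: "smooth_in_chart \<A> A c (tensor_comp \<A> Q c i j k)" if "c \<in> \<A>" for c i j k
    using Q that unfolding aniso_tensors_1_2_def by blast
  have bil: "bilinear (data_of_tensor Q c v)" if c: "c \<in> \<A>" and v: "v \<in> A" "fst v \<in> fst c" for c v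
  proof -
    have 1: "data_of_tensor Q c v (r *\<^sub>R u + s *\<^sub>R u') w = r *\<^sub>R data_of_tensor Q c v u w + s *\<^sub>R data_of_tensor Q c v u' w"
      for r s u u' w
      unfolding data_of_tensor_def tvec_of_linear[OF c v(2)]
      using Q1[OF v(1) tvec_of_in[OF c v(2)] tvec_of_in[OF c v(2)] tvec_of_in[OF c v(2)]] by simp
    have 2: "data_of_tensor Q c v u (r *\<^sub>R w + s *\<^sub>R w') = r *\<^sub>R data_of_tensor Q c v u w + s *\<^sub>R data_of_tensor Q c v u w'"
      for r s u w w'
      unfolding data_of_tensor_def tvec_of_linear[OF c v(2)]
      using Q2[OF v(1) tvec_of_in[OF c v(2)] tvec_of_in[OF c v(2)] tvec_of_in[OF c v(2)]] by simp
    show ?thesis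
      unfolding bilinear_def
    proof (intro conjI allI linearI)
      show "data_of_tensor Q c v u (w + w') = data_of_tensor Q c v u w + data_of_tensor Q c v u w'" for u w w'
        using 2[of u 1 w 1 w'] by simp
      show "data_of_tensor Q c v u (r *\<^sub>R w) = r *\<^sub>R data_of_tensor Q c v u w" for u r w
        using 2[of u r w 0 w] by simp
      show "data_of_tensor Q c v (u + u') w = data_of_tensor Q c v u w + data_of_tensor Q c v u' w" for u u' w
        using 1[of 1 u 1 u' w] by simp
      show "data_of_tensor Q c v (r *\<^sub>R u) w = r *\<^sub>R data_of_tensor Q c v u w" for r u w
        using 1[of r u 0 u w] by simp
    qed
  qed
  fix c v assume c: "c \<in> \<A>" and v: "v \<in> A" "fst v \<in> fst c"
  show "bilinear (data_of_tensor Q c v)"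
    by (rule bil[OF c v])
  show "msmooth TA (\<lambda>v. data_of_tensor Q c v u w) v" for u w
  proof (rule TM.msmooth_cong)
    show "eventually (\<lambda>v. (\<Sum>i\<in>UNIV. \<Sum>j\<in>UNIV. (u $ i * w $ j) *\<^sub>R data_of_tensor Q c v (axis i 1) (axis j 1)) =
        data_of_tensor Q c v u w) (nhdsin TM.mtop v)"
      using eventually_dom[OF c v]
      by eventually_elim (rule bilinear_expansion_axis[symmetric], use bil[OF c] in blast)
    have "msmooth TA (\<lambda>v. data_of_tensor Q c v (axis i 1) (axis j 1)) v" for i j
      unfolding TM.msmooth_vec_iff data_of_tensor_axis
      using Qs[OF c] v unfolding smooth_in_chart_iff[OF c] by blast
    then show "msmooth TA (\<lambda>v. \<Sum>i\<in>UNIV. \<Sum>j\<in>UNIV. (u $ i * w $ j) *\<^sub>R data_of_tensor Q c v (axis i 1) (axis j 1)) v"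
      by (intro TM.msmooth_sum TM.msmooth_scaleR TM.msmooth_const A_points_T v)
  qed
  fix d u w assume d: "d \<in> \<A>" "fst v \<in> fst d"
  have tv: "tvec_of \<A> d (fst v) (dtr c d (fst v) u) = tvec_of \<A> c (fst v) u" for u
    by (rule tangent_eqI[OF _ _ d]) (simp_all add: tvec_of_in c d v tvec_of_apply)
  show "data_of_tensor Q d v (dtr c d (fst v) u) (dtr c d (fst v) w) = dtr c d (fst v) (data_of_tensor Q c v u w)"
    unfolding data_of_tensor_def tv
    by (rule tangent_coord[OF QT[OF v(1) tvec_of_in[OF c v(2)] tvec_of_in[OF c v(2)]] c d(1) v(2) d(2)])
qed

text \<open>As for connections, the value is computed in an arbitrary chart;
  \<open>tensor_of_data_apply\<close> shows that the chart does not matter. The default value zero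
  is the convention of \<open>aniso_tensors_1_2\<close>.\<close>

definition tensor_of_data :: "(('a, real^'n) chart \<Rightarrow> ('a, real^'n) tpoint \<Rightarrow> real^'n \<Rightarrow> real^'n \<Rightarrow> real^'n) \<Rightarrow>
    ('a, real^'n) tpoint \<Rightarrow> ('a, real^'n) tvec \<Rightarrow> ('a, real^'n) tvec \<Rightarrow> ('a, real^'n) tvec"
  where "tensor_of_data G v w u =
    (if v \<in> A \<and> w \<in> tangent_space \<A> (fst v) \<and> u \<in> tangent_space \<A> (fst v)
     then let c = some_chart \<A> (fst v) in tvec_of \<A> c (fst v) (G c v (w c) (u c)) else 0)"

section \<open>The anisotropic tensor with prescribed components\<close>

context
  fixes G assumes G: "tensor_data G"
begin

lemma tensor_of_data_apply:
  assumes v: "v \<in> A" and wu: "w \<in> tangent_space \<A> (fst v)" "u \<in> tangent_space \<A> (fst v)"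
    and d: "d \<in> \<A>" "fst v \<in> fst d"
  shows "tensor_of_data G v w u d = G d v (w d) (u d)"
proof -
  define c where "c = some_chart \<A> (fst v)"
  have c: "c \<in> \<A>" "fst v \<in> fst c"
    using some_chart[OF A_points[OF v]] by (simp_all add: c_def)
  have "tensor_of_data G v w u d = dtr c d (fst v) (G c v (w c) (u c))"
    using v wu d by (simp add: tensor_of_data_def Let_def tvec_of_apply flip: c_def)
  then show ?thesis
    unfolding tensor_dataD(3)[OF G c(1) v c(2) d, symmetric]
    by (simp only: tangent_coord[OF wu(1) c(1) d(1) c(2) d(2)] tangent_coord[OF wu(2) c(1) d(1) c(2) d(2)])
qed

lemma tensor_comp_tensor_of_data:
  assumes "c \<in> \<A>" "v \<in> A" "fst v \<in> fst c"
  shows "tensor_comp \<A> (tensor_of_data G) c i j k v = G c v (axis i 1) (axis j 1) $ k"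
  using tensor_of_data_apply[OF assms(2) tvec_of_in tvec_of_in assms(1,3), of c c "axis i 1" "axis j 1"] assms
  by (simp add: tensor_comp_def coord_field_def)

lemma tensor_of_data_in: "tensor_of_data G \<in> aniso_tensors_1_2 \<A> A"
  unfolding aniso_tensors_1_2_def Let_def
proof (intro CollectI conjI ballI allI impI)
  have T: "tensor_of_data G v w u \<in> tangent_space \<A> (fst v)" if "v \<in> A" for v w u
    using that some_chart[OF A_points[OF that]] by (simp add: tensor_of_data_def Let_def tvec_of_in tangent_0)
  then show "tensor_of_data G v w u \<in> tangent_space \<A> (fst v)" if "v \<in> A" for v w u
    using that .
  fix v assume v: "v \<in> A"
  obtain c where c: "c \<in> \<A>" "fst v \<in> fst c"
    using v by (rule A_chartE)
  note bil = tensor_dataD(1)[OF G c(1) v c(2)]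
  note app = tensor_of_data_apply[OF v _ _ c]
  fix w u assume wu: "w \<in> tangent_space \<A> (fst v)" "u \<in> tangent_space \<A> (fst v)"
  show "tensor_of_data G v (r *\<^sub>R w + s *\<^sub>R w') u = r *\<^sub>R tensor_of_data G v w u + s *\<^sub>R tensor_of_data G v w' u"
    if w': "w' \<in> tangent_space \<A> (fst v)" for w' r s
  proof (rule tangent_eqI[OF _ _ c])
    have "r *\<^sub>R w + s *\<^sub>R w' \<in> tangent_space \<A> (fst v)"
      by (intro tangent_add tangent_scale wu w')
    then show "tensor_of_data G v (r *\<^sub>R w + s *\<^sub>R w') u c =
        (r *\<^sub>R tensor_of_data G v w u + s *\<^sub>R tensor_of_data G v w' u) c"
      by (simp add: app wu w' bilinear_ladd[OF bil] bilinear_lmul[OF bil])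
  qed (intro tangent_add tangent_scale T v)+
  show "tensor_of_data G v w (r *\<^sub>R u + s *\<^sub>R u') = r *\<^sub>R tensor_of_data G v w u + s *\<^sub>R tensor_of_data G v w u'"
    if u': "u' \<in> tangent_space \<A> (fst v)" for u' r s
  proof (rule tangent_eqI[OF _ _ c])
    have "r *\<^sub>R u + s *\<^sub>R u' \<in> tangent_space \<A> (fst v)"
      by (intro tangent_add tangent_scale wu u')
    then show "tensor_of_data G v w (r *\<^sub>R u + s *\<^sub>R u') c =
        (r *\<^sub>R tensor_of_data G v w u + s *\<^sub>R tensor_of_data G v w u') c"
      by (simp add: app wu u' bilinear_radd[OF bil] bilinear_rmul[OF bil])
  qed (intro tangent_add tangent_scale T v)+
next
  fix v w u assume "\<not> (v \<in> A \<and> w \<in> tangent_space \<A> (fst v) \<and> u \<in> tangent_space \<A> (fst v))"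
  then show "tensor_of_data G v w u = 0"
    by (simp only: tensor_of_data_def if_False)
next
  fix c i j k assume c: "c \<in> \<A>"
  show "smooth_in_chart \<A> A c (tensor_comp \<A> (tensor_of_data G) c i j k)"
    unfolding smooth_in_chart_iff[OF c]
  proof (intro ballI impI)
    fix v assume v: "v \<in> A" "fst v \<in> fst c"
    have "eventually (\<lambda>v. G c v (axis i 1) (axis j 1) $ k = tensor_comp \<A> (tensor_of_data G) c i j k v)
        (nhdsin TM.mtop v)"
      using eventually_dom[OF c v] by eventually_elim (simp add: tensor_comp_tensor_of_data c)
    then show "msmooth TA (tensor_comp \<A> (tensor_of_data G) c i j k) v"
      by (rule TM.msmooth_cong)
        (rule TM.msmooth_linear[OF bounded_linear_vec_nth tensor_dataD(2)[OF G c v]])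
  qed
qed

end

lemma add_tensor_eqI:
  assumes D': "D' \<in> aniso_connections \<A> A"
    and eq: "\<And>c v i j k. c \<in> \<A> \<Longrightarrow> v \<in> A \<Longrightarrow> fst v \<in> fst c \<Longrightarrow>
      christoffel \<A> D' c k i j v = christoffel \<A> D c k i j v + tensor_comp \<A> Q c i j k v"
  shows "add_tensor \<A> A D Q = D'"
  unfolding add_tensor_def
proof (rule the_equality)
  show "D' \<in> aniso_connections \<A> A \<and> (\<forall>c\<in>\<A>. \<forall>v\<in>dom_in \<A> A c. \<forall>i j k.
      christoffel \<A> D' c k i j v = christoffel \<A> D c k i j v + tensor_comp \<A> Q c i j k v)"
    using D' eq by (simp add: dom_in_iff)
  fix D'' assume *: "D'' \<in> aniso_connections \<A> A \<and> (\<forall>c\<in>\<A>. \<forall>v\<in>dom_in \<A> A c. \<forall>i j k.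
      christoffel \<A> D'' c k i j v = christoffel \<A> D c k i j v + tensor_comp \<A> Q c i j k v)"
  show "D'' = D'"
  proof (rule aniso_connections_eqI[OF conjunct1[OF *] D'])
    fix c v a i j assume cv: "c \<in> \<A>" "v \<in> A" "fst v \<in> fst c"
    then have "v \<in> dom_in \<A> A c"
      by (simp add: dom_in_iff)
    then show "christoffel \<A> D'' c a i j v = christoffel \<A> D' c a i j v"
      using conjunct2[OF *] eq[OF cv] cv(1) by simp
  qed
qed

text \<open>Translates the condition on components into the statement that the bilinear map vanishes
  when \<open>y\<close> is its second argument; by linearity the first argument may be restricted to
  the standard basis.\<close>

lemma tensor_contraction:
  assumes "bilinear (data_of_tensor Q c v)"
  shows "(\<forall>i k. (\<Sum>j\<in>UNIV. tensor_comp \<A> Q c i j k v * y $ j) = 0) \<longleftrightarrow> (\<forall>u. data_of_tensor Q c v u y = 0)"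
proof -
  have l: "linear (\<lambda>u. data_of_tensor Q c v u y)" "linear (data_of_tensor Q c v u)" for u
    using assms by (simp_all add: bilinear_def)
  have *: "data_of_tensor Q c v (axis i 1) y $ k = (\<Sum>j\<in>UNIV. tensor_comp \<A> Q c i j k v * y $ j)" for i k
    using linear_expansion_axis[OF l(2), of "axis i 1" y]
    by (simp add: mult.commute flip: data_of_tensor_axis)
  have "(\<forall>i. data_of_tensor Q c v (axis i 1) y = 0) \<longleftrightarrow> (\<forall>u. data_of_tensor Q c v u y = 0)"
  proof
    assume 0: "\<forall>i. data_of_tensor Q c v (axis i 1) y = 0"
    show "\<forall>u. data_of_tensor Q c v u y = 0"
    proof
      fix u
      show "data_of_tensor Q c v u y = 0"
        using linear_expansion_axis[OF l(1), of u] 0 by simp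
    qed
  qed blast
  then show ?thesis
    by (simp add: vec_eq_iff flip: *)
qed

text \<open>Homogeneity of \<open>H\<close> enters through \<open>Gam_aniso_of_self\<close>: it
  makes \<open>aniso_of\<close> of \<open>H\<close> itself a preimage of \<open>H\<close>, with
  which all others are compared.\<close>

lemma nl_of_fibre:
  assumes H: "H \<in> nonlinear_connections \<A> A" and hom: "homogeneous_nl \<A> A H"
  shows "{D \<in> aniso_connections \<A> A. nl_of \<A> A D = H} =
    {add_tensor \<A> A (aniso_of \<A> A H) Q |Q. Q \<in> aniso_tensors_1_2 \<A> A \<and>
       (\<forall>c\<in>\<A>. \<forall>v\<in>dom_in \<A> A c. \<forall>i k. (\<Sum>j\<in>UNIV. tensor_comp \<A> Q c i j k v * snd v c $ j) = 0)}"
proof (intro equalityI subsetI)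
  let ?D0 = "aniso_of \<A> A H"
  note D0 = aniso_of_in[OF H]
  fix D assume "D \<in> {D \<in> aniso_connections \<A> A. nl_of \<A> A D = H}"
  then have D: "D \<in> aniso_connections \<A> A" "nl_of \<A> A D = H"
    by auto
  define G where "G = (\<lambda>c v u w. Gam \<A> D c v u w - Gam \<A> ?D0 c v u w)"
  have G: "tensor_data G"
    unfolding G_def by (intro tensor_data_diff aniso_data_Gam D D0)
  define Q where "Q = tensor_of_data G"
  have Q: "Q \<in> aniso_tensors_1_2 \<A> A"
    unfolding Q_def by (rule tensor_of_data_in[OF G])
  have comp: "tensor_comp \<A> Q c i j k v = christoffel \<A> D c k i j v - christoffel \<A> ?D0 c k i j v"
    if "c \<in> \<A>" "v \<in> A" "fst v \<in> fst c" for c i j k v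
    unfolding Q_def tensor_comp_tensor_of_data[OF G that] by (simp add: G_def)
  have "add_tensor \<A> A ?D0 Q = D"
    by (rule add_tensor_eqI[OF D(1)]) (simp add: comp)
  moreover have "(\<Sum>j\<in>UNIV. tensor_comp \<A> Q c i j k v * snd v c $ j) = 0"
    if "c \<in> \<A>" "v \<in> dom_in \<A> A c" for c v i k
  proof -
    have v: "v \<in> A" "fst v \<in> fst c"
      using that by (simp_all add: dom_in_iff)
    have "Gam \<A> D c v (axis i 1) (snd v c) = Gam \<A> ?D0 c v (axis i 1) (snd v c)"
      using Nl_nl_of[OF D(1) that(1) v] Gam_aniso_of_self[OF H hom that(1) v] by (simp add: D(2))
    then show ?thesis
      using Gam_comp[of \<A> D c v i "snd v c" k] Gam_comp[of \<A> ?D0 c v i "snd v c" k]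
      by (simp add: comp[OF that(1) v] left_diff_distrib sum_subtractf)
  qed
  ultimately show "D \<in> {add_tensor \<A> A ?D0 Q |Q. Q \<in> aniso_tensors_1_2 \<A> A \<and>
       (\<forall>c\<in>\<A>. \<forall>v\<in>dom_in \<A> A c. \<forall>i k. (\<Sum>j\<in>UNIV. tensor_comp \<A> Q c i j k v * snd v c $ j) = 0)}"
    using Q by blast
next
  let ?D0 = "aniso_of \<A> A H"
  note D0 = aniso_of_in[OF H]
  fix D assume "D \<in> {add_tensor \<A> A ?D0 Q |Q. Q \<in> aniso_tensors_1_2 \<A> A \<and>
       (\<forall>c\<in>\<A>. \<forall>v\<in>dom_in \<A> A c. \<forall>i k. (\<Sum>j\<in>UNIV. tensor_comp \<A> Q c i j k v * snd v c $ j) = 0)}"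
  then obtain Q where DQ: "D = add_tensor \<A> A ?D0 Q" and Q: "Q \<in> aniso_tensors_1_2 \<A> A"
    and Qy: "\<forall>c\<in>\<A>. \<forall>v\<in>dom_in \<A> A c. \<forall>i k. (\<Sum>j\<in>UNIV. tensor_comp \<A> Q c i j k v * snd v c $ j) = 0"
    by blast
  note tQ = tensor_data_of_tensor[OF Q]
  have G: "aniso_data (\<lambda>c v u w. Gam \<A> ?D0 c v u w + data_of_tensor Q c v u w)"
    by (intro aniso_data_add aniso_data_Gam D0 tQ)
  \<comment> \<open>Realises the definite description \<open>add_tensor\<close> by the connection
    whose coordinate data are the sum.\<close>
  define D' where "D' = conn_of_data (\<lambda>c v u w. Gam \<A> ?D0 c v u w + data_of_tensor Q c v u w)"
  have D': "D' \<in> aniso_connections \<A> A"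
    unfolding D'_def by (rule conn_of_data_in[OF G])
  have "D = D'"
    unfolding DQ
    by (rule add_tensor_eqI[OF D']) (simp add: D'_def christoffel_conn_of_data[OF G] data_of_tensor_axis)
  moreover have "nl_of \<A> A D' = H"
  proof (rule nl_of_eqI)
    have "Nl \<A> H c v u = Gam \<A> D' c v u (snd v c)" if cv: "c \<in> \<A>" "v \<in> A" "fst v \<in> fst c" for c v u
    proof -
      have "\<forall>i k. (\<Sum>j\<in>UNIV. tensor_comp \<A> Q c i j k v * snd v c $ j) = 0"
        using Qy cv dom_in_iff by blast
      then have "data_of_tensor Q c v u (snd v c) = 0"
        using tensor_contraction[OF tensor_dataD(1)[OF tQ cv]] by blast
      then show ?thesis
        by (simp add: D'_def Gam_conn_of_data[OF G cv] Gam_aniso_of_self[OF H hom cv])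
    qed
    then show "nl_from_aniso \<A> A D' H"
      unfolding nl_from_aniso_iff using H by blast
  qed
  ultimately show "D \<in> {D \<in> aniso_connections \<A> A. nl_of \<A> A D = H}"
    using D' by simp
qed

subsection \<open>Affine connections\<close>

text \<open>An arbitrary section of \<open>A\<close> over the manifold, in general not continuous.
  It serves to evaluate expressions that are constant on the fibres of \<open>A\<close>.\<close>

definition over :: "'a \<Rightarrow> ('a, real^'n) tpoint" where
  "over p = (SOME v. v \<in> A \<and> fst v = p)"

lemma over: "p \<in> points \<A> \<Longrightarrow> over p \<in> A \<and> fst (over p) = p"
proof -
  assume "p \<in> points \<A>"
  then have "p \<in> fst ` A"
    by (simp only: base_A)
  then show ?thesis
    unfolding over_def by (intro someI_ex[of "\<lambda>v. v \<in> A \<and> fst v = p"]) blast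
qed

section \<open>A given affine connection viewed as an anisotropic one\<close>

context
  fixes D :: "('a \<Rightarrow> ('a, real^'n) tvec) \<Rightarrow> ('a \<Rightarrow> ('a, real^'n) tvec) \<Rightarrow> 'a \<Rightarrow> ('a, real^'n) tvec"
  assumes D: "D \<in> affine_connections \<A>"
begin

lemma affine_PiE: "D \<in> vector_fields \<A> \<rightarrow>\<^sub>E vector_fields \<A> \<rightarrow>\<^sub>E vector_fields \<A>"
  using D unfolding affine_connections_def mem_Collect_eq by (rule conjunct1)

lemma affine_field:
  "X \<in> vector_fields \<A> \<Longrightarrow> Y \<in> vector_fields \<A> \<Longrightarrow> D X Y \<in> vector_fields \<A>"
  using affine_PiE by blast

lemma as_aniso_apply:
  "X \<in> vector_fields \<A> \<Longrightarrow> Y \<in> vector_fields \<A> \<Longrightarrow>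
    as_aniso \<A> A D X Y v = (if v \<in> A then D X Y (fst v) else 0)"
  by (simp add: as_aniso_def)

lemma as_aniso_field:
  assumes "X \<in> vector_fields \<A>" "Y \<in> vector_fields \<A>"
  shows "as_aniso \<A> A D X Y \<in> aniso_fields \<A> A"
  unfolding aniso_fields_iff
proof (intro conjI ballI allI impI)
  fix v assume "v \<in> A"
  then show "as_aniso \<A> A D X Y v \<in> tangent_space \<A> (fst v)"
    by (simp add: as_aniso_apply assms vector_fields_tangent[OF affine_field[OF assms]])
next
  fix v assume "v \<notin> A"
  then show "as_aniso \<A> A D X Y v = 0"
    unfolding as_aniso_apply[OF assms] by simp
next
  fix c v assume c: "c \<in> \<A>" and v: "v \<in> A" "fst v \<in> fst c"
  have "eventually (\<lambda>v. D X Y (fst v) c = as_aniso \<A> A D X Y v c) (nhdsin TM.mtop v)"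
    using eventually_A[OF v(1)] by eventually_elim (simp add: as_aniso_apply assms)
  moreover have "msmooth TA (\<lambda>v. D X Y (fst v) c) v"
    using A_TM v by (intro msmooth_base[OF vector_fields_msmooth[OF affine_field[OF assms] c v(2)]]) blast
  ultimately show "msmooth TA (\<lambda>v. as_aniso \<A> A D X Y v c) v"
    by (rule TM.msmooth_cong)
qed

lemma as_aniso_in: "as_aniso \<A> A D \<in> aniso_connections \<A> A"
  unfolding aniso_connections_def
proof (intro CollectI conjI ballI allI impI)
  have "as_aniso \<A> A D X \<in> extensional (vector_fields \<A>)" if "X \<in> vector_fields \<A>" for X
    using that by (simp add: as_aniso_def)
  then show "as_aniso \<A> A D \<in> vector_fields \<A> \<rightarrow>\<^sub>E vector_fields \<A> \<rightarrow>\<^sub>E aniso_fields \<A> A"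
    using as_aniso_field by (intro PiE_I) (auto simp: as_aniso_def)
next
  fix X Y Z assume XYZ: "X \<in> vector_fields \<A>" "Y \<in> vector_fields \<A>" "Z \<in> vector_fields \<A>"
  have "D (X + Y) Z = D X Z + D Y Z" "D X (Y + Z) = D X Y + D X Z"
    using D XYZ unfolding affine_connections_def by blast+
  then show "as_aniso \<A> A D (X + Y) Z = as_aniso \<A> A D X Z + as_aniso \<A> A D Y Z"
    "as_aniso \<A> A D X (Y + Z) = as_aniso \<A> A D X Y + as_aniso \<A> A D X Z"
    by (intro ext; simp only: plus_fun_apply as_aniso_apply vector_fields_add XYZ split: if_split; simp)+
next
  fix X Y f v assume XY: "X \<in> vector_fields \<A>" "Y \<in> vector_fields \<A>" and f: "smooth_fun \<A> f" and v: "v \<in> A"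
  have "D X (\<lambda>p. f p *\<^sub>R Y p) (fst v) =
      dir_deriv \<A> (fst v) (X (fst v)) f *\<^sub>R Y (fst v) + f (fst v) *\<^sub>R D X Y (fst v)"
    using D XY f A_points[OF v] unfolding affine_connections_def by blast
  then show "as_aniso \<A> A D X (\<lambda>p. f p *\<^sub>R Y p) v =
      dir_deriv \<A> (fst v) (X (fst v)) f *\<^sub>R Y (fst v) + f (fst v) *\<^sub>R as_aniso \<A> A D X Y v"
    by (simp only: as_aniso_apply vector_fields_scale XY f v if_True)
next
  fix X Y Z f h v
  assume XYZ: "X \<in> vector_fields \<A>" "Y \<in> vector_fields \<A>" "Z \<in> vector_fields \<A>"
    and fh: "smooth_fun \<A> f \<and> smooth_fun \<A> h" and v: "v \<in> A"
  have W: "(\<lambda>p. f p *\<^sub>R X p + h p *\<^sub>R Y p) \<in> vector_fields \<A>"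
    using vector_fields_add[OF vector_fields_scale vector_fields_scale, of X f Y h] XYZ fh
    by (simp add: plus_fun_def)
  have "D (\<lambda>p. f p *\<^sub>R X p + h p *\<^sub>R Y p) Z (fst v) =
      f (fst v) *\<^sub>R D X Z (fst v) + h (fst v) *\<^sub>R D Y Z (fst v)"
    using D XYZ fh A_points[OF v] unfolding affine_connections_def by blast
  then show "as_aniso \<A> A D (\<lambda>p. f p *\<^sub>R X p + h p *\<^sub>R Y p) Z v =
      f (fst v) *\<^sub>R as_aniso \<A> A D X Z v + h (fst v) *\<^sub>R as_aniso \<A> A D Y Z v"
    by (simp only: as_aniso_apply W XYZ v if_True)
qed

text \<open>Both parts come from the fact that the Christoffel symbol is a component of
  \<open>D (E i) (E j)\<close> at the base point. This expression does not involve
  \<open>over\<close>, hence it is smooth although \<open>over\<close> need not be.\<close>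

lemma christoffel_as_aniso:
  assumes c: "c \<in> \<A>" and p: "p \<in> fst c"
  shows "v \<in> A \<Longrightarrow> fst v = p \<Longrightarrow>
      christoffel \<A> (as_aniso \<A> A D) c a i j v = christoffel \<A> (as_aniso \<A> A D) c a i j (over p)"
    and "msmooth \<A> (\<lambda>p. christoffel \<A> (as_aniso \<A> A D) c a i j (over p)) p"
proof -
  obtain E where E: "\<And>i. E i \<in> vector_fields \<A>"
    "\<And>i. eventually (\<lambda>q. E i q = coord_field \<A> c i q) (nhdsin mtop p)"
    using ex_coord_field[OF c p] by blast
  have *: "christoffel \<A> (as_aniso \<A> A D) c a i j v = D (E i) (E j) (fst v) c $ a"
    if "v \<in> A" "fst v \<in> fst c" "eventually (\<lambda>q. E i q = coord_field \<A> c i q) (nhdsin mtop (fst v))"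
      "eventually (\<lambda>q. E j q = coord_field \<A> c j q) (nhdsin mtop (fst v))" for v i j a
    using christoffel_eq[OF as_aniso_in c that(1,2) E(1) that(3) E(1) that(4)]
    by (simp add: as_aniso_apply E that(1))
  have o: "over p \<in> A" "fst (over p) = p"
    using over[OF chart_in_points[OF c p]] by auto
  show "christoffel \<A> (as_aniso \<A> A D) c a i j v = christoffel \<A> (as_aniso \<A> A D) c a i j (over p)"
    if "v \<in> A" "fst v = p"
    using *[of v i j a] *[of "over p" i j a] that o E(2) p by simp
  have "eventually (\<lambda>q. D (E i) (E j) q c $ a = christoffel \<A> (as_aniso \<A> A D) c a i j (over q)) (nhdsin mtop p)"
    using eventually_in_domain[OF c p] eventually_eventually_nhdsin[OF E(2)[of i]]
      eventually_eventually_nhdsin[OF E(2)[of j]]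
  proof eventually_elim
    fix q assume q: "q \<in> fst c" "eventually (\<lambda>q. E i q = coord_field \<A> c i q) (nhdsin mtop q)"
      "eventually (\<lambda>q. E j q = coord_field \<A> c j q) (nhdsin mtop q)"
    show "D (E i) (E j) q c $ a = christoffel \<A> (as_aniso \<A> A D) c a i j (over q)"
      using *[of "over q" i j a] over[OF chart_in_points[OF c q(1)]] q by simp
  qed
  moreover have "msmooth \<A> (\<lambda>q. D (E i) (E j) q c $ a) p"
    by (rule msmooth_linear[OF bounded_linear_vec_nth vector_fields_msmooth[OF affine_field[OF E(1,1)] c p]])
  ultimately show "msmooth \<A> (\<lambda>p. christoffel \<A> (as_aniso \<A> A D) c a i j (over p)) p"
    by (rule msmooth_cong)
qed

lemma nl_comp_as_aniso:
  assumes "c \<in> \<A>" "v \<in> A" "fst v \<in> fst c"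
  shows "nl_comp \<A> (nl_of \<A> A (as_aniso \<A> A D)) c i a v =
    (\<Sum>j\<in>UNIV. christoffel \<A> (as_aniso \<A> A D) c a i j (over (fst v)) * snd v c $ j)"
proof -
  have "v \<in> dom_in \<A> A c"
    using assms by (simp add: dom_in_iff)
  then have "nl_comp \<A> (nl_of \<A> A (as_aniso \<A> A D)) c i a v =
      (\<Sum>j\<in>UNIV. christoffel \<A> (as_aniso \<A> A D) c a i j v * snd v c $ j)"
    using nl_from_aniso_nl_of[OF as_aniso_in] assms(1) unfolding nl_from_aniso_def by blast
  then show ?thesis
    using christoffel_as_aniso(1)[OF assms(1,3,2) refl] by simp
qed

lemma nl_of_as_aniso_linear: "nl_of \<A> A (as_aniso \<A> A D) \<in> linear_connections \<A> A"
  unfolding linear_connections_def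
proof (intro CollectI conjI ballI nl_of_in as_aniso_in)
  fix c assume c: "c \<in> \<A>"
  let ?G = "\<lambda>a i j p. christoffel \<A> (as_aniso \<A> A D) c a i j (over p)"
  have "smooth_on (snd c ` fst c) (?G a i j \<circ> chart_inv c)" for a i j
    using smooth_on_chart_iff[OF c openin_domain[OF c], of "?G a i j"] christoffel_as_aniso(2)[OF c]
    by (simp add: comp_def)
  moreover have "nl_comp \<A> (nl_of \<A> A (as_aniso \<A> A D)) c i a v =
      (\<Sum>j\<in>UNIV. ?G a i j (fst v) * snd v c $ j)" if "v \<in> dom_in \<A> A c" for v i a
    using nl_comp_as_aniso[OF c] that by (simp add: dom_in_iff)
  ultimately show "\<exists>G :: 'n \<Rightarrow> 'n \<Rightarrow> 'n \<Rightarrow> 'a \<Rightarrow> real. (\<forall>a i j. smooth_on (snd c ` fst c) (G a i j \<circ> chart_inv c)) \<and>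
      (\<forall>v\<in>dom_in \<A> A c. \<forall>i a. nl_comp \<A> (nl_of \<A> A (as_aniso \<A> A D)) c i a v =
        (\<Sum>j\<in>UNIV. G a i j (fst v) * snd v c $ j))"
    by (intro exI[of _ ?G]) blast
qed

end

text \<open>The component is linear in the fibre coordinate with coefficients from the base, so its
  vertical derivative returns the coefficients.\<close>

lemma christoffel_aniso_of_linear:
  assumes H: "H \<in> nonlinear_connections \<A> A" and c: "c \<in> \<A>" and v: "v \<in> A" "fst v \<in> fst c"
    and K: "\<And>a i j. msmooth \<A> (K a i j) (fst v)"
    and comp: "\<And>v i a. v \<in> A \<Longrightarrow> fst v \<in> fst c \<Longrightarrow>
      nl_comp \<A> H c i a v = (\<Sum>j\<in>UNIV. K a i j (fst v) * snd v c $ j)"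
  shows "christoffel \<A> (aniso_of \<A> A H) c a i j v = K a i j (fst v)"
proof -
  have vTM: "v \<in> TM"
    using A_TM v by blast
  let ?P = "\<lambda>q y. \<Sum>j\<in>UNIV. y $ j *\<^sub>R K a i j q"
  have lin: "linear (?P q)" for q
    by (rule linearI) (simp_all add: algebra_simps sum.distrib sum_distrib_left)
  have "christoffel \<A> (aniso_of \<A> A H) c a i j v = partial_y \<A> c j (nl_comp \<A> H c i a) v"
    using aniso_from_nl_aniso_of[OF H] c v unfolding aniso_from_nl_def by (simp add: dom_in_iff)
  also have "\<dots> = mderiv (T c) (nl_comp \<A> H c i a) v (0, axis j 1)"
    by (simp add: partial_y_def mderiv_def comp_def)
  also have "\<dots> = mderiv (T c) (\<lambda>v. ?P (fst v) (snd v c)) v (0, axis j 1)"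
  proof (intro fun_cong[OF TM.mderiv_cong[OF T_in[OF c] A_in_T[OF v]]])
    show "eventually (\<lambda>v. nl_comp \<A> H c i a v = ?P (fst v) (snd v c)) (nhdsin TM.mtop v)"
      using eventually_dom[OF c v] by eventually_elim (simp add: comp mult.commute)
  qed
  also have "\<dots> = ?P (fst v) (mderiv (T c) (\<lambda>v. snd v c) v (0, axis j 1))"
  proof (rule mderiv_vertical[OF c v _ _ msmooth_fibre[OF c vTM v(2)]])
    show "msmooth \<A> (\<lambda>q. ?P q b) (fst v)" for b
      by (intro msmooth_sum msmooth_scaleR msmooth_const K A_points v)
  qed (rule always_eventually, rule allI, rule lin)
  also have "\<dots> = K a i j (fst v)"
    unfolding mderiv_fibre[OF c vTM v(2)] snd_conv by (rule sum_axis_scaleR)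
  finally show ?thesis .
qed

text \<open>On affine connections \<open>aniso_of\<close> is a left inverse of \<open>nl_of\<close>;
  the injectivity in the final bijection rests on this.\<close>

lemma aniso_of_nl_of_as_aniso:
  assumes D: "D \<in> affine_connections \<A>"
  shows "aniso_of \<A> A (nl_of \<A> A (as_aniso \<A> A D)) = as_aniso \<A> A D"
proof (rule aniso_connections_eqI)
  note H = nl_of_in[OF as_aniso_in[OF D]]
  show "aniso_of \<A> A (nl_of \<A> A (as_aniso \<A> A D)) \<in> aniso_connections \<A> A"
    by (rule aniso_of_in[OF H])
  show "as_aniso \<A> A D \<in> aniso_connections \<A> A"
    by (rule as_aniso_in[OF D])
  fix c v a i j assume cv: "c \<in> \<A>" "v \<in> A" "fst v \<in> fst c"
  show "christoffel \<A> (aniso_of \<A> A (nl_of \<A> A (as_aniso \<A> A D))) c a i j v =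
      christoffel \<A> (as_aniso \<A> A D) c a i j v"
    unfolding christoffel_as_aniso(1)[OF D cv(1,3,2) refl]
    by (rule christoffel_aniso_of_linear[OF H cv christoffel_as_aniso(2)[OF D cv(1,3)]
          nl_comp_as_aniso[OF D cv(1)]])
qed

text \<open>Every point of the manifold is the base point of some vector in \<open>A\<close>, so no
  value of \<open>D\<close> is lost.\<close>

lemma as_aniso_inj:
  assumes D: "D \<in> affine_connections \<A>" "D' \<in> affine_connections \<A>"
    and eq: "as_aniso \<A> A D = as_aniso \<A> A D'"
  shows "D = D'"
proof (intro ext)
  fix X Y p
  have "D X Y p = D' X Y p"
  proof -
    consider "X \<notin> vector_fields \<A>" | "X \<in> vector_fields \<A>" "Y \<notin> vector_fields \<A>"
      | "X \<in> vector_fields \<A>" "Y \<in> vector_fields \<A>" by blast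
    then show ?thesis
    proof cases
      case 1
      then show ?thesis
        using PiE_arb[OF affine_PiE[OF D(1)] 1] PiE_arb[OF affine_PiE[OF D(2)] 1] by simp
    next
      case 2
      show ?thesis
        using PiE_arb[OF PiE_mem[OF affine_PiE[OF D(1)] 2(1)] 2(2)]
          PiE_arb[OF PiE_mem[OF affine_PiE[OF D(2)] 2(1)] 2(2)] by simp
    next
      case 3
      show ?thesis
      proof (cases "p \<in> points \<A>")
        case True
        have "as_aniso \<A> A D X Y (over p) = as_aniso \<A> A D' X Y (over p)"
          by (simp only: eq)
        then show ?thesis
          using over[OF True] by (simp add: as_aniso_apply[OF D(1) 3] as_aniso_apply[OF D(2) 3])
      next
        case False
        then show ?thesis
          using affine_field[OF D(1) 3] affine_field[OF D(2) 3] by (simp add: vector_fields_def)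
      qed
    qed
  qed
  then show "D X Y p c = D' X Y p c" for c
    by simp
qed

text \<open>The vertical derivative of a linear connection is an anisotropic connection whose
  Christoffel symbols depend on the base point only. Hence it is constant on the fibres of
  \<open>A\<close> and descends to the manifold.\<close>

lemma ex_affine_of_linear:
  assumes H: "H \<in> linear_connections \<A> A"
  shows "\<exists>D\<in>affine_connections \<A>. nl_of \<A> A (as_aniso \<A> A D) = H"
proof -
  have Hn: "H \<in> nonlinear_connections \<A> A"
    using H unfolding linear_connections_def by blast
  define D' where "D' = aniso_of \<A> A H"
  have D': "D' \<in> aniso_connections \<A> A"
    unfolding D'_def by (rule aniso_of_in[OF Hn])
  have "\<forall>c\<in>\<A>. \<exists>K. (\<forall>a i j. \<forall>p\<in>fst c. msmooth \<A> (K a i j) p) \<and>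
      (\<forall>v\<in>A. fst v \<in> fst c \<longrightarrow> (\<forall>i a. nl_comp \<A> H c i a v = (\<Sum>j\<in>UNIV. K a i j (fst v) * snd v c $ j)))"
    (is "\<forall>c\<in>\<A>. \<exists>K. ?Q c K")
  proof
    fix c assume c: "c \<in> \<A>"
    obtain K :: "'n \<Rightarrow> 'n \<Rightarrow> 'n \<Rightarrow> 'a \<Rightarrow> real" where
      K: "\<forall>a i j. smooth_on (snd c ` fst c) (K a i j \<circ> chart_inv c)"
      and HK: "\<forall>v\<in>dom_in \<A> A c. \<forall>i a. nl_comp \<A> H c i a v = (\<Sum>j\<in>UNIV. K a i j (fst v) * snd v c $ j)"
      using H c unfolding linear_connections_def by blast
    have "msmooth \<A> (K a i j) p" if "p \<in> fst c" for a i j p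
      using smooth_on_chart_iff[OF c openin_domain[OF c], of "K a i j"] K that by (simp add: comp_def)
    then show "\<exists>K. ?Q c K"
      using HK dom_in_iff by (intro exI[of _ K]) blast
  qed
  \<comment> \<open>The coefficients are chosen chart by chart. Their transformation law need not be
    checked, as they turn out to be the Christoffel symbols of \<open>D'\<close>, which is already a
    connection.\<close>
  from bchoice[OF this] obtain K where KQ: "\<forall>c\<in>\<A>. ?Q c (K c)" ..
  have K: "msmooth \<A> (K c a i j) p" if "c \<in> \<A>" "p \<in> fst c" for c a i j p
    using bspec[OF KQ that(1)] that(2) by blast
  have HK: "nl_comp \<A> H c i a v = (\<Sum>j\<in>UNIV. K c a i j (fst v) * snd v c $ j)"
    if "c \<in> \<A>" "v \<in> A" "fst v \<in> fst c" for c v i a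
    using bspec[OF KQ that(1)] that(2,3) by blast
  have ch: "christoffel \<A> D' c a i j v = K c a i j (fst v)" if "c \<in> \<A>" "v \<in> A" "fst v \<in> fst c" for c a i j v
    unfolding D'_def
    by (rule christoffel_aniso_of_linear[where K = "K c", OF Hn that K[OF that(1,3)] HK[OF that(1)]])
  have formula: "D' X Y v c = mderiv c (\<lambda>q. Y q c) (fst v) (X (fst v) c) +
      (\<Sum>i\<in>UNIV. \<Sum>j\<in>UNIV. (X (fst v) c $ i * Y (fst v) c $ j) *\<^sub>R (\<chi> a. K c a i j (fst v)))"
    if "X \<in> vector_fields \<A>" "Y \<in> vector_fields \<A>" "c \<in> \<A>" "v \<in> A" "fst v \<in> fst c" for X Y c v
    unfolding aniso_conn_formula[OF D' that(3,4,5,1,2)] Gam_def by (simp add: ch[OF that(3,4,5)])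
  have base: "D' X Y v = D' X Y (over (fst v))"
    if XY: "X \<in> vector_fields \<A>" "Y \<in> vector_fields \<A>" and v: "v \<in> A" for X Y v
  proof -
    obtain c where c: "c \<in> \<A>" "fst v \<in> fst c"
      using v by (rule A_chartE)
    have o: "over (fst v) \<in> A" "fst (over (fst v)) = fst v"
      using over[OF A_points[OF v]] by blast+
    show ?thesis
    proof (rule tangent_eqI[OF aniso_conn_tangent[OF D' XY v] _ c])
      show "D' X Y (over (fst v)) \<in> tangent_space \<A> (fst v)"
        using aniso_conn_tangent[OF D' XY o(1)] o(2) by simp
      show "D' X Y v c = D' X Y (over (fst v)) c"
        using formula[OF XY c(1) v c(2)] formula[OF XY c(1) o(1)] c(2) o(2) by simp
    qed
  qed
  \<comment> \<open>The value at \<open>p\<close> is read off at one vector over \<open>p\<close>;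
    by \<open>base\<close> any other vector of \<open>A\<close> over \<open>p\<close> gives the
    same.\<close>
  define D where "D = (\<lambda>X\<in>vector_fields \<A>. \<lambda>Y\<in>vector_fields \<A>. \<lambda>p. if p \<in> points \<A> then D' X Y (over p) else 0)"
  have D_apply: "D X Y p = (if p \<in> points \<A> then D' X Y (over p) else 0)"
    if "X \<in> vector_fields \<A>" "Y \<in> vector_fields \<A>" for X Y p
    using that by (simp add: D_def)
  have D_field: "D X Y \<in> vector_fields \<A>" if XY: "X \<in> vector_fields \<A>" "Y \<in> vector_fields \<A>" for X Y
  proof (rule vector_fieldsI)
    fix p
    show "D X Y p \<in> tangent_space \<A> p"
    proof (cases "p \<in> points \<A>")
      case True
      then show ?thesis
        using aniso_conn_tangent[OF D' XY, of "over p"] over[OF True] by (simp add: D_apply[OF XY])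
    next
      case False
      then show ?thesis
        unfolding D_apply[OF XY] by (simp add: tangent_0)
    qed
  next
    fix p assume p: "p \<in> points \<A>"
    obtain c where c: "c \<in> \<A>" "p \<in> fst c"
      using p by (rule in_pointsE)
    \<comment> \<open>Smoothness cannot be read off from the definition through \<open>over\<close>,
      so \<open>D X Y\<close> is replaced by its coordinate formula with the smooth coefficients
      \<open>K\<close>.\<close>
    have "eventually (\<lambda>q. mderiv c (\<lambda>q. Y q c) q (X q c) +
        (\<Sum>i\<in>UNIV. \<Sum>j\<in>UNIV. (X q c $ i * Y q c $ j) *\<^sub>R (\<chi> a. K c a i j q)) = D X Y q c) (nhdsin mtop p)"
      using eventually_in_domain[OF c]
    proof eventually_elim
      fix q assume q: "q \<in> fst c"
      have o: "over q \<in> A" "fst (over q) = q"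
        using over[OF chart_in_points[OF c(1) q]] by blast+
      show "mderiv c (\<lambda>q. Y q c) q (X q c) +
          (\<Sum>i\<in>UNIV. \<Sum>j\<in>UNIV. (X q c $ i * Y q c $ j) *\<^sub>R (\<chi> a. K c a i j q)) = D X Y q c"
        using formula[OF XY c(1) o(1)] o(2) q chart_in_points[OF c(1) q] by (simp add: D_apply[OF XY])
    qed
    moreover have "msmooth \<A> (\<lambda>q. mderiv c (\<lambda>q. Y q c) q (X q c) +
        (\<Sum>i\<in>UNIV. \<Sum>j\<in>UNIV. (X q c $ i * Y q c $ j) *\<^sub>R (\<chi> a. K c a i j q))) p"
    proof -
      have sK: "msmooth \<A> (\<lambda>q. \<chi> a. K c a i j q) p" for i j
        unfolding msmooth_vec_iff vec_lambda_beta using K[OF c] by blast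
      have sXY: "msmooth \<A> (\<lambda>q. X q c $ i) p" "msmooth \<A> (\<lambda>q. Y q c $ i) p" for i
        by (intro msmooth_linear[OF bounded_linear_vec_nth] vector_fields_msmooth XY c)+
      show ?thesis
        by (intro msmooth_add msmooth_sum p msmooth_scaleR[OF msmooth_mult[OF sXY(1) sXY(2)] sK]
            msmooth_mderiv c vector_fields_msmooth XY)
    qed
    ultimately have "msmooth \<A> (\<lambda>q. D X Y q c) p"
      by (rule msmooth_cong)
    then show "\<exists>c\<in>\<A>. p \<in> fst c \<and> msmooth \<A> (\<lambda>q. D X Y q c) p"
      using c by blast
  qed
  have "D \<in> affine_connections \<A>"
    unfolding affine_connections_def
  proof (intro CollectI conjI ballI allI impI)
    have "D X \<in> extensional (vector_fields \<A>)" if "X \<in> vector_fields \<A>" for X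
      using that by (simp add: D_def)
    then show "D \<in> vector_fields \<A> \<rightarrow>\<^sub>E vector_fields \<A> \<rightarrow>\<^sub>E vector_fields \<A>"
      using D_field by (intro PiE_I) (auto simp: D_def)
  next
    fix X Y Z assume XYZ: "X \<in> vector_fields \<A>" "Y \<in> vector_fields \<A>" "Z \<in> vector_fields \<A>"
    have "D (X + Y) Z p = D X Z p + D Y Z p" "D X (Y + Z) p = D X Y p + D X Z p" for p
      by (cases "p \<in> points \<A>"; simp only: plus_fun_apply D_apply vector_fields_add
          aniso_conn_add[OF D'] XYZ add_0_right if_True if_False)+
    then show "D (X + Y) Z = D X Z + D Y Z" "D X (Y + Z) = D X Y + D X Z"
      by (intro ext; simp only: plus_fun_apply)+
  next
    fix X Y f p assume XY: "X \<in> vector_fields \<A>" "Y \<in> vector_fields \<A>" and f: "smooth_fun \<A> f"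
      and p: "p \<in> points \<A>"
    have o: "over p \<in> A" "fst (over p) = p"
      using over[OF p] by blast+
    show "D X (\<lambda>p. f p *\<^sub>R Y p) p = dir_deriv \<A> p (X p) f *\<^sub>R Y p + f p *\<^sub>R D X Y p"
      using aniso_conn_Leibniz[OF D' XY f o(1)]
      by (simp only: D_apply vector_fields_scale XY f p o(2) if_True)
  next
    fix X Y Z f h p
    assume XYZ: "X \<in> vector_fields \<A>" "Y \<in> vector_fields \<A>" "Z \<in> vector_fields \<A>"
      and fh: "smooth_fun \<A> f \<and> smooth_fun \<A> h" and p: "p \<in> points \<A>"
    have o: "over p \<in> A" "fst (over p) = p"
      using over[OF p] by blast+
    have W: "(\<lambda>p. f p *\<^sub>R X p + h p *\<^sub>R Y p) \<in> vector_fields \<A>"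
      using vector_fields_add[OF vector_fields_scale vector_fields_scale, of X f Y h] XYZ fh
      by (simp add: plus_fun_def)
    have "D' (\<lambda>p. f p *\<^sub>R X p + h p *\<^sub>R Y p) Z (over p) =
        f (fst (over p)) *\<^sub>R D' X Z (over p) + h (fst (over p)) *\<^sub>R D' Y Z (over p)"
      using D' XYZ fh o(1) unfolding aniso_connections_def by blast
    then show "D (\<lambda>p. f p *\<^sub>R X p + h p *\<^sub>R Y p) Z p = f p *\<^sub>R D X Z p + h p *\<^sub>R D Y Z p"
      by (simp only: D_apply W XYZ p o(2) if_True)
  qed
  moreover have "as_aniso \<A> A D = D'"
  proof (rule aniso_connections_eqI[OF as_aniso_in[OF calculation] D'])
    fix c v a i j assume cv: "c \<in> \<A>" "v \<in> A" "fst v \<in> fst c"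
    obtain E where E: "\<And>i. E i \<in> vector_fields \<A>"
      "\<And>i. eventually (\<lambda>q. E i q = coord_field \<A> c i q) (nhdsin mtop (fst v))"
      using ex_coord_field[OF cv(1,3)] by blast
    show "christoffel \<A> (as_aniso \<A> A D) c a i j v = christoffel \<A> D' c a i j v"
      unfolding christoffel_eq[OF as_aniso_in[OF \<open>D \<in> _\<close>] cv E E] christoffel_eq[OF D' cv E E]
        as_aniso_apply[OF \<open>D \<in> _\<close> E(1) E(1)] D_apply[OF E(1) E(1)]
      using base[OF E(1) E(1) cv(2)] cv(2) A_points[OF cv(2)] by simp
  qed
  moreover have "nl_of \<A> A D' = H"
  proof (rule nl_of_eqI)
    show "nl_from_aniso \<A> A D' H"
      unfolding nl_from_aniso_def using Hn HK ch by (simp add: dom_in_iff)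
  qed
  ultimately show ?thesis
    by auto
qed

lemma bij_betw_affine_linear:
  "bij_betw (\<lambda>D. nl_of \<A> A (as_aniso \<A> A D)) (affine_connections \<A>) (linear_connections \<A> A)"
  unfolding bij_betw_def
proof
  show "inj_on (\<lambda>D. nl_of \<A> A (as_aniso \<A> A D)) (affine_connections \<A>)"
  proof (rule inj_onI)
    fix D D' assume D: "D \<in> affine_connections \<A>" "D' \<in> affine_connections \<A>"
      and eq: "nl_of \<A> A (as_aniso \<A> A D) = nl_of \<A> A (as_aniso \<A> A D')"
    have "as_aniso \<A> A D = as_aniso \<A> A D'"
      using aniso_of_nl_of_as_aniso[OF D(1)] unfolding eq aniso_of_nl_of_as_aniso[OF D(2)] by (rule sym)
    then show "D = D'"
      by (rule as_aniso_inj[OF D])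
  qed
  show "(\<lambda>D. nl_of \<A> A (as_aniso \<A> A D)) ` affine_connections \<A> = linear_connections \<A> A"
    using nl_of_as_aniso_linear ex_affine_of_linear by blast
qed

lemma nl_of_image_homogeneous:
  "nl_of \<A> A ` {D \<in> aniso_connections \<A> A. homogeneous_aniso \<A> A D} =
    {H \<in> nonlinear_connections \<A> A. homogeneous_nl \<A> A H}"
proof (intro equalityI subsetI)
  fix H assume "H \<in> {H \<in> nonlinear_connections \<A> A. homogeneous_nl \<A> A H}"
  then have H: "H \<in> nonlinear_connections \<A> A" "homogeneous_nl \<A> A H"
    by simp_all
  then show "H \<in> nl_of \<A> A ` {D \<in> aniso_connections \<A> A. homogeneous_aniso \<A> A D}"
    by (intro image_eqI[of _ _ "aniso_of \<A> A H"])
      (simp_all add: nl_of_aniso_of aniso_of_in homogeneous_aniso_of)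
qed (auto intro: nl_of_in homogeneous_nl_of)

end

theorem theorem2:
  fixes \<A> :: "('a, real^'n::finite) chart set"
    and A :: "('a, real^'n) tpoint set"
  assumes "smooth_manifold \<A>"
    and "openin (atlas_topology (T_atlas \<A>)) A"
    and "A \<subseteq> {v \<in> tangent_bundle \<A>. snd v \<noteq> 0}"
    and "conic_set A"
    and "fst ` A = points \<A>"
  shows
    "(\<forall>D\<in>aniso_connections \<A> A.
        (\<exists>!H. nl_from_aniso \<A> A D H) \<and>
        nl_of \<A> A D \<in> nonlinear_connections \<A> A \<and>
        (\<forall>c\<in>\<A>. \<forall>v\<in>dom_in \<A> A c. \<forall>i a.
           nl_comp \<A> (nl_of \<A> A D) c i a v =
             (\<Sum>j\<in>UNIV. christoffel \<A> D c a i j v * snd v c $ j)) \<and>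
        (homogeneous_aniso \<A> A D \<longrightarrow> homogeneous_nl \<A> A (nl_of \<A> A D)))
     \<and>
     (\<forall>H\<in>nonlinear_connections \<A> A.
        (\<exists>!D. aniso_from_nl \<A> A H D) \<and>
        aniso_of \<A> A H \<in> aniso_connections \<A> A \<and>
        (\<forall>c\<in>\<A>. \<forall>v\<in>dom_in \<A> A c. \<forall>a i j.
           christoffel \<A> (aniso_of \<A> A H) c a i j v =
             partial_y \<A> c j (nl_comp \<A> H c i a) v) \<and>
        (homogeneous_nl \<A> A H \<longrightarrow>
           homogeneous_aniso \<A> A (aniso_of \<A> A H) \<and> nl_of \<A> A (aniso_of \<A> A H) = H))
     \<and>
     nl_of \<A> A ` {D \<in> aniso_connections \<A> A. homogeneous_aniso \<A> A D} =
       {H \<in> nonlinear_connections \<A> A. homogeneous_nl \<A> A H}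
     \<and>
     (\<forall>H\<in>nonlinear_connections \<A> A. homogeneous_nl \<A> A H \<longrightarrow>
        {D \<in> aniso_connections \<A> A. nl_of \<A> A D = H} =
        {add_tensor \<A> A (aniso_of \<A> A H) Q |Q. Q \<in> aniso_tensors_1_2 \<A> A \<and>
           (\<forall>c\<in>\<A>. \<forall>v\<in>dom_in \<A> A c. \<forall>i k.
              (\<Sum>j\<in>UNIV. tensor_comp \<A> Q c i j k v * snd v c $ j) = 0)})
     \<and>
     (\<forall>D\<in>affine_connections \<A>. as_aniso \<A> A D \<in> aniso_connections \<A> A) \<and>
     bij_betw (\<lambda>D. nl_of \<A> A (as_aniso \<A> A D)) (affine_connections \<A>) (linear_connections \<A> A)"
proof -
  interpret smooth_atlas \<A>
    by (rule smooth_manifold_smooth_atlas[OF assms(1)])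
  interpret conic_domain \<A> A
    by unfold_locales (use assms in \<open>simp_all add: smooth_manifold_def\<close>)
  have 1: "(\<exists>!H. nl_from_aniso \<A> A D H) \<and> nl_of \<A> A D \<in> nonlinear_connections \<A> A \<and>
        (\<forall>c\<in>\<A>. \<forall>v\<in>dom_in \<A> A c. \<forall>i a.
           nl_comp \<A> (nl_of \<A> A D) c i a v =
             (\<Sum>j\<in>UNIV. christoffel \<A> D c a i j v * snd v c $ j)) \<and>
        (homogeneous_aniso \<A> A D \<longrightarrow> homogeneous_nl \<A> A (nl_of \<A> A D))"
    if D: "D \<in> aniso_connections \<A> A" for D
  proof -
    note u = nl_from_aniso_nl_of[OF D, unfolded nl_from_aniso_def]
    show ?thesis
      by (intro conjI impI ex1_nl_from_aniso[OF D] conjunct1[OF u] conjunct2[OF u] homogeneous_nl_of[OF D])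
  qed
  have 2: "(\<exists>!D. aniso_from_nl \<A> A H D) \<and> aniso_of \<A> A H \<in> aniso_connections \<A> A \<and>
        (\<forall>c\<in>\<A>. \<forall>v\<in>dom_in \<A> A c. \<forall>a i j.
           christoffel \<A> (aniso_of \<A> A H) c a i j v =
             partial_y \<A> c j (nl_comp \<A> H c i a) v) \<and>
        (homogeneous_nl \<A> A H \<longrightarrow>
           homogeneous_aniso \<A> A (aniso_of \<A> A H) \<and> nl_of \<A> A (aniso_of \<A> A H) = H)"
    if H: "H \<in> nonlinear_connections \<A> A" for H
  proof -
    note u = aniso_from_nl_aniso_of[OF H, unfolded aniso_from_nl_def]
    show ?thesis
      by (intro conjI impI ex1_aniso_from_nl[OF H] conjunct1[OF u] conjunct2[OF u]
          homogeneous_aniso_of[OF H] nl_of_aniso_of[OF H])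
  qed
  show ?thesis
    by (intro conjI ballI impI 1 2 nl_of_image_homogeneous nl_of_fibre as_aniso_in bij_betw_affine_linear)
qed

end
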